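(* For every integer $\ell\ge 2$ there exists a constant $c>0$ such that the following holds. Let $$p_0=c\,n^{-\frac{4\ell-3}{4\ell-2}}(\log n)^{\frac{4\ell^2+\ell-4}{2\ell-2}},\qquad p_1=n^{-\frac{(\ell-1)(4\ell-3)}{4\ell^2-5\ell+2}}(\log n)^{3+\frac{2\ell-2}{4\ell^2-5\ell+2}}.$$ Then asymptotically almost surely $$\mathrm{ex}(G^3_{n,p},C^3_{2\ell})\le\begin{cases} c\,p^{\frac{2(\ell-1)}{\ell(4\ell-3)}}n^{1+\frac{1}{\ell}}(\log n)^{3-\frac{4\ell-4}{\ell(4\ell-3)}}, & \text{if } p_0\le p<p_1,\\ c\,p\,n^2, & \text{if } p\ge p_1.\end{cases}$$
   Context: $G^3_{n,p}$ is the random $3$-uniform hypergraph on $[n]$ in which each $3$-subset is an edge independently with probability $p$. For a $3$-graph $F$, $\mathrm{ex}(G^3_{n,p},F)$ is the maximum number of edges in an $F$-free subgraph of $G^3_{n,p}$. Asymptotically almost surely means with probability tending to $1$ as $n\to\infty$. For $k\ge 3$ and $r\ge 3$, the $r$-uniform linear cycle $C^r_k$ is the $r$-graph with vertices $v_1,\dots,v_{k(r-1)}$ and edges $e_i=\{v_{(i-1)(r-1)},\dots,v_{i(r-1)}\}$, $1\le i\le k$, where $v_0=v_{k(r-1)}$. *)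

theory Defs
  imports "HOL-Probability.Probability"
begin

(* A hypergraph is given by its set of edges. This loses only isolated vertices, which the
   linear cycles do not have. *)
type_synonym 'a hypergraph = "'a set set"

definition complete_hypergraph :: "nat \<Rightarrow> nat \<Rightarrow> nat hypergraph" where
  "complete_hypergraph r n = {e. e \<subseteq> {1..n} \<and> card e = r}"

definition random_hypergraph :: "nat \<Rightarrow> nat \<Rightarrow> real \<Rightarrow> nat hypergraph pmf" where
  "random_hypergraph r n p =
     map_pmf (\<lambda>b. {e \<in> complete_hypergraph r n. b e})
       (Pi_pmf (complete_hypergraph r n) False (\<lambda>_. bernoulli_pmf p))"

(* Not necessarily induced copies. *)
definition contains_copy :: "'a hypergraph \<Rightarrow> 'b hypergraph \<Rightarrow> bool" where
  "contains_copy H F \<longleftrightarrow> (\<exists>f. inj_on f (\<Union>F) \<and> (\<forall>e\<in>F. f ` e \<in> H))"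

(* Meant for finite H and nonempty F; then the empty hypergraph is F-free and Max is well defined. *)
definition ex_in :: "'a hypergraph \<Rightarrow> 'b hypergraph \<Rightarrow> nat" where
  "ex_in H F = Max {card G | G. G \<subseteq> H \<and> \<not> contains_copy G F}"

(* The vertex v_j is the residue of j modulo k(r-1), which identifies v_0 with v_{k(r-1)}. *)
definition linear_cycle :: "nat \<Rightarrow> nat \<Rightarrow> nat hypergraph" where
  "linear_cycle r k =
     {(\<lambda>j. j mod (k * (r - 1))) ` {(i - 1) * (r - 1)..i * (r - 1)} | i. i \<in> {1..k}}"

definition p0 :: "real \<Rightarrow> nat \<Rightarrow> nat \<Rightarrow> real" where
  "p0 c l n =
     c * real n powr (- ((4 * real l - 3) / (4 * real l - 2)))
       * ln (real n) powr ((4 * (real l)\<^sup>2 + real l - 4) / (2 * real l - 2))"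

definition p1 :: "nat \<Rightarrow> nat \<Rightarrow> real" where
  "p1 l n =
     real n powr (- (((real l - 1) * (4 * real l - 3)) / (4 * (real l)\<^sup>2 - 5 * real l + 2)))
       * ln (real n) powr (3 + (2 * real l - 2) / (4 * (real l)\<^sup>2 - 5 * real l + 2))"

end

theory Submission
  imports Defs
begin

text \<open>
  It suffices to cover all subgraphs without a linear cycle by few containers with at most \<open>N\<^sub>0\<close> edges each:
  a union bound over the containers then limits their intersections with the random hypergraph.

  A container with more than \<open>N\<^sub>0\<close> edges is refined by means of a balanced family of linear cycles
  in it. If at least half of its edges contain a pair of small codegree, then one dyadic class of such pairs is a
  graph with many edges, and a balanced family of graph cycles in it is expanded by third vertices.
  Otherwise at least half of the edges contain only pairs of large codegree, and linear cycles are
  found greedily. The threshold between the two cases is chosen so that both fingerprints have about the same size.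
  Balanced families are obtained by a maximality argument: if a family with bounded degrees could not be
  extended although it is small, then a random set of vertices would span few saturated sets,
  but still enough edges for a new cycle.

  Even cycles in a graph are counted by the trace of the \<open>2 * l\<close>-th power of the
  normalized adjacency matrix, which is at least 1. Closed walks with a repeated vertex contribute at
  most half of it, because the diagonal entries of the even powers are log-convex.
\<close>

section \<open>Hypergraph containers\<close>

text \<open>The exponents come from balancing costs, with \<open>L = ln n\<close>. A light step
  gains only a fraction of order \<open>1 / L\<close> of a container, because one of about
  \<open>L\<close> dyadic classes is used, and creates \<open>exp (O(X L))\<close> containers. A
  heavy step gains a constant fraction, so it may create \<open>exp (O(X L^2))\<close> containers at
  the same rate. Shrinking all triples to size \<open>N\<^sub>0\<close> takes \<open>O(L)\<close>
  units of this rate, so there are \<open>exp (O(X L^3))\<close> containers in total. The union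
  bound wants \<open>p N\<^sub>0\<close> to be of order \<open>X L^3\<close>, hence
  \<open>N\<^sub>0 = K L^3 X / p\<close>; inserting this into the condition \<open>heavy\<close>
  determines \<open>X\<close> as the product of powers of \<open>p\<close>, \<open>n\<close> and
  \<open>L\<close> in the theorem. At \<open>p0\<close> (with constant 1) this \<open>X\<close>
  equals \<open>n powr (1 + 1 / (2 l - 1)) * L\<close>, about the least fingerprint for which
  balanced families of graph cycles are large enough. At \<open>p1\<close> the quantity
  \<open>L^3 X / p\<close> has dropped to \<open>n^2\<close>; smaller containers cannot be reached,
  since the average codegree would no longer be a large constant. For larger \<open>p\<close> the
  containers of \<open>p1\<close> are reused, which gives the bound linear in
  \<open>p\<close>.\<close>

text \<open>Hypergraphs carry real weights because links of different vertices are added up during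
  the container construction, so that a set can acquire multiplicity. The total weight is
  \<open>wdeg X h {}\<close>.\<close>

definition wdeg :: "'a set \<Rightarrow> ('a set \<Rightarrow> real) \<Rightarrow> 'a set \<Rightarrow> real" where
  "wdeg X h S = (\<Sum>A | S \<subseteq> A \<and> A \<subseteq> X. h A)"

text \<open>The codegree condition of container theorems: up to the uniformity,
  \<open>wdeg X h {} / card X\<close> is the average degree, and every further vertex of
  \<open>S\<close> has to gain a factor \<tau>.\<close>

definition spread :: "'a set \<Rightarrow> real \<Rightarrow> real \<Rightarrow> ('a set \<Rightarrow> real) \<Rightarrow> bool" where
  "spread X K \<tau> h \<longleftrightarrow> (\<forall>A. 0 \<le> h A) \<and> 0 < wdeg X h {} \<and>
     (\<forall>S. S \<subseteq> X \<longrightarrow> S \<noteq> {} \<longrightarrow> wdeg X h S \<le> K * \<tau> ^ (card S - 1) * wdeg X h {} / card X)"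

definition uniform_wt :: "'a set \<Rightarrow> nat \<Rightarrow> ('a set \<Rightarrow> real) \<Rightarrow> bool" where
  "uniform_wt X k h \<longleftrightarrow> (\<forall>A. A \<subseteq> X \<longrightarrow> h A \<noteq> 0 \<longrightarrow> card A = k)"

definition indep_wt :: "('a set \<Rightarrow> real) \<Rightarrow> 'a set \<Rightarrow> bool" where
  "indep_wt h I \<longleftrightarrow> (\<forall>A. A \<subseteq> I \<longrightarrow> h A = 0)"

lemma wdeg_nonneg: "(\<And>A. 0 \<le> h A) \<Longrightarrow> 0 \<le> wdeg X h S"
  unfolding wdeg_def by (rule sum_nonneg) auto

lemma wdeg_mono:
  assumes "finite X" "\<And>A. g A \<le> h A" shows "wdeg X g S \<le> wdeg X h S"
  unfolding wdeg_def using assms by (intro sum_mono) auto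

lemma wdeg_alt:
  assumes "finite X"
  shows "wdeg X h S = (\<Sum>A\<in>Pow X. if S \<subseteq> A then h A else 0)"
  unfolding wdeg_def using assms by (intro sum.mono_neutral_cong_left) auto

lemma sum_wdeg:
  assumes "finite X" and u: "uniform_wt X k g" and nn: "\<And>A. 0 \<le> g A"
  shows "(\<Sum>S\<in>Pow X. wdeg X g S) = 2 ^ k * wdeg X g {}"
proof -
  have fin: "finite (Pow X)" using assms by simp
  have "(\<Sum>S\<in>Pow X. wdeg X g S) = (\<Sum>S\<in>Pow X. \<Sum>A\<in>Pow X. if S \<subseteq> A then g A else 0)"
    using assms by (simp add: wdeg_alt)
  also have "\<dots> = (\<Sum>A\<in>Pow X. \<Sum>S\<in>Pow X. if S \<subseteq> A then g A else 0)"
    by (rule sum.swap)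
  also have "\<dots> = (\<Sum>A\<in>Pow X. 2 ^ k * g A)"
  proof (rule sum.cong[OF refl])
    fix A assume A: "A \<in> Pow X"
    have fA: "finite A" using A assms finite_subset by auto
    have "{S \<in> Pow X. S \<subseteq> A} = Pow A" using A by auto
    then have "(\<Sum>S\<in>Pow X. if S \<subseteq> A then g A else 0) = real (card (Pow A)) * g A"
      using fin by (simp add: sum.inter_filter[symmetric])
    also have "\<dots> = 2 ^ k * g A"
      using u A fA by (cases "g A = 0") (auto simp: uniform_wt_def card_Pow)
    finally show "(\<Sum>S\<in>Pow X. if S \<subseteq> A then g A else 0) = 2 ^ k * g A" .
  qed
  also have "\<dots> = 2 ^ k * wdeg X g {}"
    by (simp add: wdeg_def sum_distrib_left Pow_def)
  finally show ?thesis .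
qed

lemma sum_wdeg_singleton:
  assumes "finite X" and u: "uniform_wt X k g"
  shows "(\<Sum>v\<in>X. wdeg X g {v}) = k * wdeg X g {}"
proof -
  have "(\<Sum>v\<in>X. wdeg X g {v}) = (\<Sum>v\<in>X. \<Sum>A\<in>Pow X. if v \<in> A then g A else 0)"
    using assms by (simp add: wdeg_alt)
  also have "\<dots> = (\<Sum>A\<in>Pow X. \<Sum>v\<in>X. if v \<in> A then g A else 0)"
    by (rule sum.swap)
  also have "\<dots> = (\<Sum>A\<in>Pow X. k * g A)"
  proof (rule sum.cong[OF refl])
    fix A assume A: "A \<in> Pow X"
    have "{v \<in> X. v \<in> A} = A" using A by auto
    then have "(\<Sum>v\<in>X. if v \<in> A then g A else 0) = real (card A) * g A"
      using assms by (simp add: sum.inter_filter[symmetric])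
    also have "\<dots> = k * g A"
      using u A by (cases "g A = 0") (auto simp: uniform_wt_def)
    finally show "(\<Sum>v\<in>X. if v \<in> A then g A else 0) = k * g A" .
  qed
  also have "\<dots> = k * wdeg X g {}"
    by (simp add: wdeg_def sum_distrib_left Pow_def)
  finally show ?thesis .
qed

text \<open>Vertices of degree below a quarter of \<open>M / card X\<close> carry at most
  \<open>M / 4\<close> in total, so the others carry at least \<open>M / 4\<close>; as each of these
  has degree at most \<open>K * M / card X\<close>, there are at least
  \<open>card X / (4 * K)\<close> of them.\<close>

lemma low_degree_card:
  assumes fin: "finite X" and ne: "X \<noteq> {}" and K: "K > 0" and M: "M > 0"
    and tot: "M / 2 \<le> (\<Sum>v\<in>X. d v)" and up: "\<And>v. v \<in> X \<Longrightarrow> d v \<le> K * M / card X"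
  shows "real (card {v \<in> X. d v < M / (4 * card X)}) \<le> (1 - 1 / (4 * K)) * card X"
proof -
  let ?L = "{v \<in> X. d v < M / (4 * card X)}"
  have N: "real (card X) > 0" using fin ne by (simp add: card_gt_0_iff)
  have split: "(\<Sum>v\<in>X. d v) = (\<Sum>v\<in>?L. d v) + (\<Sum>v\<in>X - ?L. d v)"
    using fin by (intro sum.subset_diff[THEN trans]) (auto simp: add.commute)
  have "(\<Sum>v\<in>?L. d v) \<le> card ?L * (M / (4 * card X))"
    using sum_bounded_above[of ?L d "M / (4 * card X)"] by force
  also have "\<dots> \<le> card X * (M / (4 * card X))"
    using card_mono[OF fin, of ?L] M by (intro mult_right_mono) auto
  also have "\<dots> = M / 4" using N by simp
  finally have 1: "(\<Sum>v\<in>?L. d v) \<le> M / 4" .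
  have "(\<Sum>v\<in>X - ?L. d v) \<le> card (X - ?L) * (K * M / card X)"
    using sum_bounded_above[of "X - ?L" d "K * M / card X"] up by force
  then have "M / 4 \<le> card (X - ?L) * (K * M / card X)" using tot split 1 by linarith
  then have "M * card X \<le> M * (4 * K * card (X - ?L))"
    using N by (simp add: field_simps)
  then have "card X \<le> 4 * K * card (X - ?L)" using M by simp
  moreover have "real (card (X - ?L)) = real (card X) - card ?L"
    using fin card_mono[OF fin, of ?L] by (subst card_Diff_subset) (auto simp: of_nat_diff)
  ultimately have "card X \<le> 4 * K * (real (card X) - card ?L)" by simp
  then show ?thesis using K by (simp add: field_simps)
qed

definition saturated :: "'a set \<Rightarrow> (nat \<Rightarrow> real) \<Rightarrow> ('a set \<Rightarrow> real) \<Rightarrow> 'a set \<Rightarrow> bool" where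
  "saturated X \<Delta> g S \<longleftrightarrow> S \<noteq> {} \<and> S \<subseteq> X \<and> \<Delta> (card S) \<le> wdeg X g S"

definition trim :: "'a set \<Rightarrow> (nat \<Rightarrow> real) \<Rightarrow> ('a set \<Rightarrow> real) \<Rightarrow> ('a set \<Rightarrow> real) \<Rightarrow> 'a set \<Rightarrow> real" where
  "trim X \<Delta> g h A = (if \<exists>S\<subseteq>A. saturated X \<Delta> g S then 0 else h A)"

definition absorb :: "'a set \<Rightarrow> (nat \<Rightarrow> real) \<Rightarrow> ('a set \<Rightarrow> real) \<Rightarrow> 'a \<Rightarrow> ('a set \<Rightarrow> real) \<Rightarrow> 'a set \<Rightarrow> real" where
  "absorb X \<Delta> h v g A = g A + (if v \<in> A then 0 else trim X \<Delta> g h (insert v A))"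

text \<open>Union bound: every set that loses its weight contains some saturated set and is counted
  in its degree.\<close>

lemma wdeg_trim_lower:
  assumes fin: "finite X" and hn: "\<And>A. 0 \<le> h A"
  shows "wdeg X h {} - (\<Sum>S | saturated X \<Delta> g S. wdeg X h S) \<le> wdeg X (trim X \<Delta> g h) {}"
proof -
  let ?Sat = "{S. saturated X \<Delta> g S}"
  have finS: "finite ?Sat" using fin by (rule_tac finite_subset[of _ "Pow X"]) (auto simp: saturated_def)
  have eq: "{A. {} \<subseteq> A \<and> A \<subseteq> X} = Pow X" by auto
  have "(\<Sum>S\<in>?Sat. wdeg X h S) = (\<Sum>S\<in>?Sat. \<Sum>A\<in>Pow X. if S \<subseteq> A then h A else 0)"
    using assms by (simp add: wdeg_alt)
  also have "\<dots> = (\<Sum>A\<in>Pow X. \<Sum>S\<in>?Sat. if S \<subseteq> A then h A else 0)" by (rule sum.swap)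
  finally have 1: "(\<Sum>S\<in>?Sat. wdeg X h S) = (\<Sum>A\<in>Pow X. \<Sum>S\<in>?Sat. if S \<subseteq> A then h A else 0)" .
  have "h A - trim X \<Delta> g h A \<le> (\<Sum>S\<in>?Sat. if S \<subseteq> A then h A else 0)" for A
  proof (cases "\<exists>S\<subseteq>A. saturated X \<Delta> g S")
    case True
    then obtain S where S: "S \<subseteq> A" "saturated X \<Delta> g S" by auto
    have "(if S \<subseteq> A then h A else 0) \<le> (\<Sum>S\<in>?Sat. if S \<subseteq> A then h A else 0)"
      using S finS hn by (intro member_le_sum) auto
    then show ?thesis using S True by (simp add: trim_def)
  next
    case False
    then have "trim X \<Delta> g h A = h A" unfolding trim_def by (rule if_not_P)
    then show ?thesis using hn by (simp add: sum_nonneg)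
  qed
  then have "(\<Sum>A\<in>Pow X. h A - trim X \<Delta> g h A) \<le> (\<Sum>S\<in>?Sat. wdeg X h S)"
    unfolding 1 by (intro sum_mono)
  then show ?thesis by (simp add: wdeg_def eq sum_subtractf Pow_def)
qed

lemma trim_le: "(\<And>A. 0 \<le> h A) \<Longrightarrow> trim X \<Delta> g h A \<le> h A"
  and trim_nonneg: "(\<And>A. 0 \<le> h A) \<Longrightarrow> 0 \<le> trim X \<Delta> g h A"
  by (auto simp: trim_def)

lemma wdeg_link:
  assumes fin: "finite X" and v: "v \<in> X" "v \<notin> S"
  shows "(\<Sum>A | S \<subseteq> A \<and> A \<subseteq> X. if v \<in> A then 0 else h (insert v A)) = wdeg X h (insert v S)"
proof -
  have finS: "finite {A. S \<subseteq> A \<and> A \<subseteq> X}" using fin by (rule_tac finite_subset[of _ "Pow X"]) auto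
  have "(\<Sum>A | S \<subseteq> A \<and> A \<subseteq> X. if v \<in> A then 0 else h (insert v A))
      = (\<Sum>A | S \<subseteq> A \<and> A \<subseteq> X \<and> v \<notin> A. h (insert v A))"
    using finS by (intro sum.mono_neutral_cong_right) auto
  also have "\<dots> = wdeg X h (insert v S)" unfolding wdeg_def
    using v by (intro sum.reindex_bij_witness[of _ "\<lambda>A. A - {v}" "insert v"]) auto
  finally show ?thesis .
qed

lemma wdeg_absorb_empty:
  assumes "finite X" "v \<in> X"
  shows "wdeg X (absorb X \<Delta> h v g) {} = wdeg X g {} + wdeg X (trim X \<Delta> g h) {v}"
  using wdeg_link[of X v "{}" "trim X \<Delta> g h"] assms
  by (simp add: wdeg_def absorb_def sum.distrib)

text \<open>A saturated \<open>S\<close> gains nothing, since all sets above it have been trimmed;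
  any other \<open>S\<close> is below \<Delta> and gains at most one link degree, which is bounded
  by \<open>D\<close>. So the overshoot above \<Delta> never exceeds \<open>D\<close>.\<close>

lemma wdeg_absorb_le:
  assumes fin: "finite X" and v: "v \<in> X" and hn: "\<And>A. 0 \<le> h A"
    and S: "S \<noteq> {}" "S \<subseteq> X" and D: "0 \<le> D"
    and hb: "v \<notin> S \<Longrightarrow> wdeg X h (insert v S) \<le> D"
    and gb: "wdeg X g S \<le> \<Delta> (card S) + D"
  shows "wdeg X (absorb X \<Delta> h v g) S \<le> \<Delta> (card S) + D"
proof -
  have *: "wdeg X (absorb X \<Delta> h v g) S
     = wdeg X g S + (\<Sum>A | S \<subseteq> A \<and> A \<subseteq> X. if v \<in> A then 0 else trim X \<Delta> g h (insert v A))"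
    by (simp add: wdeg_def absorb_def sum.distrib)
  show ?thesis
  proof (cases "saturated X \<Delta> g S")
    case True
    then have "trim X \<Delta> g h (insert v A) = 0" if "S \<subseteq> A" for A
      using that by (auto simp: trim_def)
    then have "(\<Sum>A | S \<subseteq> A \<and> A \<subseteq> X. if v \<in> A then 0 else trim X \<Delta> g h (insert v A)) = 0"
      by (intro sum.neutral) auto
    then show ?thesis using * gb by simp
  next
    case False
    then have g: "wdeg X g S < \<Delta> (card S)" using S by (auto simp: saturated_def)
    have "(\<Sum>A | S \<subseteq> A \<and> A \<subseteq> X. if v \<in> A then 0 else trim X \<Delta> g h (insert v A)) \<le> D"
    proof (cases "v \<in> S")
      case True
      then have "(\<Sum>A | S \<subseteq> A \<and> A \<subseteq> X. if v \<in> A then 0 else trim X \<Delta> g h (insert v A)) = 0"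
        by (intro sum.neutral) auto
      then show ?thesis using D by simp
    next
      case False
      then have "(\<Sum>A | S \<subseteq> A \<and> A \<subseteq> X. if v \<in> A then 0 else trim X \<Delta> g h (insert v A))
         = wdeg X (trim X \<Delta> g h) (insert v S)" by (intro wdeg_link fin v)
      also have "\<dots> \<le> wdeg X h (insert v S)" by (intro wdeg_mono fin trim_le hn)
      finally show ?thesis using hb False by simp
    qed
    then show ?thesis using * g by simp
  qed
qed

text \<open>The function \<open>g\<close> collects the links of vertices of large degree that the independent set contains.
  Sets that are saturated in \<open>g\<close> are blocked in \<open>h\<close>, which keeps \<open>g\<close> spread. Either \<open>g\<close> becomes heavy
  and replaces \<open>h\<close> with uniformity smaller by one, or all vertices of the independent set have small
  degree in the trimmed \<open>h\<close>, and the vertices of small degree form a container.\<close>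

lemma containers_level:
  fixes X :: "'a set" and K \<tau> :: real and s :: nat
  assumes fin: "finite X" and ne: "X \<noteq> {}" and \<tau>: "\<tau> > 0"
  defines "R \<equiv> nat \<lceil>4 * \<tau> * card X\<rceil>"
  shows "K \<ge> 1 \<Longrightarrow> spread X K \<tau> h \<Longrightarrow> uniform_wt X (Suc i) h \<Longrightarrow> Suc i \<le> s \<Longrightarrow>
    \<exists>\<C>. finite \<C> \<and> \<C> \<noteq> {} \<and> card \<C> \<le> (card X + 1) ^ (i * R) \<and>
      (\<forall>I. I \<subseteq> X \<longrightarrow> indep_wt h I \<longrightarrow> (\<exists>C\<in>\<C>. I \<subseteq> C \<and> C \<subseteq> X \<and>
        real (card C) \<le> (1 - 1 / (4 * K * (1 + 2 ^ s) ^ i)) * card X))"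
proof (induction i arbitrary: h K)
  \<comment> \<open>With uniformity 1, an independent set consists of vertices of degree 0, so the
    low-degree vertices form a single container.\<close>
  case 0
  define C where "C = {v \<in> X. wdeg X h {v} < wdeg X h {} / (4 * card X)}"
  have M: "wdeg X h {} > 0" and hn: "\<And>A. 0 \<le> h A" using 0 by (auto simp: spread_def)
  have up: "wdeg X h {v} \<le> K * wdeg X h {} / card X" if "v \<in> X" for v
    using 0(2) that unfolding spread_def by (auto dest: spec[of _ "{v}"])
  have tot: "wdeg X h {} / 2 \<le> (\<Sum>v\<in>X. wdeg X h {v})"
    using sum_wdeg_singleton[OF fin 0(3)] M by simp
  have C: "real (card C) \<le> (1 - 1 / (4 * K)) * card X"
    unfolding C_def by (intro low_degree_card fin ne M tot up) (use 0 in auto)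
  have "I \<subseteq> C" if I: "I \<subseteq> X" "indep_wt h I" for I
  proof
    fix v assume v: "v \<in> I"
    have "wdeg X h {v} = 0" unfolding wdeg_def
    proof (rule sum.neutral, intro ballI)
      fix A assume A: "A \<in> {A. {v} \<subseteq> A \<and> A \<subseteq> X}"
      show "h A = 0"
      proof (rule ccontr)
        assume "h A \<noteq> 0"
        then have "card A = 1" using 0(3) A by (auto simp: uniform_wt_def)
        then have "A = {v}" using A by (auto simp: card_1_singleton_iff)
        then show False using I v \<open>h A \<noteq> 0\<close> by (auto simp: indep_wt_def)
      qed
    qed
    moreover have "card X > 0" using fin ne by (simp add: card_gt_0_iff)
    ultimately show "v \<in> C" using v I M by (auto simp: C_def)
  qed
  then show ?case using C by (intro exI[of _ "{C}"]) (auto simp: C_def)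
next
  case (Suc i)
  define N where "N = real (card X)"
  define M where "M = wdeg X h {}"
  \<comment> \<open>The factor \<open>2 ^ s\<close> raises the saturation level so far that trimming
    costs at most half of the weight of \<open>h\<close>.\<close>
  define K' where "K' = 2 ^ s * K"
  define \<Delta> where "\<Delta> = (\<lambda>j. K' * \<tau> ^ (j - 1) * (\<tau> * M) / N)"
  define D where "D = (\<lambda>j. K * \<tau> ^ j * M / N)"
  define good where "good = (\<lambda>C. C \<subseteq> X \<and>
     real (card C) \<le> (1 - 1 / (4 * K * (1 + 2 ^ s) ^ Suc i)) * card X)"
  have N: "N > 0" using fin ne by (simp add: card_gt_0_iff N_def)
  have K: "K \<ge> 1" and K'K: "K' \<ge> K" "K' \<ge> 1" using Suc.prems
    by (auto simp: K'_def mult_le_cancel_right1 intro: order_trans[of 1 K])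
  have M: "M > 0" and hn: "\<And>A. 0 \<le> h A" using Suc.prems by (auto simp: spread_def M_def)
  have hb: "wdeg X h S \<le> D (card S - 1)" if "S \<noteq> {}" "S \<subseteq> X" for S
    using Suc.prems(2) that unfolding spread_def D_def M_def N_def by auto
  have Dpos: "D j > 0" for j using K \<tau> M N by (simp add: D_def)
  have \<Delta>pos: "\<Delta> j > 0" for j using K'K \<tau> M N by (simp add: \<Delta>_def)
  define a where "a = (card X + 1) ^ (i * R)"
  \<comment> \<open>Here \<open>r\<close> bounds the number of vertices that may still be absorbed:
    each adds at least \<open>M / (4 * N)\<close> to the weight of \<open>g\<close>, which has to
    reach \<open>\<tau> * M\<close>.\<close>
  have "\<exists>\<C>. finite \<C> \<and> \<C> \<noteq> {} \<and> card \<C> \<le> (card X + 1) ^ r * a \<and>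
      (\<forall>I. I \<subseteq> X \<longrightarrow> indep_wt h I \<longrightarrow> indep_wt g I \<longrightarrow> (\<exists>C\<in>\<C>. I \<subseteq> C \<and> good C))"
    if "\<And>A. 0 \<le> g A" "uniform_wt X (Suc i) g"
      "\<And>S. S \<noteq> {} \<Longrightarrow> S \<subseteq> X \<Longrightarrow> wdeg X g S \<le> \<Delta> (card S) + D (card S)"
      "\<tau> * M - wdeg X g {} \<le> r * (M / (4 * N))" for g and r :: nat
    using that
  proof (induction r arbitrary: g)
    \<comment> \<open>The link family is heavy now. The sum of \<Delta> and \<open>D\<close> is its
      degree bound, so it is spread with constant \<open>K * (1 + 2 ^ s)\<close>, and the outer
      induction hypothesis applies to it.\<close>
    case (0 g)
    have "\<tau> * M \<le> wdeg X g {}" using 0 by simp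
    moreover have "0 < \<tau> * M" using \<tau> M by simp
    ultimately have g0: "0 < wdeg X g {}" by linarith
    have "spread X (K * (1 + 2 ^ s)) \<tau> g" unfolding spread_def
    proof (intro conjI allI impI)
      fix S assume S: "S \<subseteq> X" "S \<noteq> {}"
      have fS: "finite S" using S fin finite_subset by auto
      then have "card S > 0" using S by (simp add: card_gt_0_iff)
      then have "D (card S) = K * \<tau> ^ (card S - 1) * (\<tau> * M) / N"
        unfolding D_def by (cases "card S") auto
      then have "\<Delta> (card S) + D (card S) = K * (1 + 2 ^ s) * \<tau> ^ (card S - 1) * (\<tau> * M) / N"
        unfolding \<Delta>_def K'_def by (simp add: algebra_simps add_divide_distrib)
      also have "\<dots> \<le> K * (1 + 2 ^ s) * \<tau> ^ (card S - 1) * wdeg X g {} / N"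
        using \<open>\<tau> * M \<le> wdeg X g {}\<close> K \<tau> N by (intro divide_right_mono mult_left_mono) auto
      finally show "wdeg X g S \<le> K * (1 + 2 ^ s) * \<tau> ^ (card S - 1) * wdeg X g {} / real (card X)"
        using 0(3)[of S] S by (simp add: N_def)
    qed (use 0 g0 in auto)
    moreover have "1 \<le> K * (1 + 2 ^ s)" using K mult_mono[of 1 K 1 "1 + 2 ^ s"] by simp
    ultimately obtain \<C> where \<C>: "finite \<C>" "\<C> \<noteq> {}" "card \<C> \<le> a"
      "\<forall>I. I \<subseteq> X \<longrightarrow> indep_wt g I \<longrightarrow> (\<exists>C\<in>\<C>. I \<subseteq> C \<and> C \<subseteq> X \<and>
        real (card C) \<le> (1 - 1 / (4 * (K * (1 + 2 ^ s)) * (1 + 2 ^ s) ^ i)) * card X)"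
      using Suc.IH[of "K * (1 + 2 ^ s)" g] 0(2) Suc.prems unfolding a_def by auto
    have "4 * (K * (1 + 2 ^ s)) * (1 + 2 ^ s) ^ i = 4 * K * (1 + 2 ^ s) ^ Suc i" by simp
    then show ?case using \<C> unfolding good_def by (intro exI[of _ \<C>]) (simp add: mult.assoc)
  next
    case (Suc r g)
    show ?case
    proof (cases "\<tau> * M \<le> wdeg X g {}")
      case True
      then have "\<tau> * M - wdeg X g {} \<le> r * (M / (4 * N))"
        using M N by (auto intro: order_trans[of _ 0])
      then obtain \<C> where "finite \<C>" "\<C> \<noteq> {}" "card \<C> \<le> (card X + 1) ^ r * a"
        "\<forall>I. I \<subseteq> X \<longrightarrow> indep_wt h I \<longrightarrow> indep_wt g I \<longrightarrow> (\<exists>C\<in>\<C>. I \<subseteq> C \<and> good C)"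
        using Suc.IH[of g] Suc.prems by auto
      moreover have "(card X + 1) ^ r * a \<le> (card X + 1) ^ Suc r * a" by simp
      ultimately show ?thesis by (meson order_trans)
    next
      case False
      define t where "t = trim X \<Delta> g h"
      define C where "C = {v \<in> X. wdeg X t {v} < M / (4 * card X)}"
      have tle: "t A \<le> h A" "0 \<le> t A" for A unfolding t_def by (auto intro: trim_le trim_nonneg hn)
      have ut: "uniform_wt X (Suc (Suc i)) t"
        using \<open>uniform_wt X (Suc (Suc i)) h\<close> unfolding uniform_wt_def t_def trim_def by auto
      \<comment> \<open>The degree of a saturated set in \<open>g\<close> is at least
        \<open>2 ^ s * \<tau>\<close> times the largest degree it can have in \<open>h\<close>;
        summing the degrees in \<open>g\<close> over all sets counts each set of \<open>g\<close>
        only \<open>2 ^ Suc i\<close> times.\<close>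
      have "(\<Sum>S | saturated X \<Delta> g S. wdeg X h S) \<le> (\<Sum>S | saturated X \<Delta> g S. wdeg X g S / (2 ^ s * \<tau>))"
      proof (rule sum_mono)
        fix S assume "S \<in> {S. saturated X \<Delta> g S}"
        then have S: "S \<noteq> {}" "S \<subseteq> X" "\<Delta> (card S) \<le> wdeg X g S" by (auto simp: saturated_def)
        have "wdeg X h S \<le> D (card S - 1)" using hb S by simp
        also have "\<dots> = \<Delta> (card S) / (2 ^ s * \<tau>)" using \<tau> unfolding D_def \<Delta>_def K'_def by simp
        also have "\<dots> \<le> wdeg X g S / (2 ^ s * \<tau>)" using S \<tau> by (intro divide_right_mono) auto
        finally show "wdeg X h S \<le> wdeg X g S / (2 ^ s * \<tau>)" .
      qed
      also have "\<dots> \<le> (\<Sum>S\<in>Pow X. wdeg X g S / (2 ^ s * \<tau>))"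
        using fin \<tau> Suc.prems(1) by (intro sum_mono2) (auto simp: saturated_def wdeg_nonneg)
      also have "\<dots> = 2 ^ Suc i * wdeg X g {} / (2 ^ s * \<tau>)"
        using sum_wdeg[OF fin Suc.prems(2,1)] by (simp add: sum_divide_distrib[symmetric])
      also have "\<dots> \<le> 2 ^ Suc i * (\<tau> * M) / (2 ^ s * \<tau>)"
        using False \<tau> by (intro divide_right_mono mult_left_mono) auto
      also have "\<dots> = M * (2 ^ Suc i / 2 ^ s)" using \<tau> by simp
      also have "\<dots> \<le> M * (1 / 2)"
        using power_increasing[OF \<open>Suc (Suc i) \<le> s\<close>, of "2::real"] M
        by (intro mult_left_mono) (auto simp: field_simps)
      finally have "(\<Sum>S | saturated X \<Delta> g S. wdeg X h S) \<le> M / 2" by simp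
      then have t2: "M / 2 \<le> wdeg X t {}"
        using wdeg_trim_lower[OF fin, of h \<Delta> g, OF hn] unfolding t_def M_def by linarith
      have "0 \<le> wdeg X t {}" by (rule wdeg_nonneg) (rule tle)
      then have "wdeg X t {} \<le> (\<Sum>v\<in>X. wdeg X t {v})"
        using mult_right_mono[of 1 "real (Suc (Suc i))" "wdeg X t {}"]
        unfolding sum_wdeg_singleton[OF fin ut] by simp
      then have tot: "M / 2 \<le> (\<Sum>v\<in>X. wdeg X t {v})" using t2 by linarith
      have up: "wdeg X t {v} \<le> K * M / card X" if "v \<in> X" for v
        using wdeg_mono[OF fin, of t h "{v}", OF tle(1)] hb[of "{v}"] that by (simp add: D_def N_def)
      have "real (card C) \<le> (1 - 1 / (4 * K)) * card X"
        unfolding C_def by (intro low_degree_card fin ne M tot up) (use K in auto)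
      also have "\<dots> \<le> (1 - 1 / (4 * K * (1 + 2 ^ s) ^ Suc i)) * card X"
      proof -
        have "(1::real) \<le> (1 + 2 ^ s) ^ Suc i" by (rule one_le_power) simp
        then have "4 * K * 1 \<le> 4 * K * (1 + 2 ^ s) ^ Suc i" using K by (intro mult_left_mono) auto
        then have "1 / (4 * K * (1 + 2 ^ s) ^ Suc i) \<le> 1 / (4 * K)"
          using K by (intro divide_left_mono mult_pos_pos zero_less_power) (auto simp: add_pos_pos)
        then show ?thesis by (intro mult_right_mono) auto
      qed
      finally have gC: "good C" unfolding good_def C_def by auto
      have step: "\<exists>\<C>. finite \<C> \<and> \<C> \<noteq> {} \<and> card \<C> \<le> (card X + 1) ^ r * a \<and>
        (\<forall>I. I \<subseteq> X \<longrightarrow> indep_wt h I \<longrightarrow> indep_wt (absorb X \<Delta> h v g) I \<longrightarrow>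
          (\<exists>C\<in>\<C>. I \<subseteq> C \<and> good C))" if v: "v \<in> X - C" for v
      proof (rule Suc.IH)
        show "0 \<le> absorb X \<Delta> h v g A" for A
          using Suc.prems(1) tle unfolding absorb_def t_def by (simp add: add_nonneg_nonneg)
        show "uniform_wt X (Suc i) (absorb X \<Delta> h v g)"
          unfolding uniform_wt_def
        proof (intro allI impI)
          fix A assume A: "A \<subseteq> X" "absorb X \<Delta> h v g A \<noteq> 0"
          show "card A = Suc i"
          proof (cases "g A = 0")
            case True
            then have "v \<notin> A" "t (insert v A) \<noteq> 0"
              using A(2) by (auto simp: absorb_def t_def split: if_splits)
            then have "card (insert v A) = Suc (Suc i)" using ut A v unfolding uniform_wt_def by auto
            then show ?thesis using \<open>v \<notin> A\<close> finite_subset[OF A(1) fin] by simp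
          next
            case False
            then show ?thesis using Suc.prems(2) A unfolding uniform_wt_def by auto
          qed
        qed
        show "wdeg X (absorb X \<Delta> h v g) S \<le> \<Delta> (card S) + D (card S)"
          if S: "S \<noteq> {}" "S \<subseteq> X" for S
        proof (rule wdeg_absorb_le)
          show "wdeg X h (insert v S) \<le> D (card S)" if "v \<notin> S"
            using hb[of "insert v S"] that v S finite_subset[OF S(2) fin] by simp
          show "wdeg X g S \<le> \<Delta> (card S) + D (card S)" using Suc.prems(3) S by auto
        qed (use fin v hn S Dpos[of "card S"] in auto)
        have "M / (4 * N) \<le> wdeg X t {v}" using v by (auto simp: C_def N_def)
        moreover have "\<tau> * M - wdeg X g {} \<le> r * (M / (4 * N)) + M / (4 * N)"
          using Suc.prems(4) by (simp only: of_nat_Suc distrib_right mult_1 add.commute)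
        ultimately show "\<tau> * M - wdeg X (absorb X \<Delta> h v g) {} \<le> r * (M / (4 * N))"
          using v wdeg_absorb_empty[OF fin, of v \<Delta> h g] unfolding t_def by simp
      qed
      define \<F> where "\<F> = (\<lambda>v. SOME \<C>. finite \<C> \<and> \<C> \<noteq> {} \<and> card \<C> \<le> (card X + 1) ^ r * a \<and>
        (\<forall>I. I \<subseteq> X \<longrightarrow> indep_wt h I \<longrightarrow> indep_wt (absorb X \<Delta> h v g) I \<longrightarrow>
          (\<exists>C\<in>\<C>. I \<subseteq> C \<and> good C)))"
      have \<F>: "finite (\<F> v) \<and> \<F> v \<noteq> {} \<and> card (\<F> v) \<le> (card X + 1) ^ r * a \<and>
        (\<forall>I. I \<subseteq> X \<longrightarrow> indep_wt h I \<longrightarrow> indep_wt (absorb X \<Delta> h v g) I \<longrightarrow>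
          (\<exists>C\<in>\<F> v. I \<subseteq> C \<and> good C))" if "v \<in> X - C" for v
        unfolding \<F>_def by (rule someI_ex) (rule step[OF that])
      \<comment> \<open>Either the independent set lies in \<open>C\<close>, or one of its vertices
        outside \<open>C\<close> is absorbed. Branching over all possible vertices costs a factor
        \<open>card X + 1\<close>.\<close>
      define \<C> where "\<C> = insert C (\<Union>v\<in>X - C. \<F> v)"
      have "finite (\<Union>v\<in>X - C. \<F> v)" using \<F> fin by auto
      then have ins: "card \<C> \<le> Suc (card (\<Union>v\<in>X - C. \<F> v))"
        unfolding \<C>_def by (simp add: card_insert_if)
      have "card (\<Union>v\<in>X - C. \<F> v) \<le> (\<Sum>v\<in>X - C. card (\<F> v))"
        using fin by (intro card_UN_le) auto
      also have "\<dots> \<le> card (X - C) * ((card X + 1) ^ r * a)"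
        using sum_bounded_above[of "X - C" "\<lambda>v. card (\<F> v)"] \<F> by auto
      also have "\<dots> \<le> card X * ((card X + 1) ^ r * a)"
        using fin by (intro mult_right_mono card_mono) auto
      finally have "card (\<Union>v\<in>X - C. \<F> v) \<le> card X * ((card X + 1) ^ r * a)" .
      moreover have "1 \<le> (card X + 1) ^ r * a" unfolding a_def by simp
      moreover have "(card X + 1) ^ Suc r * a = (card X + 1) ^ r * a + card X * ((card X + 1) ^ r * a)"
        by (simp add: algebra_simps)
      ultimately have card\<C>: "card \<C> \<le> (card X + 1) ^ Suc r * a" using ins by linarith
      have "\<exists>C\<in>\<C>. I \<subseteq> C \<and> good C" if I: "I \<subseteq> X" "indep_wt h I" "indep_wt g I" for I
      proof (cases "I \<subseteq> C")
        case True
        then show ?thesis using gC by (auto simp: \<C>_def)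
      next
        case False
        then obtain v where v: "v \<in> I" "v \<in> X - C" using I by auto
        \<comment> \<open>As \<open>v\<close> is in \<open>I\<close>, a link set inside
          \<open>I\<close> comes from a set \<open>insert v A\<close> inside \<open>I\<close>, where
          \<open>h\<close> vanishes.\<close>
        have "indep_wt (absorb X \<Delta> h v g) I"
          using I v unfolding indep_wt_def absorb_def trim_def by auto
        then obtain C' where "C' \<in> \<F> v" "I \<subseteq> C'" "good C'" using \<F>[OF v(2)] I by blast
        then show ?thesis using v unfolding \<C>_def by auto
      qed
      moreover have "finite \<C>" "\<C> \<noteq> {}" using \<F> fin by (auto simp: \<C>_def)
      ultimately show ?thesis using card\<C> by blast
    qed
  qed
  note main = this
  have "\<exists>\<C>. finite \<C> \<and> \<C> \<noteq> {} \<and> card \<C> \<le> (card X + 1) ^ R * a \<and>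
      (\<forall>I. I \<subseteq> X \<longrightarrow> indep_wt h I \<longrightarrow> (\<exists>C\<in>\<C>. I \<subseteq> C \<and> good C))"
  proof -
    have "4 * \<tau> * N \<le> R" unfolding R_def N_def by linarith
    then have "4 * \<tau> * N * (M / (4 * N)) \<le> R * (M / (4 * N))" using M N by (intro mult_right_mono) auto
    then have "\<tau> * M \<le> R * (M / (4 * N))" using N by (simp add: field_simps)
    then have "\<tau> * M - wdeg X (\<lambda>_. 0) {} \<le> R * (M / (4 * N))" by (simp add: wdeg_def)
    moreover have "wdeg X (\<lambda>_. 0) S \<le> \<Delta> (card S) + D (card S)" for S
      using \<Delta>pos[of "card S"] Dpos[of "card S"] by (simp add: wdeg_def)
    ultimately have "\<exists>\<C>. finite \<C> \<and> \<C> \<noteq> {} \<and> card \<C> \<le> (card X + 1) ^ R * a \<and>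
      (\<forall>I. I \<subseteq> X \<longrightarrow> indep_wt h I \<longrightarrow> indep_wt (\<lambda>_. 0) I \<longrightarrow> (\<exists>C\<in>\<C>. I \<subseteq> C \<and> good C))"
      by (intro main) (auto simp: uniform_wt_def)
    then show ?thesis by (simp add: indep_wt_def)
  qed
  moreover have "(card X + 1) ^ R * a = (card X + 1) ^ (Suc i * R)"
    unfolding a_def by (simp add: power_add)
  ultimately show ?case unfolding good_def by auto
qed

text \<open>The case of 0/1 weights. The exponents \<open>s - 1\<close> of the weighted version are
  relaxed to \<open>s\<close> to keep the later bounds simple.\<close>

theorem containers:
  fixes X :: "'a set" and \<S> :: "'a set set" and K \<tau> :: real
  assumes fin: "finite X" and ne: "\<S> \<noteq> {}" and \<tau>: "\<tau> > 0" and K: "K \<ge> 1" and s: "s \<ge> 1"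
    and \<S>: "\<And>A. A \<in> \<S> \<Longrightarrow> A \<subseteq> X \<and> card A = s"
    and deg: "\<And>S. S \<noteq> {} \<Longrightarrow> S \<subseteq> X \<Longrightarrow>
      real (card {A \<in> \<S>. S \<subseteq> A}) \<le> K * \<tau> ^ (card S - 1) * card \<S> / card X"
  obtains \<C> where "finite \<C>" "card \<C> \<le> (card X + 1) ^ (s * nat \<lceil>4 * \<tau> * card X\<rceil>)"
    "\<And>I. I \<subseteq> X \<Longrightarrow> (\<And>A. A \<in> \<S> \<Longrightarrow> \<not> A \<subseteq> I) \<Longrightarrow>
      \<exists>C\<in>\<C>. I \<subseteq> C \<and> C \<subseteq> X \<and> real (card C) \<le> (1 - 1 / (4 * K * (1 + 2 ^ s) ^ s)) * card X"
proof -
  define h where "h = (\<lambda>A. if A \<in> \<S> then 1 else 0 :: real)"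
  define R where "R = nat \<lceil>4 * \<tau> * card X\<rceil>"
  have fS: "finite \<S>" using \<S> fin by (intro finite_subset[of \<S> "Pow X"]) auto
  have wd: "wdeg X h S = card {A \<in> \<S>. S \<subseteq> A}" for S
  proof -
    have "wdeg X h S = (\<Sum>A\<in>{A \<in> \<S>. S \<subseteq> A}. 1)"
      unfolding wdeg_def h_def using \<S> fin
      by (intro sum.mono_neutral_cong_right) (auto intro: finite_subset[of _ "Pow X"])
    then show ?thesis by simp
  qed
  obtain A where A: "A \<in> \<S>" using ne by auto
  have Xne: "X \<noteq> {}" using \<S>[OF A] s by auto
  have sp: "spread X K \<tau> h"
    unfolding spread_def wd using deg fS ne by (auto simp: h_def card_gt_0_iff)
  have un: "uniform_wt X (Suc (s - 1)) h" using \<S> s by (auto simp: uniform_wt_def h_def)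
  obtain \<C> where \<C>: "finite \<C>" "card \<C> \<le> (card X + 1) ^ ((s - 1) * R)"
    "\<forall>I. I \<subseteq> X \<longrightarrow> indep_wt h I \<longrightarrow> (\<exists>C\<in>\<C>. I \<subseteq> C \<and> C \<subseteq> X \<and>
        real (card C) \<le> (1 - 1 / (4 * K * (1 + 2 ^ s) ^ (s - 1))) * card X)"
    using containers_level[OF fin Xne \<tau> K sp un, of s] s unfolding R_def by auto
  have pw: "1 - 1 / (4 * K * (1 + 2 ^ s) ^ (s - 1)) \<le> 1 - 1 / (4 * K * (1 + 2 ^ s) ^ s)"
    using K by (intro diff_left_mono divide_left_mono mult_left_mono power_increasing mult_pos_pos zero_less_power)
      (auto simp: add_pos_pos)
  show ?thesis
  proof (rule that)
    show "finite \<C>" by fact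
    have "(card X + 1) ^ ((s - 1) * R) \<le> (card X + 1) ^ (s * R)" by (intro power_increasing) auto
    then show "card \<C> \<le> (card X + 1) ^ (s * nat \<lceil>4 * \<tau> * card X\<rceil>)" using \<C> unfolding R_def by simp
    fix I assume I: "I \<subseteq> X" "\<And>A. A \<in> \<S> \<Longrightarrow> \<not> A \<subseteq> I"
    then have "indep_wt h I" by (auto simp: indep_wt_def h_def)
    then obtain C where "C \<in> \<C>" "I \<subseteq> C" "C \<subseteq> X"
      "real (card C) \<le> (1 - 1 / (4 * K * (1 + 2 ^ s) ^ (s - 1))) * card X" using \<C> I by auto
    moreover have "\<dots> \<le> (1 - 1 / (4 * K * (1 + 2 ^ s) ^ s)) * card X"
      using pw by (intro mult_right_mono) auto
    ultimately show "\<exists>C\<in>\<C>. I \<subseteq> C \<and> C \<subseteq> X \<and> real (card C) \<le> (1 - 1 / (4 * K * (1 + 2 ^ s) ^ s)) * card X"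
      by (meson order_trans)
  qed
qed

section \<open>Saturation in random samples\<close>

text \<open>A smallest nonempty subfamily that keeps the density works: if some \<open>f\<close> had
  degree below \<kappa>, deleting all members through \<open>f\<close> would lose less than \<kappa>
  members and at least one element of the union, so the density would survive. It serves for
  vertices of graphs (\<phi> the identity) and for pairs in triples.\<close>

lemma min_degree_subfamily:
  fixes Y :: "'e set" and \<phi> :: "'e \<Rightarrow> 'f set" and \<kappa> :: real
  assumes fin: "finite Y" and fin\<phi>: "\<And>e. e \<in> Y \<Longrightarrow> finite (\<phi> e)" and ne: "Y \<noteq> {}"
    and dens: "\<kappa> * card (\<Union>(\<phi> ` Y)) \<le> card Y"
  obtains Z where "Z \<subseteq> Y" "Z \<noteq> {}" "\<And>f. f \<in> \<Union>(\<phi> ` Z) \<Longrightarrow> \<kappa> \<le> card {e \<in> Z. f \<in> \<phi> e}"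
proof -
  define P where "P = (\<lambda>Z. Z \<subseteq> Y \<and> Z \<noteq> {} \<and> \<kappa> * card (\<Union>(\<phi> ` Z)) \<le> card Z)"
  have "P Y" using assms by (simp add: P_def)
  then obtain Z where Z: "P Z" and min: "\<And>Z'. P Z' \<Longrightarrow> card Z \<le> card Z'"
    using ex_has_least_nat[of P Y card] by blast
  have finZ: "finite Z" using Z fin finite_subset by (auto simp: P_def)
  have "\<kappa> \<le> card {e \<in> Z. f \<in> \<phi> e}" if f: "f \<in> \<Union>(\<phi> ` Z)" for f
  proof (rule ccontr)
    assume small: "\<not> \<kappa> \<le> card {e \<in> Z. f \<in> \<phi> e}"
    define Z' where "Z' = {e \<in> Z. f \<notin> \<phi> e}"
    have fU: "finite (\<Union>(\<phi> ` Z))" using finZ fin\<phi> Z by (auto simp: P_def)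
    have "card Z = card Z' + card {e \<in> Z. f \<in> \<phi> e}"
      unfolding Z'_def using finZ by (subst card_Un_disjoint[symmetric]) (auto intro: arg_cong[where f = card])
    then have cZ: "real (card Z) < card Z' + \<kappa>" using small by simp
    have "\<Union>(\<phi> ` Z') \<subseteq> \<Union>(\<phi> ` Z) - {f}" by (auto simp: Z'_def)
    then have "card (\<Union>(\<phi> ` Z')) \<le> card (\<Union>(\<phi> ` Z) - {f})" using fU by (intro card_mono) auto
    then have cU: "real (card (\<Union>(\<phi> ` Z'))) \<le> real (card (\<Union>(\<phi> ` Z))) - 1"
      using card_Suc_Diff1[OF fU f] by linarith
    have \<kappa>: "\<kappa> > 0" using small by simp
    have "\<kappa> * card (\<Union>(\<phi> ` Z')) \<le> \<kappa> * (real (card (\<Union>(\<phi> ` Z))) - 1)"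
      using cU \<kappa> by (intro mult_left_mono) auto
    also have "\<dots> \<le> card Z - \<kappa>" using Z by (simp add: P_def algebra_simps)
    also have "\<dots> < card Z'" using cZ by simp
    finally have lt: "\<kappa> * card (\<Union>(\<phi> ` Z')) < card Z'" .
    moreover have "0 \<le> \<kappa> * card (\<Union>(\<phi> ` Z'))" using \<kappa> by simp
    ultimately have "0 < real (card Z')" by linarith
    then have "Z' \<noteq> {}" by auto
    then have "P Z'" using lt Z by (auto simp: P_def Z'_def)
    then have "card Z \<le> card Z'" by (rule min)
    moreover have "Z' \<subset> Z" using f by (auto simp: Z'_def)
    ultimately show False using psubset_card_mono[OF finZ, of Z'] by linarith
  qed
  then show ?thesis using that[of Z] Z by (auto simp: P_def)
qed

text \<open>Take a largest family \<open>\<S>\<close> within the degree bounds. If it had fewer than \<open>M\<close> members, then few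
  saturated sets and few members of \<open>\<S>\<close> would survive in a random \<open>R \<omega>\<close>; after deleting one element
  from every saturated set, some copy would be left that can be added to \<open>\<S>\<close>. The maximum with 0 in
  the conclusion only matters for infinite \<open>S\<close>, which have cardinality 0.\<close>

lemma saturation:
  fixes X :: "'a set" and \<G> :: "'a set set" and \<Omega> :: "'w set" and R :: "'w \<Rightarrow> 'a set"
    and u :: "'w \<Rightarrow> real" and \<kappa> \<beta> M :: real and \<pi> \<Delta> :: "nat \<Rightarrow> real" and s :: nat
  assumes fin: "finite X" and \<G>: "\<And>A. A \<in> \<G> \<Longrightarrow> A \<subseteq> X \<and> card A = s"
    and \<Omega>: "finite \<Omega>" and R: "\<And>\<omega>. \<omega> \<in> \<Omega> \<Longrightarrow> R \<omega> \<subseteq> X"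
    and cnt: "\<And>\<omega> Y. \<omega> \<in> \<Omega> \<Longrightarrow> Y \<subseteq> R \<omega> \<Longrightarrow> \<kappa> * (card Y - u \<omega>) \<le> card {A \<in> \<G>. A \<subseteq> Y}"
    and prob: "\<And>A S. A \<in> \<G> \<Longrightarrow> S \<subseteq> A \<Longrightarrow> S \<noteq> {} \<Longrightarrow>
      card {\<omega> \<in> \<Omega>. S \<subseteq> R \<omega>} \<le> \<pi> (card S) * card \<Omega>"
    and \<kappa>: "\<kappa> > 0" and s: "s \<ge> 1" and \<Delta>: "\<And>j. 1 \<le> j \<Longrightarrow> j < s \<Longrightarrow> \<Delta> j \<ge> 2"
    and \<beta>: "\<And>j. 1 \<le> j \<Longrightarrow> j < s \<Longrightarrow> \<pi> j / \<Delta> j \<le> \<beta>" "\<beta> \<ge> 0" "\<pi> s \<ge> 0"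
    and M: "M \<ge> 0"
    and main: "card \<Omega> * (M * (2 ^ (s + 1) * \<beta> + \<pi> s / \<kappa>)) < (\<Sum>\<omega>\<in>\<Omega>. card (R \<omega>) - u \<omega>)"
  obtains \<S> where "\<S> \<subseteq> \<G>" "M \<le> card \<S>"
    "\<And>S. S \<noteq> {} \<Longrightarrow> card S < s \<Longrightarrow> real (card {A \<in> \<S>. S \<subseteq> A}) \<le> max (\<Delta> (card S)) 0"
proof -
  define P where "P = (\<lambda>\<S>. \<S> \<subseteq> \<G> \<and>
     (\<forall>S. S \<noteq> {} \<longrightarrow> card S < s \<longrightarrow> real (card {A \<in> \<S>. S \<subseteq> A}) \<le> max (\<Delta> (card S)) 0))"
  have fG: "finite \<G>" using \<G> fin by (intro finite_subset[of \<G> "Pow X"]) auto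
  have "P {}" by (auto simp: P_def)
  moreover have "\<forall>\<S>. P \<S> \<longrightarrow> card \<S> < Suc (card \<G>)"
    using fG by (auto simp: P_def less_Suc_eq_le intro: card_mono)
  ultimately obtain \<S> where \<S>: "P \<S>" and max: "\<And>\<S>'. P \<S>' \<Longrightarrow> card \<S>' \<le> card \<S>"
    using ex_has_greatest_nat[of P "{}" card "Suc (card \<G>)"] by (metis less_imp_le)
  have fS: "finite \<S>" using \<S> fG finite_subset by (auto simp: P_def)
  have finA: "finite A" if "A \<in> \<G>" for A using \<G>[OF that] fin finite_subset by auto
  have SG: "A \<in> \<G>" if "A \<in> \<S>" for A using \<S> that by (auto simp: P_def)
  have "M \<le> card \<S>"
  proof (rule ccontr)
    assume "\<not> M \<le> card \<S>"
    then have small: "card \<S> \<le> M" by simp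
    \<comment> \<open>Sets whose degree leaves no room for one more member of the family.\<close>
    define Bad where "Bad = {S. S \<noteq> {} \<and> card S < s \<and> (\<exists>A\<in>\<G>. S \<subseteq> A) \<and>
       real (card {A \<in> \<S>. S \<subseteq> A}) + 1 > \<Delta> (card S)}"
    have finBad: "finite Bad" using \<G> fin by (intro finite_subset[of Bad "Pow X"]) (auto simp: Bad_def)
    define bad where "bad = (\<lambda>\<omega>. {S \<in> Bad. S \<subseteq> R \<omega>})"
    define hit where "hit = (\<lambda>\<omega>. {A \<in> \<S>. A \<subseteq> R \<omega>})"
    have dc: "(\<Sum>\<omega>\<in>\<Omega>. real (card {S \<in> \<T>. S \<subseteq> R \<omega>})) = (\<Sum>S\<in>\<T>. card {\<omega> \<in> \<Omega>. S \<subseteq> R \<omega>})"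
      if "finite \<T>" for \<T>
    proof -
      have "(\<Sum>\<omega>\<in>\<Omega>. real (card {S \<in> \<T>. S \<subseteq> R \<omega>})) = (\<Sum>\<omega>\<in>\<Omega>. \<Sum>S\<in>\<T>. if S \<subseteq> R \<omega> then 1 else 0)"
        using that by (simp add: sum.inter_filter[symmetric])
      also have "\<dots> = (\<Sum>S\<in>\<T>. \<Sum>\<omega>\<in>\<Omega>. if S \<subseteq> R \<omega> then 1 else 0)" by (rule sum.swap)
      also have "\<dots> = (\<Sum>S\<in>\<T>. card {\<omega> \<in> \<Omega>. S \<subseteq> R \<omega>})"
        using \<Omega> by (simp add: sum.inter_filter[symmetric])
      finally show ?thesis .
    qed
    have "(\<Sum>\<omega>\<in>\<Omega>. real (card (bad \<omega>))) = (\<Sum>S\<in>Bad. real (card {\<omega> \<in> \<Omega>. S \<subseteq> R \<omega>}))"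
      unfolding bad_def using dc[OF finBad] by simp
    \<comment> \<open>Charging: since \<Delta> is at least 2, a bad set lies in more than half of
      \<Delta> members, and its probability is distributed over them. Every member contains at most
      \<open>2 ^ s\<close> bad sets, so few bad sets survive on average if the family is
      small.\<close>
    also have "\<dots> \<le> (\<Sum>S\<in>Bad. \<Sum>A\<in>{A \<in> \<S>. S \<subseteq> A}. 2 * \<beta> * card \<Omega>)"
    proof (rule sum_mono)
      fix S assume S: "S \<in> Bad"
      then obtain A where A: "A \<in> \<G>" "S \<subseteq> A" "S \<noteq> {}" by (auto simp: Bad_def)
      have "finite S" using A finA finite_subset by auto
      then have j: "1 \<le> card S" "card S < s" using A S by (auto simp: Bad_def card_gt_0_iff Suc_le_eq)
      have D: "\<Delta> (card S) \<ge> 2" using \<Delta> j by blast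
      have d: "\<Delta> (card S) < 2 * real (card {A \<in> \<S>. S \<subseteq> A})" using S D by (auto simp: Bad_def)
      have "real (card {\<omega> \<in> \<Omega>. S \<subseteq> R \<omega>}) \<le> \<pi> (card S) * card \<Omega>" using prob A by blast
      also have "\<dots> = \<pi> (card S) / \<Delta> (card S) * \<Delta> (card S) * card \<Omega>" using D by simp
      also have "\<dots> \<le> \<beta> * \<Delta> (card S) * card \<Omega>"
        using \<beta>(1)[OF j] D by (intro mult_right_mono) auto
      also have "\<dots> \<le> \<beta> * (2 * real (card {A \<in> \<S>. S \<subseteq> A})) * card \<Omega>"
        using d \<beta> by (intro mult_right_mono mult_left_mono) auto
      also have "\<dots> = (\<Sum>A\<in>{A \<in> \<S>. S \<subseteq> A}. 2 * \<beta> * card \<Omega>)" by simp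
      finally show "real (card {\<omega> \<in> \<Omega>. S \<subseteq> R \<omega>}) \<le> (\<Sum>A\<in>{A \<in> \<S>. S \<subseteq> A}. 2 * \<beta> * card \<Omega>)" .
    qed
    also have "\<dots> = (\<Sum>S\<in>Bad. \<Sum>A\<in>\<S>. if S \<subseteq> A then 2 * \<beta> * card \<Omega> else 0)"
      using fS by (simp add: sum.inter_filter[symmetric])
    also have "\<dots> = (\<Sum>A\<in>\<S>. \<Sum>S\<in>Bad. if S \<subseteq> A then 2 * \<beta> * card \<Omega> else 0)" by (rule sum.swap)
    also have "\<dots> \<le> (\<Sum>A\<in>\<S>. 2 ^ s * (2 * \<beta> * card \<Omega>))"
    proof (rule sum_mono)
      fix A assume A: "A \<in> \<S>"
      have "card {S \<in> Bad. S \<subseteq> A} \<le> card (Pow A)"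
        using finA[OF SG[OF A]] by (intro card_mono) auto
      also have "\<dots> = 2 ^ s" using \<G>[OF SG[OF A]] finA[OF SG[OF A]] by (simp add: card_Pow)
      finally have "real (card {S \<in> Bad. S \<subseteq> A}) \<le> 2 ^ s"
        by (metis of_nat_le_iff of_nat_numeral of_nat_power)
      then have "real (card {S \<in> Bad. S \<subseteq> A}) * (2 * \<beta> * card \<Omega>) \<le> 2 ^ s * (2 * \<beta> * card \<Omega>)"
        using \<beta> by (intro mult_right_mono) auto
      then show "(\<Sum>S\<in>Bad. if S \<subseteq> A then 2 * \<beta> * card \<Omega> else 0) \<le> 2 ^ s * (2 * \<beta> * card \<Omega>)"
        using finBad by (simp add: sum.inter_filter[symmetric])
    qed
    also have "\<dots> = card \<S> * (2 ^ (s + 1) * \<beta> * card \<Omega>)" by simp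
    also have "\<dots> \<le> M * (2 ^ (s + 1) * \<beta> * card \<Omega>)" using small \<beta> by (intro mult_right_mono) auto
    finally have b1: "(\<Sum>\<omega>\<in>\<Omega>. real (card (bad \<omega>))) \<le> M * (2 ^ (s + 1) * \<beta> * card \<Omega>)" .
    have "(\<Sum>\<omega>\<in>\<Omega>. real (card (hit \<omega>))) = (\<Sum>A\<in>\<S>. real (card {\<omega> \<in> \<Omega>. A \<subseteq> R \<omega>}))"
      unfolding hit_def using dc[OF fS] by simp
    also have "\<dots> \<le> (\<Sum>A\<in>\<S>. \<pi> s * card \<Omega>)"
    proof (rule sum_mono)
      fix A assume A: "A \<in> \<S>"
      have "card A = s" "A \<noteq> {}" using \<G>[OF SG[OF A]] s by auto
      then show "real (card {\<omega> \<in> \<Omega>. A \<subseteq> R \<omega>}) \<le> \<pi> s * card \<Omega>" using prob[OF SG[OF A], of A] by simp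
    qed
    also have "\<dots> = card \<S> * (\<pi> s * card \<Omega>)" by simp
    also have "\<dots> \<le> M * (\<pi> s * card \<Omega>)" using small \<beta> by (intro mult_right_mono) auto
    finally have b2: "(\<Sum>\<omega>\<in>\<Omega>. real (card (hit \<omega>)) / \<kappa>) \<le> M * (\<pi> s * card \<Omega>) / \<kappa>"
      unfolding sum_divide_distrib[symmetric] using \<kappa> by (intro divide_right_mono) auto
    have "\<exists>\<omega>\<in>\<Omega>. real (card (bad \<omega>)) + card (hit \<omega>) / \<kappa> < card (R \<omega>) - u \<omega>"
    proof (rule ccontr)
      assume "\<not> ?thesis"
      then have "(\<Sum>\<omega>\<in>\<Omega>. card (R \<omega>) - u \<omega>) \<le> (\<Sum>\<omega>\<in>\<Omega>. real (card (bad \<omega>)) + card (hit \<omega>) / \<kappa>)"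
        by (intro sum_mono) (auto simp: not_less)
      also have "\<dots> \<le> M * (2 ^ (s + 1) * \<beta> * card \<Omega>) + M * (\<pi> s * card \<Omega>) / \<kappa>"
        using b1 b2 by (simp add: sum.distrib)
      also have "\<dots> = card \<Omega> * (M * (2 ^ (s + 1) * \<beta> + \<pi> s / \<kappa>))" by (simp add: algebra_simps)
      finally show False using main by simp
    qed
    then obtain \<omega> where \<omega>: "\<omega> \<in> \<Omega>" "real (card (bad \<omega>)) + card (hit \<omega>) / \<kappa> < card (R \<omega>) - u \<omega>" by auto
    \<comment> \<open>\<open>Y\<close> contains no bad set, but by \<open>cnt\<close> more copies
      than members of the family, so one of these copies can be added.\<close>
    define Y where "Y = R \<omega> - (\<lambda>S. SOME x. x \<in> S) ` bad \<omega>"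
    have fb: "finite (bad \<omega>)" using finBad by (simp add: bad_def)
    have "card (R \<omega>) - card ((\<lambda>S. SOME x. x \<in> S) ` bad \<omega>) \<le> card Y"
      unfolding Y_def using fb by (intro diff_card_le_card_Diff) auto
    then have cY: "real (card (R \<omega>)) - card (bad \<omega>) \<le> card Y"
      using card_image_le[OF fb, of "\<lambda>S. SOME x. x \<in> S"] by linarith
    have nobad: "S \<notin> Bad" if "S \<subseteq> Y" for S
    proof
      assume "S \<in> Bad"
      then have "S \<in> bad \<omega>" "S \<noteq> {}" using that by (auto simp: bad_def Y_def Bad_def)
      then have "(SOME x. x \<in> S) \<in> (\<lambda>S. SOME x. x \<in> S) ` bad \<omega>" "(SOME x. x \<in> S) \<in> S"
        by (auto simp: some_in_eq)
      then show False using that by (auto simp: Y_def)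
    qed
    have "card {A \<in> \<S>. A \<subseteq> Y} \<le> card (hit \<omega>)"
      using fS by (intro card_mono) (auto simp: hit_def Y_def)
    then have "real (card {A \<in> \<S>. A \<subseteq> Y}) \<le> card (hit \<omega>)" by simp
    also have "\<dots> < \<kappa> * (card Y - u \<omega>)"
    proof -
      have "card (hit \<omega>) / \<kappa> < card Y - u \<omega>" using \<omega>(2) cY by linarith
      then show ?thesis using \<kappa> by (simp add: pos_divide_less_eq mult.commute)
    qed
    also have "\<dots> \<le> card {A \<in> \<G>. A \<subseteq> Y}" using cnt[OF \<omega>(1), of Y] by (auto simp: Y_def)
    finally have "\<not> {A \<in> \<G>. A \<subseteq> Y} \<subseteq> {A \<in> \<S>. A \<subseteq> Y}"
      using card_mono[of "{A \<in> \<S>. A \<subseteq> Y}" "{A \<in> \<G>. A \<subseteq> Y}"] fS by auto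
    then obtain A where A: "A \<in> \<G>" "A \<subseteq> Y" "A \<notin> \<S>" by auto
    have "P (insert A \<S>)" unfolding P_def
    proof (intro conjI allI impI)
      show "insert A \<S> \<subseteq> \<G>" using A SG by auto
      fix S :: "'a set" assume S: "S \<noteq> {}" "card S < s"
      show "real (card {B \<in> insert A \<S>. S \<subseteq> B}) \<le> max (\<Delta> (card S)) 0"
      proof (cases "S \<subseteq> A")
        case True
        then have "S \<notin> Bad" using nobad A by auto
        then have "real (card {A \<in> \<S>. S \<subseteq> A}) + 1 \<le> \<Delta> (card S)"
          using S True A unfolding Bad_def by auto
        moreover have "{B \<in> insert A \<S>. S \<subseteq> B} = insert A {B \<in> \<S>. S \<subseteq> B}" using True by auto
        ultimately show ?thesis using fS A by simp
      next
        case False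
        then have "{B \<in> insert A \<S>. S \<subseteq> B} = {B \<in> \<S>. S \<subseteq> B}" by auto
        then show ?thesis using \<S> S by (simp add: P_def)
      qed
    qed
    from max[OF this] show False using A fS by simp
  qed
  then show ?thesis using that[of \<S>] \<S> unfolding P_def by blast
qed

section \<open>Uniform random vertex sets of fixed size\<close>

text \<open>A fixed size, rather than independent choices of vertices, guarantees that every sampled
  subgraph has at most \<open>w\<close> vertices, as the cycle count in a sample requires.\<close>

definition samples :: "'v set \<Rightarrow> nat \<Rightarrow> 'v set set" where
  "samples V w = {W. W \<subseteq> V \<and> card W = w}"

lemma finite_samples: "finite V \<Longrightarrow> finite (samples V w)"
  unfolding samples_def by (rule finite_subset[of _ "Pow V"]) auto

lemma card_samples: "finite V \<Longrightarrow> card (samples V w) = card V choose w"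
  unfolding samples_def by (rule n_subsets)

lemma card_samples_containing:
  assumes "finite V" "A \<subseteq> V" "card A \<le> w"
  shows "card {W \<in> samples V w. A \<subseteq> W} = (card V - card A) choose (w - card A)"
proof -
  have fA: "finite A" using assms finite_subset by auto
  have "bij_betw (\<lambda>W. W - A) {W \<in> samples V w. A \<subseteq> W} (samples (V - A) (w - card A))"
  proof (rule bij_betw_byWitness[where f' = "\<lambda>W. W \<union> A"])
    show "(\<lambda>W. W - A) ` {W \<in> samples V w. A \<subseteq> W} \<subseteq> samples (V - A) (w - card A)"
      using fA by (auto simp: samples_def card_Diff_subset)
    show "(\<lambda>W. W \<union> A) ` samples (V - A) (w - card A) \<subseteq> {W \<in> samples V w. A \<subseteq> W}"
    proof
      fix U assume "U \<in> (\<lambda>W. W \<union> A) ` samples (V - A) (w - card A)"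
      then obtain W where W: "U = W \<union> A" "W \<subseteq> V - A" "card W = w - card A" by (auto simp: samples_def)
      then have "card U = card W + card A"
        using fA assms finite_subset[of W V] by (subst W(1), subst card_Un_disjoint) auto
      then show "U \<in> {W \<in> samples V w. A \<subseteq> W}" using W assms by (auto simp: samples_def)
    qed
  qed (auto simp: samples_def)
  then have "card {W \<in> samples V w. A \<subseteq> W} = card (samples (V - A) (w - card A))"
    by (rule bij_betw_same_card)
  also have "\<dots> = (card V - card A) choose (w - card A)"
    using assms fA by (simp add: card_samples card_Diff_subset)
  finally show ?thesis .
qed

lemma binomial_shift_ratio:
  assumes "Suc a \<le> w" "w \<le> n"
  shows "real ((n - Suc a) choose (w - Suc a)) = real (w - a) / real (n - a) * real ((n - a) choose (w - a))"
proof -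
  have "(w - a) * ((n - a) choose (w - a)) = (n - a) * ((n - a - 1) choose (w - a - 1))"
    using assms by (intro times_binomial_minus1_eq) auto
  then have "real (w - a) * ((n - a) choose (w - a)) = (n - a) * ((n - Suc a) choose (w - Suc a))"
    using assms by (metis diff_Suc_eq_diff_pred diff_commute One_nat_def of_nat_mult Suc_eq_plus1 diff_diff_left)
  then show ?thesis using assms by (simp add: field_simps)
qed

text \<open>Exposing the vertices of \<open>A\<close> one by one gives factors
  \<open>(w - a) / (card V - a)\<close>, each at most \<open>w / card V\<close>.\<close>

lemma samples_upper:
  assumes V: "finite V" "A \<subseteq> V" and w: "w \<le> card V" "card V > 0"
  shows "real (card {W \<in> samples V w. A \<subseteq> W}) \<le> (w / card V) ^ card A * card (samples V w)"
proof (cases "card A \<le> w")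
  case False
  then have "{W \<in> samples V w. A \<subseteq> W} = {}"
    using V by (auto simp: samples_def) (meson card_mono finite_subset)
  then have "card {W \<in> samples V w. A \<subseteq> W} = 0" by (simp only: card.empty)
  then show ?thesis by (simp del: card_eq_0_iff)
next
  case True
  have "a \<le> w \<Longrightarrow> real ((card V - a) choose (w - a)) \<le> (w / card V) ^ a * (card V choose w)" for a
  proof (induction a)
    case (Suc a)
    have "real ((card V - Suc a) choose (w - Suc a)) = real (w - a) / real (card V - a) * real ((card V - a) choose (w - a))"
      using Suc w by (intro binomial_shift_ratio) auto
    also have "\<dots> \<le> (w / card V) * ((w / card V) ^ a * (card V choose w))"
    proof (intro mult_mono)
      have "real a * real w \<le> real a * real (card V)" using w by (intro mult_left_mono) auto
      then show "real (w - a) / real (card V - a) \<le> w / card V"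
        using Suc w by (simp add: field_simps of_nat_diff)
    qed (use Suc in auto)
    finally show ?case by (simp add: algebra_simps)
  qed simp
  from this[OF True] show ?thesis using card_samples_containing[OF V True] V by (simp add: card_samples)
qed

text \<open>The factors \<open>(w - a) / (card V - a)\<close> stay above
  \<open>w / (2 * card V)\<close> as long as \<open>a\<close> is at most
  \<open>w / 2\<close>.\<close>

lemma samples_lower:
  assumes V: "finite V" "A \<subseteq> V" and w: "w \<le> card V" "2 * card A \<le> w" "w > 0"
  shows "(w / (2 * card V)) ^ card A * card (samples V w) \<le> real (card {W \<in> samples V w. A \<subseteq> W})"
proof -
  have "2 * a \<le> w \<Longrightarrow> (w / (2 * card V)) ^ a * (card V choose w) \<le> real ((card V - a) choose (w - a))" for a
  proof (induction a)
    case (Suc a)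
    have "(w / (2 * card V)) ^ Suc a * (card V choose w) = (w / (2 * card V)) * ((w / (2 * card V)) ^ a * (card V choose w))"
      by simp
    also have "\<dots> \<le> real (w - a) / real (card V - a) * real ((card V - a) choose (w - a))"
    proof (intro mult_mono)
      have "w / (2 * card V) = (w / 2) / card V" by simp
      also have "\<dots> \<le> real (w - a) / card V" using Suc by (intro divide_right_mono) auto
      also have "\<dots> \<le> real (w - a) / real (card V - a)"
        using Suc w by (intro divide_left_mono) auto
      finally show "w / (2 * card V) \<le> real (w - a) / real (card V - a)" by simp
    qed (use Suc in auto)
    also have "\<dots> = real ((card V - Suc a) choose (w - Suc a))"
      using Suc w by (intro binomial_shift_ratio[symmetric, of a w "card V"]) auto
    finally show ?case .
  qed simp
  from this[OF w(2)] show ?thesis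
    using card_samples_containing[OF V, of w] V w by (simp add: card_samples)
qed

section \<open>Closed walks and even cycles in graphs\<close>

fun walk_wt :: "('v \<Rightarrow> 'v \<Rightarrow> real) \<Rightarrow> 'v list \<Rightarrow> real" where
  "walk_wt M (x # y # xs) = M x y * walk_wt M (y # xs)"
| "walk_wt M xs = 1"

text \<open>The matrix power \<open>M^k\<close> for a matrix with rows and columns indexed by the
  set \<open>V\<close>.\<close>

fun kernel_pow :: "'v set \<Rightarrow> ('v \<Rightarrow> 'v \<Rightarrow> real) \<Rightarrow> nat \<Rightarrow> 'v \<Rightarrow> 'v \<Rightarrow> real" where
  "kernel_pow V M 0 x y = (if x = y then 1 else 0)"
| "kernel_pow V M (Suc k) x y = (\<Sum>z\<in>V. M x z * kernel_pow V M k z y)"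

definition words :: "'v set \<Rightarrow> nat \<Rightarrow> 'v list set" where
  "words V k = {xs. set xs \<subseteq> V \<and> length xs = k}"

lemma finite_words: "finite V \<Longrightarrow> finite (words V k)"
  unfolding words_def by (rule finite_lists_length_eq)

lemma card_words: "finite V \<Longrightarrow> card (words V k) = card V ^ k"
  unfolding words_def by (rule card_lists_length_eq)

lemma words_0 [simp]: "words V 0 = {[]}" by (auto simp: words_def)

lemma sum_words_Suc:
  assumes "finite V"
  shows "(\<Sum>xs\<in>words V (Suc k). f xs) = (\<Sum>x\<in>V. \<Sum>ys\<in>words V k. f (x # ys))"
proof -
  have "(\<Sum>x\<in>V. \<Sum>ys\<in>words V k. f (x # ys)) = (\<Sum>(x, ys)\<in>V \<times> words V k. f (x # ys))"
    by (rule sum.cartesian_product)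
  also have "\<dots> = (\<Sum>xs\<in>words V (Suc k). f xs)"
    by (rule sum.reindex_bij_witness[where i = "\<lambda>xs. (hd xs, tl xs)" and j = "\<lambda>(x, ys). x # ys"])
      (auto simp: words_def length_Suc_conv)
  finally show ?thesis by simp
qed

lemma walk_wt_split: "walk_wt M (us @ x # vs) = walk_wt M (us @ [x]) * walk_wt M (x # vs)"
proof (induction us)
  case (Cons a us)
  then show ?case by (cases us) auto
qed simp

lemma walk_wt_nonneg: "(\<And>x y. 0 \<le> M x y) \<Longrightarrow> 0 \<le> walk_wt M xs"
  by (induction M xs rule: walk_wt.induct) auto

lemma walk_wt_le:
  "(\<And>x y. 0 \<le> M x y) \<Longrightarrow> (\<And>x y. M x y \<le> b) \<Longrightarrow> walk_wt M (x # xs) \<le> b ^ length xs"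
proof (induction xs arbitrary: x)
  case (Cons y ys)
  have "0 \<le> b" using Cons.prems order_trans by blast
  then show ?case using Cons by (auto intro!: mult_mono walk_wt_nonneg)
qed simp

lemma walk_wt_nonzero:
  "walk_wt M xs \<noteq> 0 \<Longrightarrow> Suc i < length xs \<Longrightarrow> M (xs ! i) (xs ! Suc i) \<noteq> 0"
proof (induction M xs arbitrary: i rule: walk_wt.induct)
  case (1 M x y xs)
  then show ?case by (cases i) auto
qed auto

lemma sum_walk_wt:
  assumes "finite V" "y \<in> V"
  shows "(\<Sum>ys\<in>words V k. walk_wt M (x # ys @ [y])) = kernel_pow V M (Suc k) x y"
proof (induction k arbitrary: x)
  case 0
  show ?case using assms by (simp add: if_distrib[of "\<lambda>t. _ * t"] cong: if_cong)
next
  case (Suc k)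
  have "(\<Sum>ys\<in>words V k. walk_wt M (x # (z # ys) @ [y])) = M x z * kernel_pow V M (Suc k) z y" for z
    by (simp add: Suc[symmetric] sum_distrib_left del: kernel_pow.simps)
  then show ?case unfolding sum_words_Suc[OF assms(1)] kernel_pow.simps(2)[of V M "Suc k" x y]
    by (intro sum.cong refl)
qed

definition closed_wt :: "('v \<Rightarrow> 'v \<Rightarrow> real) \<Rightarrow> 'v list \<Rightarrow> real" where
  "closed_wt M xs = walk_wt M (xs @ [hd xs])"

lemma sum_closed_wt:
  assumes "finite V"
  shows "(\<Sum>xs\<in>words V (Suc k). closed_wt M xs) = (\<Sum>x\<in>V. kernel_pow V M (Suc k) x x)"
  unfolding sum_words_Suc[OF assms] closed_wt_def
  using sum_walk_wt[OF assms, where M = M and k = k] by (simp del: kernel_pow.simps)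

text \<open>A closed walk that visits \<open>x\<close> twice is cut there into two closed walks at
  \<open>x\<close>; the second one, \<open>ds @ as\<close>, runs through the starting point of the
  original walk.\<close>

lemma closed_wt_split:
  "closed_wt M (as @ x # bs @ x # ds) = walk_wt M (x # bs @ [x]) * walk_wt M (x # (ds @ as) @ [x])"
proof (cases as)
  case Nil
  then show ?thesis using walk_wt_split[of M "x # bs" x "ds @ [x]"] by (simp add: closed_wt_def)
next
  case (Cons a as')
  have "closed_wt M (as @ x # bs @ x # ds) = walk_wt M (as @ x # (bs @ x # ds @ [a]))"
    using Cons by (simp add: closed_wt_def)
  also have "\<dots> = walk_wt M (as @ [x]) * walk_wt M ((x # bs) @ x # (ds @ [a]))"
    by (subst walk_wt_split) simp
  also have "\<dots> = walk_wt M (as @ [x]) * (walk_wt M (x # bs @ [x]) * walk_wt M (x # ds @ [a]))"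
    by (subst walk_wt_split) simp
  also have "walk_wt M (x # (ds @ as) @ [x]) = walk_wt M ((x # ds) @ a # (as' @ [x]))"
    using Cons by simp
  then have "walk_wt M (x # (ds @ as) @ [x]) = walk_wt M (x # ds @ [a]) * walk_wt M (as @ [x])"
    using Cons by (subst (asm) walk_wt_split) simp
  ultimately show ?thesis by simp
qed

text \<open>Cutting at the repeated vertex turns a word into a vertex with two closed walks of
  lengths \<open>j - i\<close> and \<open>k - (j - i)\<close>. With \<open>i\<close> and
  \<open>j\<close> fixed the word can be rebuilt from them, so no triple is used twice.\<close>

lemma sum_closed_wt_repeat:
  assumes fin: "finite V" and nn: "\<And>x y. 0 \<le> M x y" and ij: "i < j" "j < k"
  shows "(\<Sum>xs | xs \<in> words V k \<and> xs ! i = xs ! j. closed_wt M xs)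
     \<le> (\<Sum>x\<in>V. kernel_pow V M (j - i) x x * kernel_pow V M (k - (j - i)) x x)"
proof -
  define p where "p = j - i - 1"
  define q where "q = k - (j - i) - 1"
  define T where "T = V \<times> words V p \<times> words V q"
  define g where "g = (\<lambda>(x, bs, cs). walk_wt M (x # bs @ [x]) * walk_wt M (x # cs @ [x]))"
  have "(\<Sum>xs | xs \<in> words V k \<and> xs ! i = xs ! j. closed_wt M xs) \<le> sum g T"
  proof (rule sum_le_included)
    show "finite {xs \<in> words V k. xs ! i = xs ! j}" using finite_words[OF fin] by auto
    show "finite T" unfolding T_def using fin finite_words by auto
    show "\<forall>y\<in>T. 0 \<le> g y" by (auto simp: g_def intro!: mult_nonneg_nonneg walk_wt_nonneg nn)
    show "\<forall>xs\<in>{xs \<in> words V k. xs ! i = xs ! j}. \<exists>y\<in>T.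
       (\<lambda>(x, bs, cs). drop (q - i) cs @ x # bs @ x # take (q - i) cs) y = xs \<and> closed_wt M xs \<le> g y"
    proof
      fix xs assume "xs \<in> {xs \<in> words V k. xs ! i = xs ! j}"
      then have xs: "set xs \<subseteq> V" "length xs = k" "xs ! i = xs ! j" by (auto simp: words_def)
      define as where "as = take i xs"
      define bs where "bs = take p (drop (Suc i) xs)"
      define ds where "ds = drop (Suc j) xs"
      have 1: "xs = as @ xs ! i # drop (Suc i) xs"
        unfolding as_def using ij xs by (intro id_take_nth_drop) auto
      have "drop p (drop (Suc i) xs) = drop j xs" using ij by (simp add: p_def)
      also have "\<dots> = xs ! i # ds" unfolding ds_def using ij xs Cons_nth_drop_Suc[of j xs] by simp
      finally have 2: "drop (Suc i) xs = bs @ xs ! i # ds"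
        unfolding bs_def by (metis append_take_drop_id)
      have eq: "xs = as @ xs ! i # bs @ xs ! i # ds" using 1 2 by simp
      have len: "length as = i" "length bs = p" "length ds = q - i"
        using ij xs by (auto simp: as_def bs_def ds_def p_def q_def)
      have sub: "set as \<subseteq> V" "set bs \<subseteq> V" "set ds \<subseteq> V" "xs ! i \<in> V"
        using xs(1) ij xs(2) unfolding as_def bs_def ds_def
        by (auto dest!: in_set_takeD in_set_dropD)
      have iq: "i \<le> q" using ij by (simp add: q_def)
      show "\<exists>y\<in>T. (\<lambda>(x, bs, cs). drop (q - i) cs @ x # bs @ x # take (q - i) cs) y = xs \<and> closed_wt M xs \<le> g y"
      proof (rule bexI[of _ "(xs ! i, bs, ds @ as)"], intro conjI)
        show "(\<lambda>(x, bs, cs). drop (q - i) cs @ x # bs @ x # take (q - i) cs) (xs ! i, bs, ds @ as) = xs"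
          using len eq by simp
        have "closed_wt M xs = g (xs ! i, bs, ds @ as)"
          by (subst eq, subst closed_wt_split) (simp add: g_def)
        then show "closed_wt M xs \<le> g (xs ! i, bs, ds @ as)" by simp
        show "(xs ! i, bs, ds @ as) \<in> T" using sub len iq by (auto simp: T_def words_def)
      qed
    qed
  qed
  also have "sum g T = (\<Sum>x\<in>V. (\<Sum>bs\<in>words V p. walk_wt M (x # bs @ [x])) * (\<Sum>cs\<in>words V q. walk_wt M (x # cs @ [x])))"
    unfolding T_def g_def by (simp add: sum.cartesian_product[symmetric] sum_product)
  also have "\<dots> = (\<Sum>x\<in>V. kernel_pow V M (Suc p) x x * kernel_pow V M (Suc q) x x)"
    by (intro sum.cong refl) (simp add: sum_walk_wt[OF fin] del: kernel_pow.simps)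
  also have "Suc p = j - i" using ij by (simp add: p_def)
  also have "Suc q = k - (j - i)" using ij by (simp add: q_def)
  finally show ?thesis .
qed

section \<open>Powers of a symmetric matrix and log-convex sequences\<close>

lemma kernel_pow_nonneg: "(\<And>x y. 0 \<le> M x y) \<Longrightarrow> 0 \<le> kernel_pow V M k x y"
  by (induction k arbitrary: x) (auto intro!: sum_nonneg)

lemma kernel_pow_add:
  assumes "finite V" "x \<in> V"
  shows "kernel_pow V M (a + b) x y = (\<Sum>z\<in>V. kernel_pow V M a x z * kernel_pow V M b z y)"
  using assms(2)
proof (induction a arbitrary: x)
  case 0
  then show ?case using assms(1) by (simp add: if_distrib[of "\<lambda>t. t * _"] cong: if_cong)
next
  case (Suc a)
  have "kernel_pow V M (Suc a + b) x y = (\<Sum>t\<in>V. \<Sum>z\<in>V. M x t * (kernel_pow V M a t z * kernel_pow V M b z y))"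
    using Suc.IH by (simp add: sum_distrib_left)
  also have "\<dots> = (\<Sum>z\<in>V. \<Sum>t\<in>V. M x t * (kernel_pow V M a t z * kernel_pow V M b z y))"
    by (rule sum.swap)
  also have "\<dots> = (\<Sum>z\<in>V. kernel_pow V M (Suc a) x z * kernel_pow V M b z y)"
    by (simp add: sum_distrib_right mult.assoc)
  finally show ?case .
qed

lemma kernel_pow_sym:
  assumes fin: "finite V" and sym: "\<And>x y. M x y = M y x" and "x \<in> V" "y \<in> V"
  shows "kernel_pow V M k x y = kernel_pow V M k y x"
  using assms(3,4)
proof (induction k arbitrary: x y)
  case (Suc k)
  have one: "kernel_pow V M (Suc 0) z w = M z w" if "w \<in> V" for z w
    using that fin by (simp add: if_distrib[of "\<lambda>t. _ * t"] cong: if_cong)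
  have "kernel_pow V M (Suc k) x y = kernel_pow V M (k + Suc 0) x y" by simp
  also have "\<dots> = (\<Sum>z\<in>V. kernel_pow V M k x z * kernel_pow V M (Suc 0) z y)"
    using kernel_pow_add[OF fin Suc.prems(1), of M k "Suc 0" y] by simp
  also have "\<dots> = (\<Sum>z\<in>V. M y z * kernel_pow V M k z x)"
    using Suc one sym by (intro sum.cong refl) (metis mult.commute)
  finally show ?case by simp
qed auto

lemma kernel_pow_diag_square:
  assumes "finite V" "\<And>x y. M x y = M y x" "x \<in> V"
  shows "kernel_pow V M (2 * a) x x = (\<Sum>z\<in>V. (kernel_pow V M a x z)\<^sup>2)"
  using kernel_pow_add[OF assms(1,3), of M a a x] kernel_pow_sym[where M = M and x = x, OF assms(1,2,3)]
  by (simp add: mult_2 power2_eq_square)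

text \<open>Cauchy-Schwarz for rows \<open>x\<close> of the powers \<open>a\<close> and
  \<open>b\<close>. It yields log-convexity of the even diagonal entries and reduces odd powers to
  even ones.\<close>

lemma kernel_pow_diag_cauchy:
  assumes "finite V" "\<And>x y. M x y = M y x" "x \<in> V"
  shows "(kernel_pow V M (a + b) x x)\<^sup>2 \<le> kernel_pow V M (2 * a) x x * kernel_pow V M (2 * b) x x"
proof -
  have "kernel_pow V M (a + b) x x = (\<Sum>z\<in>V. kernel_pow V M a x z * kernel_pow V M b x z)"
    using kernel_pow_add[OF assms(1,3), of M a b x] kernel_pow_sym[where M = M and k = b and x = x, OF assms(1,2)] assms(3) by simp
  then show ?thesis
    using Cauchy_Schwarz_ineq_sum[of "kernel_pow V M a x" "kernel_pow V M b x" V]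
    by (simp add: kernel_pow_diag_square[where M = M, OF assms])
qed

lemma log_convex_ratio:
  fixes f :: "nat \<Rightarrow> real"
  assumes pos: "\<And>i. 0 < f i" and cvx: "\<And>i. (f (Suc i))\<^sup>2 \<le> f i * f (Suc (Suc i))" and "i \<le> j"
  shows "f (Suc i) / f i \<le> f (Suc j) / f j"
  using \<open>i \<le> j\<close>
proof (induction j rule: dec_induct)
  case (step n)
  have "f (Suc n) / f n \<le> f (Suc (Suc n)) / f (Suc n)"
    using cvx[of n] pos by (simp add: field_simps power2_eq_square)
  then show ?case using step by linarith
qed simp

text \<open>Moving two indices apart with constant sum does not decrease the product, because the
  ratios of neighbours increase; the extreme position of the smaller index is 1.\<close>

lemma log_convex_product:
  fixes f :: "nat \<Rightarrow> real"
  assumes pos: "\<And>i. 0 < f i" and cvx: "\<And>i. (f (Suc i))\<^sup>2 \<le> f i * f (Suc (Suc i))"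
  shows "f (Suc i) * f (Suc j) \<le> f 1 * f (Suc (i + j))"
proof (induction i)
  case (Suc i)
  have r: "f (Suc (Suc i)) / f (Suc i) \<le> f (Suc (Suc (i + j))) / f (Suc (i + j))"
    using log_convex_ratio[of f, OF pos cvx, of "Suc i" "Suc (i + j)"] by simp
  have "f (Suc (Suc i)) * f (Suc j) = f (Suc (Suc i)) / f (Suc i) * (f (Suc i) * f (Suc j))"
    using pos[of "Suc i"] by simp
  also have "\<dots> \<le> f (Suc (Suc (i + j))) / f (Suc (i + j)) * (f 1 * f (Suc (i + j)))"
    using pos by (intro mult_mono[OF r Suc]) (auto intro: less_imp_le)
  also have "\<dots> = f 1 * f (Suc (Suc i + j))" using pos[of "Suc (i + j)"] by simp
  finally show ?case .
qed simp

text \<open>If \<open>f n\<close> exceeds \<open>r * f (Suc n)\<close>, the last ratio is below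
  \<open>1 / r\<close>, hence so are all earlier ones, and \<open>f n\<close> is at most
  \<open>(1 / r) ^ n\<close> because of \<open>f 0 = 1\<close>.\<close>

lemma log_convex_last:
  fixes f :: "nat \<Rightarrow> real"
  assumes pos: "\<And>i. 0 < f i" and cvx: "\<And>i. (f (Suc i))\<^sup>2 \<le> f i * f (Suc (Suc i))"
    and f0: "f 0 = 1" and r: "r > 0"
  shows "f n \<le> r * f (Suc n) + (1 / r) ^ n"
proof (cases "f n \<le> r * f (Suc n)")
  case True
  then show ?thesis using r by (simp add: add_increasing2)
next
  case False
  have "f (Suc n) / f n \<le> 1 / r" using False r pos[of n] by (simp add: field_simps)
  then have ratio: "f (Suc i) \<le> 1 / r * f i" if "i \<le> n" for i
  proof -
    have "f (Suc i) / f i \<le> 1 / r"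
      using log_convex_ratio[of f, OF pos cvx that] \<open>f (Suc n) / f n \<le> 1 / r\<close> by linarith
    then show ?thesis using pos[of i] by (simp add: pos_divide_le_eq)
  qed
  have "i \<le> n \<Longrightarrow> f i \<le> (1 / r) ^ i" for i
  proof (induction i)
    case (Suc i)
    have "f (Suc i) \<le> 1 / r * f i" using ratio Suc by simp
    also have "\<dots> \<le> 1 / r * (1 / r) ^ i" using Suc r by (intro mult_left_mono) auto
    finally show ?case by simp
  qed (simp add: f0)
  then have "f n \<le> (1 / r) ^ n" by simp
  moreover have "0 \<le> r * f (Suc n)" using r pos[of "Suc n"] by simp
  ultimately show ?thesis by linarith
qed

text \<open>With \<open>f x i = M^(2 i) x x\<close>, closed walks that visit \<open>x\<close> twice have weight at most
  \<open>f x 1 * f x (l - 1)\<close> by log-convexity of \<open>f x\<close>, and \<open>f x (l - 1)\<close> is at most \<open>r * f x l\<close> up to a term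
  that is negligible after summation over \<open>x\<close>.\<close>

lemma closed_wt_injective_lower:
  fixes \<delta> :: real
  assumes fin: "finite V" and nn: "\<And>x y. 0 \<le> M x y" and sym: "\<And>x y. M x y = M y x"
    and loop: "\<And>x. M x x = 0" and \<delta>: "\<delta> > 0"
    and diag: "\<And>x. x \<in> V \<Longrightarrow> 0 < kernel_pow V M 2 x x \<and> kernel_pow V M 2 x x \<le> 1 / \<delta>"
    and tr: "1 \<le> (\<Sum>x\<in>V. kernel_pow V M (2 * l) x x)"
    and l: "l \<ge> 2" and V: "(8 * l\<^sup>2) ^ l * card V \<le> \<delta> ^ l"
  shows "1 / 2 \<le> (\<Sum>xs | xs \<in> words V (2 * l) \<and> distinct xs. closed_wt M xs)"
proof -
  define f where "f = (\<lambda>x i. kernel_pow V M (2 * i) x x)"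
  define Z where "Z = (\<Sum>x\<in>V. f x l)"
  \<comment> \<open>Chosen so that the at most \<open>2 * l\<^sup>2\<close> pairs of positions, each
    with a factor \<open>1 / \<delta>\<close>, contribute only \<open>1 / 4\<close> of the
    trace.\<close>
  define r where "r = \<delta> / (8 * l\<^sup>2)"
  have r: "r > 0" using \<delta> l by (simp add: r_def)
  have f0: "f x 0 = 1" for x by (simp add: f_def)
  have cvx: "(f x (Suc i))\<^sup>2 \<le> f x i * f x (Suc (Suc i))" if "x \<in> V" for x i
  proof -
    have "2 * Suc i = i + Suc (Suc i)" by simp
    then show ?thesis unfolding f_def using kernel_pow_diag_cauchy[where M = M, OF fin sym that, of i "Suc (Suc i)"] by metis
  qed
  have fnn: "0 \<le> f x i" for x i unfolding f_def by (rule kernel_pow_nonneg[OF nn])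
  have pos: "0 < f x i" if x: "x \<in> V" for x i
  proof (induction i rule: nat_less_induct)
    case (1 i)
    consider "i = 0" | "i = 1" | j where "i = Suc (Suc j)" by (metis One_nat_def not0_implies_Suc)
    then show ?case
    proof cases
      case 2
      then show ?thesis using diag[OF x] by (simp add: f_def)
    next
      case 3
      then have "0 < f x (Suc j)" using 1 by auto
      then have "0 < (f x (Suc j))\<^sup>2" by simp
      moreover have "(f x (Suc j))\<^sup>2 \<le> f x j * f x i" using cvx[OF x, of j] 3 by simp
      ultimately have "0 < f x j * f x i" by linarith
      then show ?thesis using fnn[of x i] fnn[of x j] by (simp add: zero_less_mult_iff)
    qed (simp add: f0)
  qed
  have pair: "kernel_pow V M p x x * kernel_pow V M (2 * l - p) x x \<le> 1 / \<delta> * f x (l - 1)"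
    if x: "x \<in> V" and p: "1 \<le> p" "p < 2 * l" for x p
  proof -
    have one: "kernel_pow V M (Suc 0) x x = 0" using x loop by (simp add: if_distrib[of "\<lambda>t. _ * t"] cong: if_cong)
    have top: "f x 1 * f x (l - 1) \<le> 1 / \<delta> * f x (l - 1)"
      using diag[OF x] fnn by (intro mult_right_mono) (auto simp: f_def)
    show ?thesis
    proof (cases "even p")
      case True
      then obtain i where i: "p = 2 * Suc i" using p by (metis dvdE gr0_implies_Suc less_eq_Suc_le One_nat_def mult_is_0 neq0_conv not_one_le_zero)
      then obtain j where j: "l = Suc i + Suc j" using p by (metis less_imp_Suc_add mult_less_cancel1 add_Suc_right add_Suc_shift)
      have "kernel_pow V M p x x * kernel_pow V M (2 * l - p) x x = f x (Suc i) * f x (Suc j)"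
        by (simp add: f_def i j del: kernel_pow.simps)
      also have "\<dots> \<le> f x 1 * f x (Suc (i + j))" by (rule log_convex_product[of "f x", OF pos[OF x] cvx[OF x]])
      also have "Suc (i + j) = l - 1" using j by simp
      finally show ?thesis using top by simp
    next
      \<comment> \<open>Cauchy-Schwarz bounds each odd power by the two neighbouring even ones;
        pairing the four resulting factors crosswise puts log-convexity to use. The extreme lengths
        1 and \<open>2 * l - 1\<close> have no such neighbours, but vanish for lack of
        loops.\<close>
      case odd: False
      show ?thesis
      proof (cases "p = 1 \<or> p = 2 * l - 1")
        case True
        then have "kernel_pow V M p x x * kernel_pow V M (2 * l - p) x x = 0"
          using one l p by auto
        moreover have "0 \<le> 1 / \<delta> * f x (l - 1)" using fnn[of x "l - 1"] \<delta> by simp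
        ultimately show ?thesis by linarith
      next
        case False
        from odd obtain i' where i': "p = 2 * i' + 1" by (auto elim: oddE)
        define i where "i = i' - 1"
        define j where "j = l - i - 3"
        have ij: "p = Suc i + Suc (Suc i)" "2 * l - p = Suc j + Suc (Suc j)" "l - 1 = Suc (i + Suc j)"
        proof -
          have "1 \<le> i'" "i' + 2 \<le> l" using i' False p by presburger+
          then show "p = Suc i + Suc (Suc i)" "2 * l - p = Suc j + Suc (Suc j)" "l - 1 = Suc (i + Suc j)"
            using i' unfolding i_def j_def by linarith+
        qed
        have "(kernel_pow V M p x x)\<^sup>2 \<le> f x (Suc i) * f x (Suc (Suc i))"
          unfolding f_def ij(1) by (rule kernel_pow_diag_cauchy[where M = M, OF fin sym x])
        moreover have "(kernel_pow V M (2 * l - p) x x)\<^sup>2 \<le> f x (Suc j) * f x (Suc (Suc j))"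
          unfolding f_def ij(2) by (rule kernel_pow_diag_cauchy[where M = M, OF fin sym x])
        ultimately have "(kernel_pow V M p x x)\<^sup>2 * (kernel_pow V M (2 * l - p) x x)\<^sup>2
          \<le> (f x (Suc i) * f x (Suc (Suc i))) * (f x (Suc j) * f x (Suc (Suc j)))"
          using fnn by (intro mult_mono) auto
        also have "\<dots> = (f x (Suc i) * f x (Suc (Suc j))) * (f x (Suc (Suc i)) * f x (Suc j))" by simp
        also have "\<dots> \<le> (f x 1 * f x (l - 1)) * (f x 1 * f x (l - 1))"
          using log_convex_product[of "f x", OF pos[OF x] cvx[OF x], of i "Suc j"]
            log_convex_product[of "f x", OF pos[OF x] cvx[OF x], of "Suc i" j] fnn ij(3)
          by (intro mult_mono[of "f x (Suc i) * f x (Suc (Suc j))"]) auto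
        finally have "(kernel_pow V M p x x * kernel_pow V M (2 * l - p) x x)\<^sup>2 \<le> (f x 1 * f x (l - 1))\<^sup>2"
          by (simp only: power_mult_distrib[of "kernel_pow V M p x x" "kernel_pow V M (2 * l - p) x x"]
              power2_eq_square[of "f x 1 * f x (l - 1)"])
        then have "kernel_pow V M p x x * kernel_pow V M (2 * l - p) x x \<le> f x 1 * f x (l - 1)"
          by (rule power2_le_imp_le) (use fnn in simp)
        then show ?thesis using top by simp
      qed
    qed
  qed
  define D where "D = (\<lambda>(i, j). {xs \<in> words V (2 * l). xs ! i = xs ! j})"
  define I where "I = {(i, j). i < j \<and> j < 2 * l}"
  have I: "I \<subseteq> {..<2 * l} \<times> {..<2 * l}" by (auto simp: I_def)
  then have finI: "finite I" by (rule finite_subset) auto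
  have cardI: "2 * card I \<le> (2 * l) * (2 * l)"
  proof -
    have "card I + card ((\<lambda>(i, j). (j, i)) ` I) = card (I \<union> (\<lambda>(i, j). (j, i)) ` I)"
      using finI by (intro card_Un_disjoint[symmetric]) (auto simp: I_def)
    also have "\<dots> \<le> card ({..<2 * l} \<times> {..<2 * l})" using I by (intro card_mono) auto
    also have "card ((\<lambda>(i, j). (j, i)) ` I) = card I" by (intro card_image) (auto simp: inj_on_def)
    finally show ?thesis by simp
  qed
  have cw: "0 \<le> closed_wt M xs" for xs unfolding closed_wt_def by (rule walk_wt_nonneg[OF nn])
  have fw: "finite (words V (2 * l))" by (rule finite_words[OF fin])
  have l2: "2 * l = Suc (2 * l - 1)" using l by simp
  have Z: "(\<Sum>xs\<in>words V (2 * l). closed_wt M xs) = Z"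
    using sum_closed_wt[OF fin, where M = M and k = "2 * l - 1"] l2 unfolding Z_def f_def by metis
  have Z1: "1 \<le> Z" using tr by (simp add: Z_def f_def)
  have "(\<Sum>xs | xs \<in> words V (2 * l) \<and> \<not> distinct xs. closed_wt M xs) \<le> (\<Sum>xs\<in>(\<Union>ij\<in>I. D ij). closed_wt M xs)"
  proof (rule sum_mono2)
    show "finite (\<Union>ij\<in>I. D ij)" using finI fw by (auto simp: D_def)
    show "{xs \<in> words V (2 * l). \<not> distinct xs} \<subseteq> (\<Union>ij\<in>I. D ij)"
    proof
      fix xs assume "xs \<in> {xs \<in> words V (2 * l). \<not> distinct xs}"
      then have xs: "xs \<in> words V (2 * l)" "\<not> distinct xs" "length xs = 2 * l" by (auto simp: words_def)
      then obtain i j where "i < 2 * l" "j < 2 * l" "i \<noteq> j" "xs ! i = xs ! j" by (auto simp: distinct_conv_nth)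
      then have "(i, j) \<in> I \<and> xs \<in> D (i, j) \<or> (j, i) \<in> I \<and> xs \<in> D (j, i)"
        using xs(1) by (cases "i < j") (auto simp: I_def D_def)
      then show "xs \<in> (\<Union>ij\<in>I. D ij)" by blast
    qed
  qed (rule cw)
  also have "\<dots> \<le> (\<Sum>ij\<in>I. \<Sum>xs\<in>D ij. closed_wt M xs)"
  proof -
    have "(\<Sum>xs\<in>(\<Union>ij\<in>I. D ij). closed_wt M xs) \<le> (\<Sum>(ij, xs)\<in>Sigma I D. closed_wt M xs)"
      using finI fw cw
      by (intro sum_le_included[where i = snd]) (auto simp: D_def intro!: finite_SigmaI)
    then show ?thesis using finI fw by (subst sum.Sigma) (auto simp: D_def)
  qed
  also have "\<dots> \<le> (\<Sum>ij\<in>I. 1 / \<delta> * (\<Sum>x\<in>V. f x (l - 1)))"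
  proof (rule sum_mono)
    fix ij assume "ij \<in> I"
    then obtain i j where ij: "ij = (i, j)" "i < j" "j < 2 * l" by (auto simp: I_def)
    have "(\<Sum>xs\<in>D ij. closed_wt M xs)
      \<le> (\<Sum>x\<in>V. kernel_pow V M (j - i) x x * kernel_pow V M (2 * l - (j - i)) x x)"
      using sum_closed_wt_repeat[where M = M, OF fin nn ij(2,3)] by (simp add: D_def ij(1))
    also have "\<dots> \<le> (\<Sum>x\<in>V. 1 / \<delta> * f x (l - 1))" using ij by (intro sum_mono pair) auto
    also have "\<dots> = 1 / \<delta> * (\<Sum>x\<in>V. f x (l - 1))" by (simp add: sum_distrib_left)
    finally show "(\<Sum>xs\<in>D ij. closed_wt M xs) \<le> 1 / \<delta> * (\<Sum>x\<in>V. f x (l - 1))" .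
  qed
  also have "\<dots> = card I * (1 / \<delta> * (\<Sum>x\<in>V. f x (l - 1)))" by simp
  also have "\<dots> \<le> (2 * l\<^sup>2) * (1 / \<delta> * (r * Z + card V * (1 / r) ^ (l - 1)))"
  proof (intro mult_mono)
    have "2 * real (card I) \<le> 2 * l * (2 * l)" using cardI by (metis of_nat_le_iff of_nat_mult of_nat_numeral)
    then show "real (card I) \<le> real (2 * l\<^sup>2)" by (simp add: power2_eq_square)
    have "(\<Sum>x\<in>V. f x (l - 1)) \<le> (\<Sum>x\<in>V. r * f x l + (1 / r) ^ (l - 1))"
      using log_convex_last[of "f _", OF pos cvx f0 r, where n = "l - 1"] l by (intro sum_mono) auto
    also have "\<dots> = r * Z + card V * (1 / r) ^ (l - 1)" by (simp add: sum.distrib Z_def sum_distrib_left)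
    finally show "(\<Sum>x\<in>V. f x (l - 1)) \<le> r * Z + card V * (1 / r) ^ (l - 1)" .
  qed (use \<delta> fnn in \<open>auto intro!: sum_nonneg divide_nonneg_pos\<close>)
  also have "\<dots> = 1 / 4 * (Z + card V / r ^ l)"
  proof -
    have "card V * (1 / r) ^ (l - 1) = r * (card V / r ^ l)"
      using r l by (cases l) (auto simp: power_one_over field_simps)
    then have "(2 * l\<^sup>2) * (1 / \<delta> * (r * Z + card V * (1 / r) ^ (l - 1)))
      = (2 * l\<^sup>2 * r / \<delta>) * (Z + card V / r ^ l)"
      using \<delta> by (simp only:) (simp add: field_simps)
    moreover have "2 * l\<^sup>2 * r / \<delta> = 1 / 4" using \<delta> l by (simp add: r_def)
    ultimately show ?thesis by (simp only:)
  qed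
  \<comment> \<open>This is what the hypothesis relating \<open>card V\<close> and \<delta> is for:
    it says \<open>card V \<le> r ^ l\<close>.\<close>
  also have "\<dots> \<le> 1 / 4 * (Z + 1)"
  proof -
    have "card V * (8 * l\<^sup>2) ^ l \<le> \<delta> ^ l" using V by (simp add: mult.commute)
    then have "card V \<le> r ^ l" using l by (simp add: r_def power_divide pos_le_divide_eq)
    then have "card V / r ^ l \<le> 1" using r by (simp add: divide_le_eq)
    then show ?thesis by (intro mult_left_mono add_left_mono) auto
  qed
  finally have bad: "(\<Sum>xs | xs \<in> words V (2 * l) \<and> \<not> distinct xs. closed_wt M xs) \<le> Z / 2"
    using Z1 by (simp add: field_simps)
  have "Z = (\<Sum>xs | xs \<in> words V (2 * l) \<and> distinct xs. closed_wt M xs)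
     + (\<Sum>xs | xs \<in> words V (2 * l) \<and> \<not> distinct xs. closed_wt M xs)"
    unfolding Z[symmetric] using fw
    by (subst sum.union_disjoint[symmetric]) (auto intro!: sum.cong)
  then show ?thesis using bad Z1 by linarith
qed

section \<open>Cycles as sets of edges\<close>

definition cycle_edges :: "'v list \<Rightarrow> 'v set set" where
  "cycle_edges xs = (\<lambda>i. {xs ! i, xs ! (Suc i mod length xs)}) ` {..<length xs}"

text \<open>As a set of edges, a cycle is counted once, although rotations and reflections of its
  vertex list represent it too.\<close>

definition graph_cycles :: "nat \<Rightarrow> 'v set set set" where
  "graph_cycles k = {cycle_edges xs | xs. length xs = k \<and> distinct xs}"

lemma Suc_mod_less: "i < k \<Longrightarrow> Suc i mod k = (if Suc i = k then 0 else Suc i)"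
  by auto

lemma inj_on_cycle_edge:
  assumes "distinct xs" "length xs = k" "3 \<le> k"
  shows "inj_on (\<lambda>i. {xs ! i, xs ! (Suc i mod k)}) {..<k}"
proof (rule inj_onI)
  fix i j assume ij: "i \<in> {..<k}" "j \<in> {..<k}"
    and eq: "{xs ! i, xs ! (Suc i mod k)} = {xs ! j, xs ! (Suc j mod k)}"
  have lt: "Suc i mod k < k" "Suc j mod k < k" using assms by auto
  have n: "xs ! a = xs ! b \<longleftrightarrow> a = b" if "a < k" "b < k" for a b
    using assms that by (simp add: nth_eq_iff_index_eq)
  from eq have "i = j \<or> (i = Suc j mod k \<and> Suc i mod k = j)"
    using n ij lt by (auto simp: doubleton_eq_iff)
  then show "i = j" using ij assms(3) by (auto simp: Suc_mod_less split: if_splits)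
qed

lemma card_cycle_edges:
  "distinct xs \<Longrightarrow> 3 \<le> length xs \<Longrightarrow> card (cycle_edges xs) = length xs"
  unfolding cycle_edges_def by (simp add: card_image inj_on_cycle_edge)

lemma Union_cycle_edges: "3 \<le> length xs \<Longrightarrow> \<Union>(cycle_edges xs) = set xs"
  unfolding cycle_edges_def set_conv_nth
  by (auto, metis mod_less_divisor length_greater_0_conv list.size(3) not_numeral_le_zero gr0I)

lemma card_cycle_edge:
  assumes "distinct xs" "3 \<le> length xs" "e \<in> cycle_edges xs" shows "card e = 2"
proof -
  obtain i where i: "i < length xs" "e = {xs ! i, xs ! (Suc i mod length xs)}"
    using assms by (auto simp: cycle_edges_def)
  moreover have "Suc i mod length xs < length xs" "Suc i mod length xs \<noteq> i"
    using assms i by (auto simp: Suc_mod_less)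
  ultimately show ?thesis using assms by (auto simp: card_2_iff nth_eq_iff_index_eq)
qed

text \<open>A proper part of a cycle is a union of paths. The successor map embeds the edges of
  \<open>S\<close> into their vertices; if it hit all vertices, the set of indices would be closed
  under cyclic predecessors and thus be everything.\<close>

lemma card_Union_proper_cycle_subset:
  assumes xs: "distinct xs" "3 \<le> length xs" and sub: "S \<subset> cycle_edges xs" and ne: "S \<noteq> {}"
  shows "card S + 1 \<le> card (\<Union>S)"
proof (rule ccontr)
  assume neg: "\<not> card S + 1 \<le> card (\<Union>S)"
  define k where "k = length xs"
  define e where "e = (\<lambda>i. {xs ! i, xs ! (Suc i mod k)})"
  define J where "J = {i. i < k \<and> e i \<in> S}"
  have k: "3 \<le> k" using xs by (simp add: k_def)
  have inj: "inj_on e {..<k}" unfolding e_def using inj_on_cycle_edge[OF xs(1)] xs by (simp add: k_def)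
  have S: "S = e ` J" using sub by (auto simp: J_def e_def cycle_edges_def k_def)
  have cJ: "card S = card J" unfolding S
    by (rule card_image) (rule inj_on_subset[OF inj], auto simp: J_def)
  have n: "xs ! a = xs ! b \<longleftrightarrow> a = b" if "a < k" "b < k" for a b
    using xs that by (simp add: nth_eq_iff_index_eq k_def)
  define \<phi> where "\<phi> = (\<lambda>i. xs ! (Suc i mod k))"
  have inj\<phi>: "inj_on \<phi> J"
    unfolding \<phi>_def using k n by (auto simp: inj_on_def J_def Suc_mod_less split: if_splits)
  have finJ: "finite J" by (simp add: J_def)
  have sub\<phi>: "\<phi> ` J \<subseteq> \<Union>S" by (auto simp: S \<phi>_def e_def)
  have "finite (\<Union>S)" unfolding S using finJ by (auto simp: e_def)
  moreover have "card (\<Union>S) \<le> card (\<phi> ` J)" using neg cJ inj\<phi> by (simp add: card_image)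
  ultimately have eq: "\<phi> ` J = \<Union>S" using sub\<phi> by (intro card_seteq) auto
  have pred: "\<exists>i'\<in>J. i = Suc i' mod k" if "i \<in> J" for i
  proof -
    have "xs ! i \<in> \<phi> ` J" unfolding eq using that by (auto simp: S e_def)
    then obtain i' where "i' \<in> J" "xs ! i = xs ! (Suc i' mod k)" by (auto simp: \<phi>_def)
    then show ?thesis using n[of i "Suc i' mod k"] that k by (auto simp: J_def)
  qed
  \<comment> \<open>Descending from any index reaches 0; the predecessor of 0 is
    \<open>k - 1\<close>, and descending from there covers all indices.\<close>
  have down: "i \<in> J \<Longrightarrow> j \<le> i \<Longrightarrow> j \<in> J" for i j
  proof (induction "i - j" arbitrary: i)
    case (Suc d)
    then obtain i' where i': "i' \<in> J" "i = Suc i' mod k" using pred by blast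
    moreover have "i' < k" using i' by (simp add: J_def)
    ultimately have "i = Suc i'" using Suc by (auto simp: Suc_mod_less split: if_splits)
    then have "d = i' - j" "j \<le> i'" using Suc.hyps(2) Suc.prems by auto
    then show ?case using Suc.hyps(1) i' by blast
  qed simp
  obtain i where "i \<in> J" using ne S by auto
  then have "0 \<in> J" using down by auto
  then obtain i' where i': "i' \<in> J" "0 = Suc i' mod k" using pred by blast
  then have "i' = k - 1" using k by (auto simp: J_def Suc_mod_less split: if_splits)
  then have "j \<in> J" if "j < k" for j using down[OF i'(1), of j] that by simp
  then have "J = {..<k}" by (auto simp: J_def)
  then have "S = cycle_edges xs" by (simp add: S cycle_edges_def e_def k_def)
  then show False using sub by simp
qed

lemma finite_Union_graph_cycle:
  "C \<in> graph_cycles k \<Longrightarrow> finite C \<and> finite (\<Union>C)"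
  by (auto simp: graph_cycles_def cycle_edges_def)

text \<open>The normalization by degrees makes a lower bound on the degrees sufficient: no regularity is needed.\<close>

lemma graph_closed_walks:
  fixes Y :: "'v set set" and \<delta> :: real
  assumes fin: "finite Y" and two: "\<And>e. e \<in> Y \<Longrightarrow> card e = 2" and ne: "Y \<noteq> {}"
    and deg: "\<And>x. x \<in> \<Union>Y \<Longrightarrow> \<delta> \<le> card {e \<in> Y. x \<in> e}" and \<delta>: "\<delta> > 0" and l: "l \<ge> 2"
    and big: "(8 * (real l)\<^sup>2) ^ l * card (\<Union>Y) \<le> \<delta> ^ l"
  shows "\<delta> ^ (2 * l) / 2 \<le> card {xs \<in> words (\<Union>Y) (2 * l). distinct xs \<and> cycle_edges xs \<subseteq> Y}"
proof -
  define V where "V = \<Union>Y"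
  define d where "d = (\<lambda>x. real (card {e \<in> Y. x \<in> e}))"
  \<comment> \<open>The adjacency matrix scaled by the square roots of the degrees. The vector of
    these square roots is an eigenvector for the eigenvalue 1 (\<open>eig\<close>), and the lower
    bound on the degrees makes all entries at most \<open>1 / \<delta>\<close>.\<close>
  define M where "M = (\<lambda>x y. if {x, y} \<in> Y then 1 / sqrt (d x * d y) else 0)"
  define N where "N = (\<lambda>x. {y \<in> V. {x, y} \<in> Y})"
  define Z where "Z = (\<Sum>x\<in>V. kernel_pow V M (2 * l) x x)"
  have fe: "finite e" if "e \<in> Y" for e using two[OF that] card.infinite by fastforce
  then have finV: "finite V" unfolding V_def using fin by auto
  have d\<delta>: "\<delta> \<le> d x" if "x \<in> V" for x using deg that by (simp add: d_def V_def)
  then have dpos: "0 < d x" if "x \<in> V" for x using \<delta> that by (meson less_le_trans)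
  have sym: "M x y = M y x" for x y by (simp add: M_def insert_commute mult.commute)
  have nn: "0 \<le> M x y" for x y by (simp add: M_def d_def)
  have loop: "M x x = 0" for x using two[of "{x}"] by (auto simp: M_def)
  have inV: "x \<in> V \<and> y \<in> V" if "{x, y} \<in> Y" for x y using that by (auto simp: V_def)
  have Mle: "M x y \<le> 1 / \<delta>" for x y
  proof (cases "{x, y} \<in> Y")
    case True
    have "\<delta> = sqrt (\<delta> * \<delta>)" using \<delta> by simp
    also have "\<dots> \<le> sqrt (d x * d y)"
      using d\<delta> inV[OF True] \<delta> by (intro real_sqrt_le_mono mult_mono) (auto simp: d_def)
    finally show ?thesis using True \<delta> by (simp add: M_def frac_le)
  qed (use \<delta> in \<open>simp add: M_def\<close>)
  have cardN: "card (N x) = d x" for x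
  proof -
    have "bij_betw (\<lambda>y. {x, y}) (N x) {e \<in> Y. x \<in> e}"
    proof (rule bij_betwI')
      fix e assume e: "e \<in> {e \<in> Y. x \<in> e}"
      then have "card e = 2" using two by simp
      then obtain a b where "e = {a, b}" by (auto simp: card_2_iff)
      then obtain y where "e = {x, y}" using e by auto
      then show "\<exists>y\<in>N x. e = {x, y}" using e inV[of x y] by (auto simp: N_def)
    qed (auto simp: N_def doubleton_eq_iff)
    then show ?thesis by (simp add: d_def bij_betw_same_card)
  qed
  have sumM: "(\<Sum>y\<in>V. M x y * f y) = (\<Sum>y\<in>N x. f y / sqrt (d x * d y))" for x f
    unfolding N_def M_def using finV by (intro sum.mono_neutral_cong_right) auto
  have diag: "0 < kernel_pow V M 2 x x \<and> kernel_pow V M 2 x x \<le> 1 / \<delta>" if x: "x \<in> V" for x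
  proof -
    have one: "kernel_pow V M 1 x z = M x z" if "z \<in> V" for z
      using that finV by (simp add: if_distrib[of "\<lambda>t. _ * t"] cong: if_cong)
    have "kernel_pow V M 2 x x = (\<Sum>z\<in>V. (kernel_pow V M 1 x z)\<^sup>2)"
      using kernel_pow_diag_square[where M = M and a = 1, OF finV sym x] by simp
    also have "\<dots> = (\<Sum>z\<in>V. M x z * M x z)"
      using one by (intro sum.cong) (auto simp: power2_eq_square simp del: kernel_pow.simps)
    also have "\<dots> = (\<Sum>z\<in>N x. M x z / sqrt (d x * d z))" by (rule sumM)
    also have "\<dots> = (\<Sum>z\<in>N x. 1 / (d x * d z))"
    proof (rule sum.cong[OF refl])
      fix z assume "z \<in> N x"
      then have "{x, z} \<in> Y" "0 < d x * d z" using dpos x by (auto simp: N_def)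
      then show "M x z / sqrt (d x * d z) = 1 / (d x * d z)"
        by (simp add: M_def flip: real_sqrt_mult)
    qed
    finally have eq: "kernel_pow V M 2 x x = (\<Sum>z\<in>N x. 1 / (d x * d z))" .
    have finN: "finite (N x)" using finV by (simp add: N_def)
    have "(\<Sum>z\<in>N x. 1 / (d x * d z)) \<le> (\<Sum>z\<in>N x. 1 / (d x * \<delta>))"
      using d\<delta> dpos[OF x] \<delta> dpos by (intro sum_mono divide_left_mono mult_left_mono mult_pos_pos) (auto simp: N_def)
    also have "\<dots> = 1 / \<delta>" using cardN[of x] dpos[OF x] by simp
    finally have le: "kernel_pow V M 2 x x \<le> 1 / \<delta>" using eq by simp
    have "N x \<noteq> {}" using cardN[of x] dpos[OF x] by auto
    then have "0 < (\<Sum>z\<in>N x. 1 / (d x * d z))"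
      using finN dpos x by (intro sum_pos) (auto simp: N_def)
    then show ?thesis using eq le by simp
  qed
  define S where "S = (\<Sum>x\<in>V. d x)"
  obtain e where "e \<in> Y" using ne by auto
  moreover have "e \<noteq> {}" using two[OF \<open>e \<in> Y\<close>] by auto
  ultimately have "V \<noteq> {}" by (auto simp: V_def)
  then have S: "S > 0" unfolding S_def using finV dpos by (intro sum_pos) auto
  have eig: "(\<Sum>y\<in>V. kernel_pow V M k x y * sqrt (d y)) = sqrt (d x)" if "x \<in> V" for x k
    using that
  proof (induction k arbitrary: x)
    case 0
    then show ?case using finV by (simp add: if_distrib[of "\<lambda>t. t * _"] cong: if_cong)
  next
    case (Suc k)
    have "(\<Sum>y\<in>V. kernel_pow V M (Suc k) x y * sqrt (d y)) = (\<Sum>y\<in>V. \<Sum>z\<in>V. M x z * (kernel_pow V M k z y * sqrt (d y)))"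
      by (simp add: sum_distrib_right mult.assoc)
    also have "\<dots> = (\<Sum>z\<in>V. M x z * (\<Sum>y\<in>V. kernel_pow V M k z y * sqrt (d y)))"
      by (subst sum.swap) (simp add: sum_distrib_left)
    also have "\<dots> = (\<Sum>z\<in>V. M x z * sqrt (d z))" using Suc.IH by simp
    also have "\<dots> = (\<Sum>z\<in>N x. sqrt (d z) / sqrt (d x * d z))" by (rule sumM)
    also have "\<dots> = (\<Sum>z\<in>N x. 1 / sqrt (d x))"
    proof (rule sum.cong[OF refl])
      fix z assume "z \<in> N x"
      then have "0 < d z" using dpos by (auto simp: N_def)
      then show "sqrt (d z) / sqrt (d x * d z) = 1 / sqrt (d x)" by (simp add: real_sqrt_mult)
    qed
    also have "\<dots> = d x / sqrt (d x)" using cardN[of x] by simp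
    also have "\<dots> = sqrt (d x)" using dpos[OF Suc.prems] by (simp add: real_div_sqrt)
    finally show ?case .
  qed
  have Zsq: "Z = (\<Sum>x\<in>V. \<Sum>y\<in>V. (kernel_pow V M l x y)\<^sup>2)"
    unfolding Z_def by (intro sum.cong refl kernel_pow_diag_square[OF finV sym])
  have "S = (\<Sum>x\<in>V. sqrt (d x) * sqrt (d x))" unfolding S_def using dpos by (intro sum.cong) (auto simp: less_imp_le)
  also have "\<dots> = (\<Sum>x\<in>V. sqrt (d x) * (\<Sum>y\<in>V. kernel_pow V M l x y * sqrt (d y)))"
    using eig by (intro sum.cong) auto
  also have "\<dots> = (\<Sum>x\<in>V. \<Sum>y\<in>V. (sqrt (d x) * sqrt (d y)) * kernel_pow V M l x y)"
    by (simp add: sum_distrib_left mult_ac)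
  also have "\<dots> = (\<Sum>(x, y)\<in>V \<times> V. (sqrt (d x) * sqrt (d y)) * kernel_pow V M l x y)"
    by (rule sum.cartesian_product)
  finally have Seq: "S = (\<Sum>p\<in>V \<times> V. (sqrt (d (fst p)) * sqrt (d (snd p))) * kernel_pow V M l (fst p) (snd p))"
    by (simp add: case_prod_beta)
  \<comment> \<open>The eigenvector forces the trace of the \<open>2 * l\<close>-th power, which is
    the sum of the squared entries of the \<open>l\<close>-th power, to be at least 1.\<close>
  have "S\<^sup>2 \<le> (\<Sum>p\<in>V \<times> V. (sqrt (d (fst p)) * sqrt (d (snd p)))\<^sup>2) * (\<Sum>p\<in>V \<times> V. (kernel_pow V M l (fst p) (snd p))\<^sup>2)"
    unfolding Seq by (rule Cauchy_Schwarz_ineq_sum)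
  also have "(\<Sum>p\<in>V \<times> V. (kernel_pow V M l (fst p) (snd p))\<^sup>2) = Z"
    unfolding Zsq by (simp add: sum.cartesian_product case_prod_beta)
  also have "(\<Sum>p\<in>V \<times> V. (sqrt (d (fst p)) * sqrt (d (snd p)))\<^sup>2) = (\<Sum>x\<in>V. \<Sum>y\<in>V. d x * d y)"
    unfolding sum.cartesian_product using dpos
    by (intro sum.cong) (auto simp: power_mult_distrib less_imp_le)
  also have "\<dots> = S\<^sup>2" unfolding S_def power2_eq_square by (simp add: sum_product)
  finally have "1 \<le> Z" using S by (simp add: mult_le_cancel_left1)
  then have "1 / 2 \<le> (\<Sum>xs | xs \<in> words V (2 * l) \<and> distinct xs. closed_wt M xs)"
    unfolding Z_def using closed_wt_injective_lower[where M = M and \<delta> = \<delta> and l = l, OF finV nn sym loop \<delta> diag] l big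
    by (simp add: V_def)
  also have "\<dots> = (\<Sum>xs\<in>{xs \<in> words V (2 * l). distinct xs \<and> cycle_edges xs \<subseteq> Y}. closed_wt M xs)"
  proof (rule sum.mono_neutral_cong_right)
    show "finite {xs \<in> words V (2 * l). distinct xs}" using finite_words[OF finV] by auto
    show "\<forall>xs\<in>{xs \<in> words V (2 * l). distinct xs} - {xs \<in> words V (2 * l). distinct xs \<and> cycle_edges xs \<subseteq> Y}. closed_wt M xs = 0"
    proof (rule ballI, rule ccontr)
      fix xs assume xs: "xs \<in> {xs \<in> words V (2 * l). distinct xs} - {xs \<in> words V (2 * l). distinct xs \<and> cycle_edges xs \<subseteq> Y}"
        and nz: "closed_wt M xs \<noteq> 0"
      then have len: "length xs = 2 * l" by (auto simp: words_def)
      have "{xs ! i, xs ! (Suc i mod length xs)} \<in> Y" if i: "i < length xs" for i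
      proof -
        have "M ((xs @ [hd xs]) ! i) ((xs @ [hd xs]) ! Suc i) \<noteq> 0"
          using nz i unfolding closed_wt_def by (rule_tac walk_wt_nonzero) auto
        moreover have "(xs @ [hd xs]) ! Suc i = xs ! (Suc i mod length xs)"
          using i by (cases "Suc i = length xs") (auto simp: nth_append intro!: hd_conv_nth)
        ultimately show ?thesis using i by (auto simp: nth_append M_def split: if_splits)
      qed
      then have "cycle_edges xs \<subseteq> Y" by (auto simp: cycle_edges_def)
      then show False using xs by auto
    qed
  qed auto
  \<comment> \<open>Each closed walk has weight at most \<open>(1 / \<delta>) ^ (2 * l)\<close>, so
    a total weight of \<open>1 / 2\<close> needs many walks.\<close>
  also have "\<dots> \<le> (\<Sum>xs\<in>{xs \<in> words V (2 * l). distinct xs \<and> cycle_edges xs \<subseteq> Y}. (1 / \<delta>) ^ (2 * l))"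
  proof (rule sum_mono)
    fix xs assume "xs \<in> {xs \<in> words V (2 * l). distinct xs \<and> cycle_edges xs \<subseteq> Y}"
    then have len: "length xs = 2 * l" by (auto simp: words_def)
    then obtain y ys where xs: "xs = y # ys" using l by (cases xs) auto
    have "walk_wt M (y # (ys @ [y])) \<le> (1 / \<delta>) ^ length (ys @ [y])" by (rule walk_wt_le[OF nn Mle])
    moreover have "length (ys @ [y]) = 2 * l" using len xs by simp
    ultimately show "closed_wt M xs \<le> (1 / \<delta>) ^ (2 * l)"
      by (simp only: closed_wt_def xs list.sel append_Cons)
  qed
  also have "\<dots> = card {xs \<in> words V (2 * l). distinct xs \<and> cycle_edges xs \<subseteq> Y} / \<delta> ^ (2 * l)"
    by (simp add: power_one_over)
  finally show ?thesis using \<delta> by (simp add: V_def field_simps)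
qed

section \<open>Supersaturation of even cycles in graphs\<close>

text \<open>A subgraph of minimum degree at least \<open>card Y / w\<close> contains enough closed
  walks without repetition, and a cycle arises from at most \<open>(2 * l) ^ (2 * l)\<close> of
  them.\<close>

lemma cycle_supersaturation:
  fixes Y :: "'v set set" and w :: real
  assumes fin: "finite Y" and two: "\<And>e. e \<in> Y \<Longrightarrow> card e = 2" and l: "l \<ge> 2"
    and w: "card (\<Union>Y) \<le> w" "w > 0" and big: "(8 * (real l)\<^sup>2) ^ l * w \<le> (card Y / w) ^ l"
  shows "(card Y / w) ^ (2 * l) \<le> 2 * (2 * real l) ^ (2 * l) * card {C \<in> graph_cycles (2 * l). C \<subseteq> Y}"
proof -
  define \<delta> where "\<delta> = card Y / w"
  have "0 < (8 * (real l)\<^sup>2) ^ l * w" using l w by simp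
  then have "0 < \<delta> ^ l" using big by (simp add: \<delta>_def)
  then have "\<delta> \<noteq> 0" using l by (auto simp: power_0_left)
  then have \<delta>: "\<delta> > 0" and ne: "Y \<noteq> {}" using w by (auto simp: \<delta>_def)
  have fe: "finite e" if "e \<in> Y" for e using two[OF that] card.infinite by fastforce
  have "\<delta> * card (\<Union>(id ` Y)) \<le> \<delta> * w" using w \<delta> by (intro mult_left_mono) auto
  also have "\<dots> = card Y" using w by (simp add: \<delta>_def)
  finally have dens: "\<delta> * card (\<Union>(id ` Y)) \<le> card Y" .
  obtain Z where Z: "Z \<subseteq> Y" "Z \<noteq> {}" "\<And>x. x \<in> \<Union>(id ` Z) \<Longrightarrow> \<delta> \<le> card {e \<in> Z. x \<in> id e}"
    using min_degree_subfamily[of Y id \<delta>, OF fin _ ne dens] fe by auto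
  have finZ: "finite Z" using finite_subset[OF Z(1) fin] .
  have fU: "finite (\<Union>Y)" using fin fe by auto
  have cV: "card (\<Union>Z) \<le> w" using card_mono[OF fU, of "\<Union>Z"] Z w by (meson Sup_subset_mono of_nat_mono order_trans)
  define W where "W = {xs \<in> words (\<Union>Z) (2 * l). distinct xs \<and> cycle_edges xs \<subseteq> Z}"
  define \<C> where "\<C> = {C \<in> graph_cycles (2 * l). C \<subseteq> Y}"
  have "(8 * (real l)\<^sup>2) ^ l * card (\<Union>Z) \<le> (8 * (real l)\<^sup>2) ^ l * w" using cV by (intro mult_left_mono) auto
  then have "(8 * (real l)\<^sup>2) ^ l * card (\<Union>Z) \<le> \<delta> ^ l"
    using big unfolding \<delta>_def by (rule order_trans)
  then have "\<delta> ^ (2 * l) / 2 \<le> card W"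
    unfolding W_def using Z two
    by (intro graph_closed_walks finZ \<delta> l) auto
  have fin\<C>: "finite \<C>" using fin by (simp add: \<C>_def)
  have "W \<subseteq> (\<Union>C\<in>\<C>. words (\<Union>C) (2 * l))"
  proof
    fix xs assume "xs \<in> W"
    then have xs: "length xs = 2 * l" "distinct xs" "cycle_edges xs \<subseteq> Z" by (auto simp: W_def words_def)
    then have "cycle_edges xs \<in> \<C>" using Z by (auto simp: \<C>_def graph_cycles_def)
    moreover have "xs \<in> words (\<Union>(cycle_edges xs)) (2 * l)"
      using xs l by (subst Union_cycle_edges) (auto simp: words_def)
    ultimately show "xs \<in> (\<Union>C\<in>\<C>. words (\<Union>C) (2 * l))" by blast
  qed
  then have "card W \<le> card (\<Union>C\<in>\<C>. words (\<Union>C) (2 * l))"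
    using fin\<C> by (intro card_mono) (auto simp: \<C>_def intro!: finite_words finite_Union_graph_cycle[THEN conjunct2])
  also have "\<dots> \<le> (\<Sum>C\<in>\<C>. card (words (\<Union>C) (2 * l)))" by (rule card_UN_le[OF fin\<C>])
  also have "\<dots> = (\<Sum>C\<in>\<C>. (2 * l) ^ (2 * l))"
  proof (rule sum.cong[OF refl])
    fix C assume "C \<in> \<C>"
    then obtain xs where xs: "length xs = 2 * l" "distinct xs" "C = cycle_edges xs"
      by (auto simp: \<C>_def graph_cycles_def)
    then have "\<Union>C = set xs" using l by (simp add: Union_cycle_edges)
    then show "card (words (\<Union>C) (2 * l)) = (2 * l) ^ (2 * l)"
      using xs by (simp add: card_words distinct_card)
  qed
  finally have "card W \<le> (2 * l) ^ (2 * l) * card \<C>" by (simp add: mult.commute)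
  then have "real (card W) \<le> real ((2 * l) ^ (2 * l) * card \<C>)" by (rule of_nat_mono)
  then show ?thesis using \<open>\<delta> ^ (2 * l) / 2 \<le> card W\<close> by (simp add: \<delta>_def \<C>_def)
qed

text \<open>The hypothesis \<open>cnt\<close> of \<open>saturation\<close> is linear in the number
  of edges, so the power in the cycle count is replaced by a linear minorant that vanishes at
  \<open>m\<^sub>0\<close>.\<close>

lemma cycle_supersaturation_linear:
  fixes Y :: "'v set set" and w m\<^sub>0 :: real
  assumes fin: "finite Y" and two: "\<And>e. e \<in> Y \<Longrightarrow> card e = 2" and l: "l \<ge> 2"
    and w: "card (\<Union>Y) \<le> w" "w > 0" and m0: "m\<^sub>0 > 0" and big: "(8 * (real l)\<^sup>2) ^ l * w \<le> (m\<^sub>0 / w) ^ l"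
  shows "(m\<^sub>0 / w) ^ (2 * l) / (2 * (2 * real l) ^ (2 * l) * m\<^sub>0) * (card Y - m\<^sub>0)
     \<le> card {C \<in> graph_cycles (2 * l). C \<subseteq> Y}"
proof (cases "card Y \<le> m\<^sub>0")
  case True
  then have "(m\<^sub>0 / w) ^ (2 * l) / (2 * (2 * real l) ^ (2 * l) * m\<^sub>0) * (card Y - m\<^sub>0) \<le> 0"
    using m0 w by (intro mult_nonneg_nonpos) auto
  then show ?thesis by (rule order_trans) simp
next
  case False
  define A where "A = 2 * (2 * real l) ^ (2 * l)"
  have A: "A > 0" using l by (simp add: A_def)
  have "(m\<^sub>0 / w) ^ l \<le> (card Y / w) ^ l" using False m0 w by (intro power_mono divide_right_mono) auto
  then have "(8 * (real l)\<^sup>2) ^ l * w \<le> (card Y / w) ^ l" using big by linarith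
  then have "(card Y / w) ^ (2 * l) \<le> A * card {C \<in> graph_cycles (2 * l). C \<subseteq> Y}"
    using cycle_supersaturation[OF fin two l w] by (simp add: A_def)
  moreover have "(m\<^sub>0 / w) ^ (2 * l) / m\<^sub>0 * (card Y - m\<^sub>0) \<le> (card Y / w) ^ (2 * l)"
  proof -
    have e: "t ^ (2 * l) = t ^ (2 * l - 1) * t" for t :: real using l by (cases l) auto
    have "(m\<^sub>0 / w) ^ (2 * l) / m\<^sub>0 * (card Y - m\<^sub>0) \<le> (m\<^sub>0 / w) ^ (2 * l) / m\<^sub>0 * card Y"
      using m0 w by (intro mult_left_mono) auto
    also have "\<dots> = (m\<^sub>0 / w) ^ (2 * l - 1) * (card Y / w)" using m0 by (simp add: e)
    also have "\<dots> \<le> (card Y / w) ^ (2 * l - 1) * (card Y / w)"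
      using False m0 w by (intro mult_right_mono power_mono divide_right_mono) auto
    finally show ?thesis by (simp add: e)
  qed
  ultimately have "(m\<^sub>0 / w) ^ (2 * l) / m\<^sub>0 * (card Y - m\<^sub>0) \<le> A * card {C \<in> graph_cycles (2 * l). C \<subseteq> Y}"
    by linarith
  then have "(m\<^sub>0 / w) ^ (2 * l) / m\<^sub>0 * (card Y - m\<^sub>0) / A \<le> card {C \<in> graph_cycles (2 * l). C \<subseteq> Y}"
    using A by (simp only: pos_divide_le_eq mult.commute)
  moreover have "(m\<^sub>0 / w) ^ (2 * l) / m\<^sub>0 * (card Y - m\<^sub>0) / A = (m\<^sub>0 / w) ^ (2 * l) / (A * m\<^sub>0) * (card Y - m\<^sub>0)"
    by simp
  ultimately show ?thesis by (simp only: A_def)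
qed

text \<open>\<open>saturation\<close> over random sets of \<open>w\<close> vertices. The hypothesis
  \<open>big\<close> says that a typical sample is just dense enough for the cycle count; small
  \<open>w\<close> gives strong degree bounds, since each further edge of \<open>S\<close> gains
  \<open>w / card V\<close>.\<close>

lemma graph_balanced_supersaturation:
  fixes V :: "'v set" and G :: "'v set set" and w :: nat
  assumes V: "finite V" and G: "\<And>e. e \<in> G \<Longrightarrow> e \<subseteq> V \<and> card e = 2" and ne: "G \<noteq> {}"
    and l: "l \<ge> 2" and w: "4 \<le> w" "w \<le> card V"
    and big: "(128 * (real l)\<^sup>2) ^ l * w \<le> (real (card G) * w / (real (card V))\<^sup>2) ^ l"
  obtains \<S> where "\<S> \<subseteq> {C \<in> graph_cycles (2 * l). C \<subseteq> G}"
    "(card G / (16 * card V)) ^ (2 * l) / (2 * (2 * real l) ^ (2 * l)) \<le> card \<S>"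
    "\<And>S. S \<noteq> {} \<Longrightarrow> card S < 2 * l \<Longrightarrow> real (card {A \<in> \<S>. S \<subseteq> A})
       \<le> 2 + 32 * 4 ^ l * (w / card V) ^ (card S - 1) * card \<S> / card G"
proof -
  define n m where "n = real (card V)" and "m = real (card G)"
  define q where "q = w / n"
  \<comment> \<open>A sample has at least \<open>(q / 2)\<^sup>2 * m = 4 * m\<^sub>0\<close> edges
    on average, of which \<open>m\<^sub>0\<close> are lost in the linear minorant. \<open>M\<close>
    and \<open>B\<close> are such that surviving members of the family and bad sets cost
    \<open>m\<^sub>0\<close> each, which leaves a surplus.\<close>
  define m\<^sub>0 where "m\<^sub>0 = q\<^sup>2 * m / 16"
  define A where "A = 2 * (2 * real l) ^ (2 * l)"
  define \<kappa> where "\<kappa> = (m\<^sub>0 / w) ^ (2 * l) / (A * m\<^sub>0)"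
  define M where "M = (m / (16 * n)) ^ (2 * l) / A"
  define B where "B = 32 * (4::real) ^ l"
  \<comment> \<open>Proper subsets with \<open>j\<close> edges span at least \<open>j + 1\<close>
    vertices, the whole cycle only \<open>2 * l\<close>.\<close>
  define \<pi> where "\<pi> = (\<lambda>j. if j < 2 * l then q ^ (j + 1) else q ^ (2 * l))"
  \<comment> \<open>The summand 2 meets the requirement of \<open>saturation\<close>; it is absorbed
    later, where the second summand is shown to be at least 1.\<close>
  define \<Delta> where "\<Delta> = (\<lambda>j. 2 + B * q ^ (j - 1) * M / m)"
  have finG: "finite G" using V G by (intro finite_subset[of G "Pow V"]) auto
  have n: "n > 0" and m: "m > 0" using w ne finG V by (auto simp: n_def m_def card_gt_0_iff)
  have q: "0 < q" "q \<le> 1" using w n by (auto simp: q_def n_def)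
  have m0: "m\<^sub>0 > 0" using q m by (simp add: m\<^sub>0_def)
  have A: "A > 0" using l by (simp add: A_def)
  have \<kappa>: "\<kappa> > 0" using m0 A w by (simp add: \<kappa>_def)
  have Mpos: "M > 0" using m n A by (simp add: M_def)
  have B: "B > 0" by (simp add: B_def)
  have big0: "(8 * (real l)\<^sup>2) ^ l * w \<le> (m\<^sub>0 / w) ^ l"
  proof -
    have "m\<^sub>0 / w = (m * w / n\<^sup>2) / 16" using w n by (simp add: m\<^sub>0_def q_def power2_eq_square mult_ac)
    then have "(m\<^sub>0 / w) ^ l = (m * w / n\<^sup>2) ^ l / 16 ^ l" by (simp add: power_divide)
    moreover have "(128 * (real l)\<^sup>2) ^ l = (8 * (real l)\<^sup>2) ^ l * 16 ^ l"
    proof -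
      have "128 * (real l)\<^sup>2 = (8 * (real l)\<^sup>2) * 16" by simp
      then show ?thesis by (simp only: power_mult_distrib)
    qed
    then have "(8 * (real l)\<^sup>2) ^ l * w * 16 ^ l \<le> (m * w / n\<^sup>2) ^ l"
      using big unfolding m_def n_def by (simp only: mult_ac)
    then have "(8 * (real l)\<^sup>2) ^ l * w \<le> (m * w / n\<^sup>2) ^ l / 16 ^ l" by (simp add: pos_le_divide_eq)
    ultimately show ?thesis by linarith
  qed
  obtain \<S> where \<S>: "\<S> \<subseteq> {C \<in> graph_cycles (2 * l). C \<subseteq> G}" "M \<le> card \<S>"
    "\<And>S. S \<noteq> {} \<Longrightarrow> card S < 2 * l \<Longrightarrow> real (card {A \<in> \<S>. S \<subseteq> A}) \<le> max (\<Delta> (card S)) 0"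
  proof (rule saturation[of G "{C \<in> graph_cycles (2 * l). C \<subseteq> G}" "2 * l" "samples V w" "\<lambda>W. {e \<in> G. e \<subseteq> W}"
        \<kappa> "\<lambda>_. m\<^sub>0" \<pi> \<Delta> "q\<^sup>2 * m / (B * M)" M])
    show "finite G" by fact
    show "C \<subseteq> G \<and> card C = 2 * l" if "C \<in> {C \<in> graph_cycles (2 * l). C \<subseteq> G}" for C
      using that l by (auto simp: graph_cycles_def card_cycle_edges)
    show "finite (samples V w)" by (rule finite_samples[OF V])
    show "\<kappa> * (card Y - m\<^sub>0) \<le> card {A \<in> {C \<in> graph_cycles (2 * l). C \<subseteq> G}. A \<subseteq> Y}"
      if W: "W \<in> samples V w" and Y: "Y \<subseteq> {e \<in> G. e \<subseteq> W}" for W Y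
    proof -
      have finW: "finite W" using W V finite_subset by (auto simp: samples_def)
      have finY: "finite Y" using Y finG finite_subset[of Y G] by auto
      have "card (\<Union>Y) \<le> card W" using Y finW by (intro card_mono) auto
      then have cU: "real (card (\<Union>Y)) \<le> w" using W by (simp add: samples_def)
      have "\<kappa> * (card Y - m\<^sub>0) \<le> card {C \<in> graph_cycles (2 * l). C \<subseteq> Y}"
        unfolding \<kappa>_def A_def
        using Y G w by (intro cycle_supersaturation_linear finY l cU m0 big0) auto
      also have "{C \<in> graph_cycles (2 * l). C \<subseteq> Y} = {A \<in> {C \<in> graph_cycles (2 * l). C \<subseteq> G}. A \<subseteq> Y}"
        using Y by auto
      finally show ?thesis .
    qed
    show "card {W \<in> samples V w. S \<subseteq> {e \<in> G. e \<subseteq> W}} \<le> \<pi> (card S) * card (samples V w)"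
      if C: "C \<in> {C \<in> graph_cycles (2 * l). C \<subseteq> G}" and S: "S \<subseteq> C" "S \<noteq> {}" for C S
    proof -
      obtain xs where xs: "length xs = 2 * l" "distinct xs" "C = cycle_edges xs"
        using C by (auto simp: graph_cycles_def)
      have "{W \<in> samples V w. S \<subseteq> {e \<in> G. e \<subseteq> W}} = {W \<in> samples V w. \<Union>S \<subseteq> W}"
        using S C by auto
      then have "real (card {W \<in> samples V w. S \<subseteq> {e \<in> G. e \<subseteq> W}}) \<le> q ^ card (\<Union>S) * card (samples V w)"
        using samples_upper[OF V, of "\<Union>S" w] S C G w by (auto simp: q_def n_def)
      also have "\<dots> \<le> \<pi> (card S) * card (samples V w)"
      proof (rule mult_right_mono)
        show "q ^ card (\<Union>S) \<le> \<pi> (card S)"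
        proof (cases "S = C")
          case True
          then show ?thesis using xs l by (simp add: \<pi>_def card_cycle_edges Union_cycle_edges distinct_card)
        next
          case False
          then have 1: "card S + 1 \<le> card (\<Union>S)"
            using card_Union_proper_cycle_subset[of xs S] xs l S by auto
          have "finite C" using finG C finite_subset by auto
          then have "card S < card C" using False S by (intro psubset_card_mono) auto
          then have "card S < 2 * l" using xs l by (simp add: card_cycle_edges)
          then show ?thesis using power_decreasing[OF 1, of q] q by (simp add: \<pi>_def)
        qed
      qed simp
      finally show ?thesis .
    qed
    show "\<kappa> > 0" by fact
    show "1 \<le> 2 * l" using l by simp
    show "2 \<le> \<Delta> j" for j using B q Mpos m by (simp add: \<Delta>_def)
    show "\<pi> j / \<Delta> j \<le> q\<^sup>2 * m / (B * M)" if "1 \<le> j" "j < 2 * l" for j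
    proof -
      have "\<pi> j / \<Delta> j \<le> \<pi> j / (B * q ^ (j - 1) * M / m)"
        using B q Mpos m by (intro divide_left_mono) (auto simp: \<Delta>_def \<pi>_def add_pos_pos)
      also have "\<dots> = q\<^sup>2 * m / (B * M)"
        using that q B Mpos m by (cases j) (auto simp: \<pi>_def power2_eq_square)
      finally show ?thesis .
    qed
    show "0 \<le> q\<^sup>2 * m / (B * M)" using q B Mpos m by simp
    show "0 \<le> \<pi> (2 * l)" using q by (simp add: \<pi>_def)
    show "0 \<le> M" using Mpos by simp
    define \<sigma> where "\<sigma> = real (card (samples V w))"
    have "card V choose w > 0" using w by simp
    then have \<sigma>: "\<sigma> > 0" using V by (simp add: \<sigma>_def card_samples)
    have 1: "M * (2 ^ (2 * l + 1) * (q\<^sup>2 * m / (B * M))) = m\<^sub>0"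
      using Mpos unfolding B_def m\<^sub>0_def by (simp add: power_mult)
    have 2: "M * (\<pi> (2 * l) / \<kappa>) = m\<^sub>0"
    proof -
      have wq: "w = q * n" using n by (simp add: q_def)
      have "m / (16 * n) * q = m\<^sub>0 / w" using n q unfolding m\<^sub>0_def wq by (simp add: power2_eq_square)
      then have "(m / (16 * n)) ^ (2 * l) * q ^ (2 * l) = (m\<^sub>0 / w) ^ (2 * l)"
        by (simp only: power_mult_distrib[symmetric])
      then have "M * \<pi> (2 * l) = (m\<^sub>0 / w) ^ (2 * l) / A" by (simp add: M_def \<pi>_def)
      also have "\<dots> = \<kappa> * m\<^sub>0" using m0 A by (simp add: \<kappa>_def)
      finally show ?thesis using \<kappa> by (simp add: field_simps)
    qed
    have "(\<Sum>W\<in>samples V w. real (card {e \<in> G. e \<subseteq> W})) = (\<Sum>W\<in>samples V w. \<Sum>e\<in>G. if e \<subseteq> W then 1 else 0)"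
      using finG by (simp add: sum.inter_filter[symmetric])
    also have "\<dots> = (\<Sum>e\<in>G. \<Sum>W\<in>samples V w. if e \<subseteq> W then 1 else 0)" by (rule sum.swap)
    also have "\<dots> = (\<Sum>e\<in>G. real (card {W \<in> samples V w. e \<subseteq> W}))"
      using finite_samples[OF V] by (simp add: sum.inter_filter[symmetric])
    finally have eq: "(\<Sum>W\<in>samples V w. real (card {e \<in> G. e \<subseteq> W})) = (\<Sum>e\<in>G. real (card {W \<in> samples V w. e \<subseteq> W}))" .
    have "(\<Sum>e\<in>G. (q / 2)\<^sup>2 * \<sigma>) \<le> (\<Sum>e\<in>G. real (card {W \<in> samples V w. e \<subseteq> W}))"
    proof (rule sum_mono)
      fix e assume e: "e \<in> G"
      have "w / (2 * card V) = q / 2" by (simp add: q_def n_def)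
      then show "(q / 2)\<^sup>2 * \<sigma> \<le> real (card {W \<in> samples V w. e \<subseteq> W})"
        using samples_lower[OF V, of e w] G[OF e] w unfolding \<sigma>_def by (simp only:)
    qed
    then have "4 * m\<^sub>0 * \<sigma> \<le> (\<Sum>W\<in>samples V w. real (card {e \<in> G. e \<subseteq> W}))"
      unfolding eq by (simp add: m\<^sub>0_def m_def power_divide mult_ac)
    then have "3 * m\<^sub>0 * \<sigma> \<le> (\<Sum>W\<in>samples V w. card {e \<in> G. e \<subseteq> W} - m\<^sub>0)"
      by (simp add: sum_subtractf \<sigma>_def algebra_simps)
    moreover have "\<sigma> * (2 * m\<^sub>0) < 3 * m\<^sub>0 * \<sigma>" using \<sigma> m0 by simp
    moreover have "M * (2 ^ (2 * l + 1) * (q\<^sup>2 * m / (B * M)) + \<pi> (2 * l) / \<kappa>) = 2 * m\<^sub>0"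
      unfolding distrib_left 1 2 by simp
    ultimately show "card (samples V w) * (M * (2 ^ (2 * l + 1) * (q\<^sup>2 * m / (B * M)) + \<pi> (2 * l) / \<kappa>))
       < (\<Sum>W\<in>samples V w. card {e \<in> G. e \<subseteq> W} - m\<^sub>0)"
      by (simp only: \<sigma>_def)
  qed auto
  show ?thesis
  proof (rule that[OF \<S>(1)])
    show "(card G / (16 * card V)) ^ (2 * l) / (2 * (2 * real l) ^ (2 * l)) \<le> card \<S>"
      using \<S>(2) by (simp add: M_def A_def m_def n_def)
    fix S :: "'v set set" assume S: "S \<noteq> {}" "card S < 2 * l"
    have "real (card {A \<in> \<S>. S \<subseteq> A}) \<le> \<Delta> (card S)"
      using \<S>(3)[OF S] B q Mpos m by (simp add: \<Delta>_def max_def split: if_splits)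
    also have "\<dots> \<le> 2 + B * q ^ (card S - 1) * card \<S> / m"
      unfolding \<Delta>_def using B q m \<S>(2) by (intro add_left_mono divide_right_mono mult_left_mono) auto
    finally show "real (card {A \<in> \<S>. S \<subseteq> A})
       \<le> 2 + 32 * 4 ^ l * (w / card V) ^ (card S - 1) * card \<S> / card G"
      by (simp add: B_def q_def n_def m_def)
  qed
qed

section \<open>Linear cycles\<close>

text \<open>A linear cycle is a graph cycle on the shared vertices \<open>xs\<close> whose edges
  receive private third vertices \<open>zs\<close>.\<close>

definition linear_edges :: "'v list \<Rightarrow> 'v list \<Rightarrow> 'v set set" where
  "linear_edges xs zs = (\<lambda>i. {xs ! i, xs ! (Suc i mod length xs), zs ! i}) ` {..<length xs}"

definition linear_cycles :: "nat \<Rightarrow> 'v set set set" where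
  "linear_cycles k = {linear_edges xs zs | xs zs. length xs = k \<and> length zs = k \<and> distinct (xs @ zs)}"

text \<open>Each triple adds one private vertex to the span of its graph edge, so the bound for
  proper subsets follows from that for graph cycles.\<close>

lemma linear_cycles_span:
  assumes T: "T \<in> linear_cycles k" and k: "3 \<le> k" and S: "S \<subseteq> T" "S \<noteq> {}"
  shows "card T = k" "S \<noteq> T \<Longrightarrow> 2 * card S + 1 \<le> card (\<Union>S)" "card (\<Union>T) = 2 * k"
    "finite (\<Union>T)" "\<And>f. f \<in> T \<Longrightarrow> card f = 3"
proof -
  obtain xs zs where xz: "T = linear_edges xs zs" "length xs = k" "length zs = k" "distinct (xs @ zs)"
    using T by (auto simp: linear_cycles_def)
  define e where "e = (\<lambda>i. {xs ! i, xs ! (Suc i mod k)})"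
  define f where "f = (\<lambda>i. insert (zs ! i) (e i))"
  have Tf: "T = f ` {..<k}" by (auto simp: xz linear_edges_def f_def e_def)
  have xs: "distinct xs" "distinct zs" "set xs \<inter> set zs = {}" using xz by auto
  have Ce: "cycle_edges xs = e ` {..<k}" by (simp add: cycle_edges_def e_def xz)
  have ex: "e i \<subseteq> set xs" if "i < k" for i using that xz k by (auto simp: e_def)
  have zx: "zs ! i \<notin> e j" if "i < k" "j < k" for i j
    using ex[OF that(2)] xs(3) that xz by (metis disjoint_iff nth_mem subsetD)
  have inje: "inj_on e {..<k}" unfolding e_def by (rule inj_on_cycle_edge[OF xs(1) xz(2) k])
  have injf: "inj_on f {..<k}"
  proof (rule inj_onI)
    fix i j assume ij: "i \<in> {..<k}" "j \<in> {..<k}" "f i = f j"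
    then have "zs ! i \<in> f j" by (auto simp: f_def)
    then have "zs ! i = zs ! j" using zx ij by (auto simp: f_def)
    then show "i = j" using xs ij xz by (simp add: nth_eq_iff_index_eq)
  qed
  show "card T = k" using injf by (simp add: Tf card_image)
  have span: "card (\<Union>(f ` J)) = card (\<Union>(e ` J)) + card J" if J: "J \<subseteq> {..<k}" for J
  proof -
    have finJ: "finite J" using J finite_subset by auto
    have "\<Union>(f ` J) = \<Union>(e ` J) \<union> (\<lambda>i. zs ! i) ` J" by (auto simp: f_def)
    moreover have "\<Union>(e ` J) \<inter> (\<lambda>i. zs ! i) ` J = {}" using zx J by blast
    moreover have "card ((\<lambda>i. zs ! i) ` J) = card J"
      using xs xz J by (intro card_image inj_on_nth) auto
    moreover have "finite (\<Union>(e ` J))" using finJ by (auto simp: e_def)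
    ultimately show ?thesis using finJ by (simp add: card_Un_disjoint)
  qed
  have "\<Union>(e ` {..<k}) = set xs" using Union_cycle_edges[of xs] xz k by (simp add: Ce[symmetric])
  then show "card (\<Union>T) = 2 * k" using span[of "{..<k}"] xs xz by (simp add: Tf distinct_card)
  then show "finite (\<Union>T)" using k by (metis card.infinite mult_is_0 not_numeral_le_zero zero_neq_numeral)
  show "card g = 3" if g: "g \<in> T" for g
  proof -
    obtain i where i: "i < k" "g = f i" using g by (auto simp: Tf)
    have "card (e i) = 2" using card_cycle_edge[OF xs(1), of "e i"] xz k i Ce by auto
    moreover have "finite (e i)" by (simp add: e_def)
    ultimately show ?thesis using zx[OF i(1) i(1)] i by (simp add: f_def)
  qed
  show "2 * card S + 1 \<le> card (\<Union>S)" if "S \<noteq> T"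
  proof -
    define J where "J = {i. i < k \<and> f i \<in> S}"
    have SJ: "S = f ` J" using S by (auto simp: J_def Tf)
    have "J \<noteq> {..<k}" using that SJ Tf by blast
    moreover have "J \<subseteq> {..<k}" by (auto simp: J_def)
    ultimately have J: "J \<subset> {..<k}" by blast
    have cJ: "card S = card J" unfolding SJ using J by (intro card_image inj_on_subset[OF injf]) auto
    have "e ` J \<subset> cycle_edges xs" unfolding Ce
      using J inj_on_image_eq_iff[OF inje, of J "{..<k}"] by blast
    then have "card (e ` J) + 1 \<le> card (\<Union>(e ` J))"
      using S SJ k xz by (intro card_Union_proper_cycle_subset[OF xs(1)]) auto
    moreover have "card (e ` J) = card J" using J by (intro card_image inj_on_subset[OF inje]) auto
    ultimately show ?thesis using span[of J] J cJ SJ by auto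
  qed
qed

section \<open>Expanding graph cycles by third vertices\<close>

text \<open>Greedy choice: at most \<open>N\<close> values are taken by earlier elements, so
  \<open>d\<close> remain at each step.\<close>

lemma card_injective_choices:
  assumes "finite C" "card C \<le> N" "\<And>e. e \<in> C \<Longrightarrow> finite (B e) \<and> d + N \<le> card (B e)"
  shows "d ^ card C \<le> card {z \<in> PiE C B. inj_on z C}"
  using assms
proof (induction C rule: finite_induct)
  case empty
  then show ?case by simp
next
  case (insert e C)
  let ?Z = "\<lambda>C. {z \<in> PiE C B. inj_on z C}"
  have fZ: "finite (?Z C)" "finite (?Z (insert e C))"
    using insert finite_PiE[of C B] finite_PiE[of "insert e C" B] by auto
  define P where "P = (SIGMA z:?Z C. B e - z ` C)"
  have injP: "inj_on (\<lambda>(z, x). z(e := x)) P"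
  proof (rule inj_onI, clarify)
    fix z x z' x' assume p: "(z, x) \<in> P" "(z', x') \<in> P" and eq: "z(e := x) = z'(e := x')"
    have "x = x'" using fun_cong[OF eq, of e] by simp
    moreover have "z = z'"
    proof
      fix t
      have "z e = undefined" "z' e = undefined" using p insert(2) by (auto simp: P_def PiE_def extensional_def)
      then show "z t = z' t" using fun_cong[OF eq, of t] by (cases "t = e") auto
    qed
    ultimately show "z = z' \<and> x = x'" by simp
  qed
  have "(\<lambda>(z, x). z(e := x)) ` P \<subseteq> ?Z (insert e C)"
  proof clarify
    fix z x assume p: "(z, x) \<in> P"
    then have z: "z \<in> PiE C B" "inj_on z C" "x \<in> B e" "x \<notin> z ` C" by (auto simp: P_def)
    have "z(e := x) \<in> PiE (insert e C) B" using z by (auto simp: PiE_def extensional_def)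
    moreover have "inj_on (z(e := x)) (insert e C)"
      using z insert(2) by (auto simp: inj_on_def)
    ultimately show "z(e := x) \<in> PiE (insert e C) B \<and> inj_on (z(e := x)) (insert e C)" by simp
  qed
  then have "card P \<le> card (?Z (insert e C))" using injP fZ(2) by (intro card_inj_on_le)
  moreover have "card P = (\<Sum>z\<in>?Z C. card (B e - z ` C))"
    unfolding P_def using fZ insert by (intro card_SigmaI) auto
  moreover have "(\<Sum>z\<in>?Z C. d) \<le> (\<Sum>z\<in>?Z C. card (B e - z ` C))"
  proof (rule sum_mono)
    fix z
    have "card (B e) - card (z ` C) \<le> card (B e - z ` C)" using insert by (intro diff_card_le_card_Diff) auto
    moreover have "card (z ` C) \<le> card C" by (rule card_image_le[OF insert(1)])
    ultimately show "d \<le> card (B e - z ` C)" using insert by fastforce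
  qed
  moreover have "d ^ card C \<le> card (?Z C)" using insert by auto
  then have "d ^ card (insert e C) \<le> card (?Z C) * d" using insert(1,2) by simp
  ultimately show ?case by simp
qed

lemma card_choices_le:
  assumes fin: "finite C" and A: "A \<subseteq> C"
    and B: "\<And>e. e \<in> A \<Longrightarrow> card (B e) \<le> 1" "\<And>e. e \<in> C - A \<Longrightarrow> card (B e) \<le> b"
  shows "card (PiE C B) \<le> b ^ (card C - card A)"
proof -
  have "card (PiE C B) = (\<Prod>e\<in>C. card (B e))" by (rule card_PiE[OF fin])
  also have "\<dots> = (\<Prod>e\<in>C - A. card (B e)) * (\<Prod>e\<in>A. card (B e))"
    by (rule prod.subset_diff[OF A fin])
  also have "\<dots> \<le> (\<Prod>e\<in>C - A. b) * (\<Prod>e\<in>A. 1)"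
    using B by (intro mult_mono prod_mono) auto
  also have "\<dots> = b ^ (card C - card A)"
    using A fin finite_subset[OF A fin] by (simp add: card_Diff_subset)
  finally show ?thesis .
qed

definition apexes :: "'v set set \<Rightarrow> 'v set \<Rightarrow> 'v set" where
  "apexes H e = {z. z \<notin> e \<and> insert z e \<in> H}"

text \<open>Pairs of a cycle and an apex map are counted rather than the resulting linear cycles,
  because pairs have a product structure. A linear cycle can come from several pairs; this
  multiplicity is bounded separately.\<close>

definition expansions :: "'v set set \<Rightarrow> 'v set set set \<Rightarrow> ('v set set \<times> ('v set \<Rightarrow> 'v)) set" where
  "expansions H \<S> = (SIGMA C:\<S>. {z \<in> PiE C (\<lambda>e. apexes H e - \<Union>C). inj_on z C})"

definition expand :: "'v set set \<times> ('v set \<Rightarrow> 'v) \<Rightarrow> 'v set set" where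
  "expand = (\<lambda>(C, z). (\<lambda>e. insert (z e) e) ` C)"

lemma expand_linear_cycle:
  assumes "p \<in> expansions H \<S>" "\<S> \<subseteq> graph_cycles k" "3 \<le> k"
  shows "expand p \<in> linear_cycles k \<and> expand p \<subseteq> H"
proof -
  obtain C z where p: "p = (C, z)" "C \<in> \<S>" "z \<in> PiE C (\<lambda>e. apexes H e - \<Union>C)" "inj_on z C"
    using assms(1) by (auto simp: expansions_def)
  obtain xs where xs: "C = cycle_edges xs" "length xs = k" "distinct xs"
    using p assms by (auto simp: graph_cycles_def)
  define e where "e = (\<lambda>i. {xs ! i, xs ! (Suc i mod k)})"
  have C: "C = e ` {..<k}" by (simp add: xs cycle_edges_def e_def)
  have inje: "inj_on e {..<k}" unfolding e_def by (rule inj_on_cycle_edge[OF xs(3,2) assms(3)])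
  have UC: "\<Union>C = set xs" using xs assms by (simp add: Union_cycle_edges)
  define zs where "zs = map (\<lambda>i. z (e i)) [0..<k]"
  have "distinct zs" unfolding zs_def distinct_map
    using comp_inj_on[OF inje, of z] p(4) C by (auto simp: comp_def lessThan_atLeast0)
  moreover have "set zs \<inter> set xs = {}" using p(3) UC C by (auto simp: zs_def)
  ultimately have d: "distinct (xs @ zs)" using xs by auto
  have "expand p = linear_edges xs zs"
    by (auto simp: expand_def p C linear_edges_def xs e_def zs_def image_image insert_commute intro!: image_cong)
  moreover have "linear_edges xs zs \<in> linear_cycles k"
    unfolding linear_cycles_def using d xs
    by (intro CollectI exI conjI) (rule refl, auto simp: zs_def)
  moreover have "expand p \<subseteq> H" using p(3) by (auto simp: expand_def p(1) apexes_def)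
  ultimately show ?thesis by simp
qed

text \<open>A member of \<open>S\<close> comes from one of its three pairs, whence the factor \<open>3 ^ card S\<close>.\<close>

lemma expand_degree:
  assumes fin: "finite H" and three: "\<And>f. f \<in> H \<Longrightarrow> card f = 3" and k: "3 \<le> k"
    and \<S>: "finite \<S>" "\<S> \<subseteq> graph_cycles k" and ap: "\<And>C e. C \<in> \<S> \<Longrightarrow> e \<in> C \<Longrightarrow> card (apexes H e) \<le> b"
    and S: "S \<noteq> {}" "finite S" "card S \<le> k" and \<beta>: "\<And>A. A \<noteq> {} \<Longrightarrow> card A = card S \<Longrightarrow> card {C \<in> \<S>. A \<subseteq> C} \<le> \<beta>"
  shows "finite {p \<in> expansions H \<S>. S \<subseteq> expand p}"
    "card {p \<in> expansions H \<S>. S \<subseteq> expand p} \<le> 3 ^ card S * (\<beta> * b ^ (k - card S))"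
proof -
  have finap: "finite (apexes H e)" for e
  proof (rule finite_subset)
    show "apexes H e \<subseteq> \<Union>H" by (auto simp: apexes_def)
    have "finite f" if "f \<in> H" for f using three[OF that] by (intro card_ge_0_finite) simp
    then show "finite (\<Union>H)" using fin by auto
  qed
  have "finite (expansions H \<S>)" unfolding expansions_def
  proof (rule finite_SigmaI[OF \<S>(1)])
    fix C assume "C \<in> \<S>"
    then have "finite C" using \<S>(2) finite_Union_graph_cycle by auto
    then have "finite (PiE C (\<lambda>e. apexes H e - \<Union>C))" using finap by (intro finite_PiE) auto
    then show "finite {z \<in> PiE C (\<lambda>e. apexes H e - \<Union>C). inj_on z C}" by auto
  qed
  then show "finite {p \<in> expansions H \<S>. S \<subseteq> expand p}" by auto
  show "card {p \<in> expansions H \<S>. S \<subseteq> expand p} \<le> 3 ^ card S * (\<beta> * b ^ (k - card S))"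
  proof (cases "S \<subseteq> H")
    case False
    then have "{p \<in> expansions H \<S>. S \<subseteq> expand p} = {}"
      using expand_linear_cycle[OF _ \<S>(2) k] by blast
    then have "card {p \<in> expansions H \<S>. S \<subseteq> expand p} = 0" by (simp only: card.empty)
    then show ?thesis by linarith
  next
    case SH: True
    \<comment> \<open>\<epsilon> guesses which pair of each triple in \<open>S\<close> belongs to
      the graph cycle. Once guessed, the apex over these pairs is forced (\<open>F\<close>), and the
      other pairs of the cycle have at most \<open>b\<close> apexes each.\<close>
    define E where "E = {\<epsilon> \<in> PiE S (\<lambda>f. {e. e \<subseteq> f \<and> card e = 2}). inj_on \<epsilon> S}"
    define F where "F = (\<lambda>\<epsilon> e. if e \<in> \<epsilon> ` S then {x. x \<notin> e \<and> insert x e \<in> S \<and> \<epsilon> (insert x e) = e} else apexes H e)"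
    define Q where "Q = (\<lambda>\<epsilon>. SIGMA C:{C \<in> \<S>. \<epsilon> ` S \<subseteq> C}. PiE C (F \<epsilon>))"
    have f3: "finite f" "card f = 3" if "f \<in> S" for f
    proof -
      show "card f = 3" using three SH that by auto
      then show "finite f" by (intro card_ge_0_finite) simp
    qed
    have cP: "card {e. e \<subseteq> f \<and> card e = 2} = 3" "finite {e. e \<subseteq> f \<and> card e = 2}" if "f \<in> S" for f
      using n_subsets[OF f3(1)[OF that], of 2] f3[OF that] by (auto simp: numeral_eq_Suc)
    have finPE: "finite (PiE S (\<lambda>f. {e. e \<subseteq> f \<and> card e = 2}))" using S cP by (intro finite_PiE) auto
    have finE: "finite E" using finPE by (auto simp: E_def)
    have "card E \<le> card (PiE S (\<lambda>f. {e. e \<subseteq> f \<and> card e = 2}))"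
      using finPE by (intro card_mono) (auto simp: E_def)
    also have "\<dots> = 3 ^ card S" using cP by (simp add: card_PiE[OF S(2)])
    finally have cardE: "card E \<le> 3 ^ card S" .
    have finC: "finite C" "card C = k" if C: "C \<in> \<S>" for C
    proof -
      obtain xs where "C = cycle_edges xs" "length xs = k" "distinct xs"
        using C \<S>(2) unfolding graph_cycles_def by blast
      then show "card C = k" using k by (auto simp: card_cycle_edges)
      then show "finite C" using k by (intro card_ge_0_finite) simp
    qed
    have F1: "card (F \<epsilon> e) \<le> 1 \<and> finite (F \<epsilon> e)" if "\<epsilon> \<in> E" "e \<in> \<epsilon> ` S" for \<epsilon> e
    proof -
      have "x = y" if "x \<in> F \<epsilon> e" "y \<in> F \<epsilon> e" for x y
      proof -
        have x: "x \<notin> e" "insert x e \<in> S" "\<epsilon> (insert x e) = e" and y: "insert y e \<in> S" "\<epsilon> (insert y e) = e"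
          using that \<open>e \<in> \<epsilon> ` S\<close> by (auto simp: F_def)
        then have "insert x e = insert y e" using \<open>\<epsilon> \<in> E\<close> by (auto simp: E_def inj_on_def)
        then show "x = y" using x by auto
      qed
      then have "F \<epsilon> e = {} \<or> (\<exists>x. F \<epsilon> e = {x})" by blast
      then show ?thesis by auto
    qed
    have finQ: "finite (Q \<epsilon>)" "card (Q \<epsilon>) \<le> \<beta> * b ^ (k - card S)" if \<epsilon>: "\<epsilon> \<in> E" for \<epsilon>
    proof -
      have c: "card (\<epsilon> ` S) = card S" using \<epsilon> by (auto simp: E_def intro: card_image)
      have fF: "finite (F \<epsilon> e)" for e using F1[OF \<epsilon>] finap by (cases "e \<in> \<epsilon> ` S") (auto simp: F_def)
      have fPi: "finite (PiE C (F \<epsilon>))" if "C \<in> \<S>" for C using finC[OF that] fF by (intro finite_PiE) auto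
      then show "finite (Q \<epsilon>)" unfolding Q_def using \<S> by (intro finite_SigmaI) auto
      have "card (Q \<epsilon>) = (\<Sum>C | C \<in> \<S> \<and> \<epsilon> ` S \<subseteq> C. card (PiE C (F \<epsilon>)))"
        unfolding Q_def using \<S> fPi by (intro card_SigmaI) auto
      also have "\<dots> \<le> (\<Sum>C | C \<in> \<S> \<and> \<epsilon> ` S \<subseteq> C. b ^ (k - card S))"
      proof (rule sum_mono)
        fix C assume C: "C \<in> {C \<in> \<S>. \<epsilon> ` S \<subseteq> C}"
        have "card (PiE C (F \<epsilon>)) \<le> b ^ (card C - card (\<epsilon> ` S))"
        proof (rule card_choices_le)
          show "card (F \<epsilon> e) \<le> b" if "e \<in> C - \<epsilon> ` S" for e using that C ap by (auto simp: F_def)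
        qed (use C finC F1[OF \<epsilon>] in auto)
        then show "card (PiE C (F \<epsilon>)) \<le> b ^ (k - card S)" using finC(2) C c by auto
      qed
      also have "\<dots> \<le> \<beta> * b ^ (k - card S)"
        using \<beta>[of "\<epsilon> ` S"] S c by (simp add: mult_le_mono1)
      finally show "card (Q \<epsilon>) \<le> \<beta> * b ^ (k - card S)" .
    qed
    have "{p \<in> expansions H \<S>. S \<subseteq> expand p} \<subseteq> (\<Union>\<epsilon>\<in>E. Q \<epsilon>)"
    proof
      fix p assume p: "p \<in> {p \<in> expansions H \<S>. S \<subseteq> expand p}"
      then obtain C z where Cz: "p = (C, z)" "C \<in> \<S>" "z \<in> PiE C (\<lambda>e. apexes H e - \<Union>C)" "inj_on z C"
        by (auto simp: expansions_def)
      have z: "z e \<in> apexes H e" "z e \<notin> \<Union>C" if "e \<in> C" for e using Cz(3) that by auto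
      have ff: "\<exists>e. e \<in> C \<and> f = insert (z e) e" if "f \<in> S" for f
        using p that by (auto simp: expand_def Cz(1))
      define \<epsilon> where "\<epsilon> = (\<lambda>f. if f \<in> S then (SOME e. e \<in> C \<and> f = insert (z e) e) else undefined)"
      have \<epsilon>: "\<epsilon> f \<in> C \<and> f = insert (z (\<epsilon> f)) (\<epsilon> f)" if "f \<in> S" for f
        using someI_ex[OF ff[OF that]] that by (simp add: \<epsilon>_def)
      have inj: "inj_on \<epsilon> S" using \<epsilon> by (metis inj_onI)
      have two: "card e = 2" if "e \<in> C" for e
      proof -
        obtain xs where "C = cycle_edges xs" "length xs = k" "distinct xs"
          using Cz(2) \<S>(2) unfolding graph_cycles_def by blast
        then show ?thesis using that k card_cycle_edge[of xs e] by simp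
      qed
      have "\<epsilon> \<in> PiE S (\<lambda>f. {e. e \<subseteq> f \<and> card e = 2})"
      proof (rule PiE_I)
        show "\<epsilon> f \<in> {e. e \<subseteq> f \<and> card e = 2}" if "f \<in> S" for f using \<epsilon>[OF that] two by blast
      qed (simp add: \<epsilon>_def)
      then have E: "\<epsilon> \<in> E" using inj by (simp add: E_def)
      have "z \<in> PiE C (F \<epsilon>)"
      proof (rule PiE_I)
        fix e assume e: "e \<in> C"
        show "z e \<in> F \<epsilon> e"
        proof (cases "e \<in> \<epsilon> ` S")
          case True
          then obtain f where f: "f \<in> S" "e = \<epsilon> f" by auto
          then have "f = insert (z e) e" using \<epsilon> by blast
          then show ?thesis using True z[OF e] f by (auto simp: F_def apexes_def)
        qed (use z[OF e] in \<open>simp add: F_def\<close>)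
      qed (use Cz(3) in auto)
      moreover have "\<epsilon> ` S \<subseteq> C" using \<epsilon> by auto
      ultimately show "p \<in> (\<Union>\<epsilon>\<in>E. Q \<epsilon>)" using E Cz by (auto simp: Q_def)
    qed
    then have "card {p \<in> expansions H \<S>. S \<subseteq> expand p} \<le> card (\<Union>\<epsilon>\<in>E. Q \<epsilon>)"
      using finE finQ by (intro card_mono) auto
    also have "\<dots> \<le> (\<Sum>\<epsilon>\<in>E. card (Q \<epsilon>))" by (rule card_UN_le[OF finE])
    also have "\<dots> \<le> (\<Sum>\<epsilon>\<in>E. \<beta> * b ^ (k - card S))" using finQ by (intro sum_mono) auto
    also have "\<dots> = card E * (\<beta> * b ^ (k - card S))" by simp
    also have "\<dots> \<le> 3 ^ card S * (\<beta> * b ^ (k - card S))" by (rule mult_le_mono1[OF cardE])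
    finally show ?thesis .
  qed
qed

text \<open>Of the apexes of an edge, at most \<open>k\<close> lie on the cycle and at most
  \<open>k\<close> are already used by other edges; this explains \<open>2 * k\<close>.\<close>

lemma expansions_lower:
  assumes fin: "finite H" "finite (\<Union>H)" and k: "3 \<le> k"
    and \<S>: "finite \<S>" "\<S> \<subseteq> graph_cycles k" and ap: "\<And>C e. C \<in> \<S> \<Longrightarrow> e \<in> C \<Longrightarrow> d + 2 * k \<le> card (apexes H e)"
  shows "card \<S> * d ^ k \<le> card (expansions H \<S>)"
proof -
  have finap: "finite (apexes H e)" for e
    by (rule finite_subset[OF _ fin(2)]) (auto simp: apexes_def)
  have 1: "d ^ k \<le> card {z \<in> PiE C (\<lambda>e. apexes H e - \<Union>C). inj_on z C}
     \<and> finite {z \<in> PiE C (\<lambda>e. apexes H e - \<Union>C). inj_on z C}" if C: "C \<in> \<S>" for C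
  proof -
    obtain xs where xs: "C = cycle_edges xs" "length xs = k" "distinct xs"
      using C \<S>(2) unfolding graph_cycles_def by blast
    then have cC: "finite C" "card C = k" "\<Union>C = set xs" "card (\<Union>C) = k"
      using k finite_Union_graph_cycle[of C k] C \<S>(2)
      by (auto simp: card_cycle_edges Union_cycle_edges distinct_card)
    have "d ^ card C \<le> card {z \<in> PiE C (\<lambda>e. apexes H e - \<Union>C). inj_on z C}"
    proof (rule card_injective_choices[where N = k])
      fix e assume e: "e \<in> C"
      have "card (apexes H e) - card (\<Union>C) \<le> card (apexes H e - \<Union>C)"
        using cC by (intro diff_card_le_card_Diff) auto
      then show "finite (apexes H e - \<Union>C) \<and> d + k \<le> card (apexes H e - \<Union>C)"
        using ap[OF C e] cC finap by auto
    qed (use cC in auto)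
    moreover have "finite (PiE C (\<lambda>e. apexes H e - \<Union>C))" using cC finap by (intro finite_PiE) auto
    ultimately show ?thesis using cC by auto
  qed
  have "card \<S> * d ^ k = (\<Sum>C\<in>\<S>. d ^ k)" by simp
  also have "\<dots> \<le> (\<Sum>C\<in>\<S>. card {z \<in> PiE C (\<lambda>e. apexes H e - \<Union>C). inj_on z C})"
    using 1 by (intro sum_mono) auto
  also have "\<dots> = card (expansions H \<S>)"
    unfolding expansions_def using 1 \<S> by (intro card_SigmaI[symmetric]) auto
  finally show ?thesis .
qed

section \<open>Linear cycles in families with large codegrees\<close>

definition pairs :: "'v set \<Rightarrow> 'v set set" where
  "pairs f = {e. e \<subseteq> f \<and> card e = 2}"

definition shadow :: "'v set set \<Rightarrow> 'v set set" where
  "shadow H = \<Union>(pairs ` H)"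

lemma finite_pairs: "finite f \<Longrightarrow> finite (pairs f)"
  unfolding pairs_def by (rule finite_subset[of _ "Pow f"]) auto

lemma card_pairs: "card f = 3 \<Longrightarrow> card (pairs f) = 3"
  using n_subsets[of f 2] card_ge_0_finite[of f] unfolding pairs_def by (simp add: numeral_eq_Suc)

lemma shadow_mono: "Y \<subseteq> H \<Longrightarrow> shadow Y \<subseteq> shadow H"
  by (auto simp: shadow_def)

lemma card_apexes:
  assumes three: "\<And>f. f \<in> H \<Longrightarrow> card f = 3" and e: "card e = 2"
  shows "card (apexes H e) = card {f \<in> H. e \<in> pairs f}"
proof -
  have fe: "finite e" using e by (intro card_ge_0_finite) simp
  have "bij_betw (\<lambda>z. insert z e) (apexes H e) {f \<in> H. e \<in> pairs f}"
  proof (rule bij_betwI')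
    show "insert x e = insert y e \<longleftrightarrow> x = y" if "x \<in> apexes H e" "y \<in> apexes H e" for x y
      using that by (auto simp: apexes_def)
    show "insert x e \<in> {f \<in> H. e \<in> pairs f}" if "x \<in> apexes H e" for x
      using that e by (auto simp: apexes_def pairs_def)
    fix f assume f: "f \<in> {f \<in> H. e \<in> pairs f}"
    then have "card (f - e) = 1" using three e fe by (subst card_Diff_subset) (auto simp: pairs_def)
    then obtain z where z: "f - e = {z}" by (auto simp: card_1_singleton_iff)
    then have "f = insert z e" "z \<notin> e" using f by (auto simp: pairs_def)
    then show "\<exists>z\<in>apexes H e. f = insert z e" using f by (auto simp: apexes_def)
  qed
  then show ?thesis by (rule bij_betw_same_card)
qed

text \<open>A path in the link of \<open>u\<close> together with \<open>u\<close> gives a cycle all of whose edges lie in the shadow.\<close>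

lemma link_path:
  assumes three: "\<And>f. f \<in> Z \<Longrightarrow> card f = 3" and ne: "Z \<noteq> {}"
    and deg: "\<And>e. e \<in> shadow Z \<Longrightarrow> k \<le> card (apexes Z e)" and j: "2 \<le> j" "j \<le> k"
  shows "\<exists>u vs. length vs = j \<and> distinct (u # vs) \<and> (\<forall>i. Suc i < j \<longrightarrow> {u, vs ! i, vs ! Suc i} \<in> Z)"
  using j
proof (induction j rule: dec_induct)
  case base
  obtain f where f: "f \<in> Z" using ne by auto
  then obtain u v w where "f = {u, v, w}" "distinct [u, v, w]"
    using three[OF f] by (auto simp: card_3_iff)
  then show ?case using f by (intro exI[of _ u] exI[of _ "[v, w]"]) auto
next
  case (step j)
  then obtain u vs where vs: "length vs = j" "distinct (u # vs)"
    "\<And>i. Suc i < j \<Longrightarrow> {u, vs ! i, vs ! Suc i} \<in> Z" by auto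
  define v where "v = vs ! (j - 1)"
  have v: "v \<in> set vs" "u \<noteq> v" using vs step by (auto simp: v_def)
  have "{u, vs ! (j - 2), vs ! Suc (j - 2)} \<in> Z" using vs(3)[of "j - 2"] step by simp
  moreover have "Suc (j - 2) = j - 1" using step by simp
  ultimately have "{u, v} \<in> shadow Z" using v by (auto simp: shadow_def pairs_def v_def)
  then have "k \<le> card (apexes Z {u, v})" by (rule deg)
  moreover have "card (set vs) < k" using step vs by (simp add: distinct_card)
  ultimately have "\<not> apexes Z {u, v} \<subseteq> set vs" by (meson List.finite_set card_mono leD le_less_trans not_le order_trans)
  then obtain z where z: "z \<notin> set vs" "z \<in> apexes Z {u, v}" by auto
  have "{u, (vs @ [z]) ! i, (vs @ [z]) ! Suc i} \<in> Z" if i: "Suc i < Suc j" for i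
  proof (cases "Suc i < j")
    case True
    then show ?thesis using vs by (simp add: nth_append)
  next
    case False
    then have "i = j - 1" "Suc i = j" using i by auto
    then show ?thesis using vs z step by (simp add: nth_append v_def apexes_def insert_commute)
  qed
  then show ?case using vs z by (intro exI[of _ u] exI[of _ "vs @ [z]"]) (auto simp: apexes_def)
qed

text \<open>Some subfamily has codegree at least \<open>8 * l\<close> on every pair of its shadow. A
  path in a link, closed through \<open>u\<close>, gives a graph cycle in the shadow, and
  \<open>8 * l\<close> exceeds the \<open>4 * l\<close> vertices that the greedy expansion has to
  avoid.\<close>

lemma linear_cycle_exists:
  assumes fin: "finite Y" and three: "\<And>f. f \<in> Y \<Longrightarrow> card f = 3" and l: "l \<ge> 2"
    and dens: "8 * l * card (shadow Y) < card Y"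
  shows "\<exists>T\<in>linear_cycles (2 * l). T \<subseteq> Y"
proof -
  have ff: "finite f" if "f \<in> Y" for f using three[OF that] by (intro card_ge_0_finite) simp
  have "real (8 * l) * card (\<Union>(pairs ` Y)) \<le> card Y"
    using dens unfolding shadow_def by (metis less_imp_le of_nat_le_iff of_nat_mult)
  moreover have "Y \<noteq> {}" using dens by auto
  ultimately obtain Z where Z: "Z \<subseteq> Y" "Z \<noteq> {}"
    "\<And>e. e \<in> \<Union>(pairs ` Z) \<Longrightarrow> real (8 * l) \<le> card {f \<in> Z. e \<in> pairs f}"
    using min_degree_subfamily[of Y pairs "real (8 * l)", OF fin finite_pairs[OF ff]] by metis
  have finZ: "finite Z" by (rule finite_subset[OF Z(1) fin])
  have Z3: "card f = 3" if "f \<in> Z" for f using three Z that by auto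
  have deg: "8 * l \<le> card (apexes Z e)" if "e \<in> shadow Z" for e
  proof -
    have "card e = 2" using that by (auto simp: shadow_def pairs_def)
    then have "card (apexes Z e) = card {f \<in> Z. e \<in> pairs f}" using Z3 by (intro card_apexes) auto
    then show ?thesis using Z(3)[of e] that unfolding shadow_def by simp
  qed
  obtain u vs where vs: "length vs = 2 * l - 1" "distinct (u # vs)"
    "\<And>i. Suc i < 2 * l - 1 \<Longrightarrow> {u, vs ! i, vs ! Suc i} \<in> Z"
  proof -
    have "2 \<le> 2 * l - 1" "2 * l - 1 \<le> 8 * l" using l by linarith+
    from link_path[OF Z3 Z(2) deg this] show ?thesis using that by blast
  qed
  define xs where "xs = u # vs"
  have xs: "length xs = 2 * l" "distinct xs" using vs l by (auto simp: xs_def)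
  have vd: "vs ! i \<noteq> vs ! Suc i" "u \<noteq> vs ! i" "u \<noteq> vs ! Suc i" if "Suc i < 2 * l - 1" for i
    using vs(1,2) that by (auto simp: nth_eq_iff_index_eq)
  have sh: "{u, vs ! i} \<in> shadow Z" "{vs ! i, vs ! Suc i} \<in> shadow Z" "{u, vs ! Suc i} \<in> shadow Z"
    if "Suc i < 2 * l - 1" for i
    using vs(3)[OF that] vd[OF that] unfolding shadow_def pairs_def
    by (auto intro!: bexI[of _ "{u, vs ! i, vs ! Suc i}"])
  have edges: "e \<in> shadow Z" if eC: "e \<in> cycle_edges xs" for e
  proof -
    obtain i where i: "i < 2 * l" "e = {xs ! i, xs ! (Suc i mod (2 * l))}"
      using eC unfolding cycle_edges_def xs(1) by blast
    consider "i = 0" | "i = 2 * l - 1" | i' where "i = Suc i'" "Suc i' < 2 * l - 1"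
      using i(1) by (cases i) (auto, linarith)
    then show ?thesis
    proof cases
      case 1
      then show ?thesis using i l sh(1)[of 0] by (simp add: xs_def)
    next
      case 2
      have e: "2 * l - 1 = Suc (Suc (2 * l - 3))" using l by simp
      have "Suc i mod (2 * l) = 0" using 2 l by simp
      moreover have "xs ! i = vs ! Suc (2 * l - 3)" unfolding 2 e by (simp add: xs_def)
      ultimately have "e = {u, vs ! Suc (2 * l - 3)}" using i by (auto simp: xs_def)
      then show ?thesis using sh(3)[of "2 * l - 3"] e by simp
    next
      case 3
      then show ?thesis using i sh(2)[of i'] by (simp add: xs_def)
    qed
  qed
  define C where "C = cycle_edges xs"
  have finUZ: "finite (\<Union>Z)" by (rule finite_Union[OF finZ]) (use ff Z(1) in blast)
  have "C \<in> graph_cycles (2 * l)" using xs unfolding C_def graph_cycles_def by blast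
  moreover have "1 + 2 * (2 * l) \<le> card (apexes Z e)" if "e \<in> C" for e
    using deg[OF edges] that l unfolding C_def by fastforce
  ultimately have "card {C} * 1 ^ (2 * l) \<le> card (expansions Z {C})"
    using l by (intro expansions_lower finZ finUZ) auto
  then have "expansions Z {C} \<noteq> {}" by auto
  then obtain p where "p \<in> expansions Z {C}" by blast
  then have "expand p \<in> linear_cycles (2 * l) \<and> expand p \<subseteq> Z"
    using xs l by (intro expand_linear_cycle[where \<S> = "{C}"]) (auto simp: C_def graph_cycles_def)
  then show ?thesis using Z by blast
qed

lemma card_linear_cycle:
  assumes "T \<in> linear_cycles k" "3 \<le> k"
  shows "card T = k"
proof -
  have "T \<noteq> {}" using assms by (auto simp: linear_cycles_def linear_edges_def lessThan_empty_iff)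
  then show ?thesis using linear_cycles_span(1)[OF assms order_refl] by blast
qed

text \<open>While the family is dense over its shadow, deleting a triple of some linear cycle lowers
  the count by at least one. The bound is linear in \<open>card Y\<close>, as
  \<open>saturation\<close> needs.\<close>

lemma linear_cycle_count:
  assumes fin: "finite Y" and three: "\<And>f. f \<in> Y \<Longrightarrow> card f = 3" and l: "l \<ge> 2"
  shows "real (card Y) - 8 * real l * card (shadow Y) \<le> card {T \<in> linear_cycles (2 * l). T \<subseteq> Y}"
  using fin three
proof (induction "card Y" arbitrary: Y)
  case 0
  have "0 \<le> 8 * real l * card (shadow Y)" by simp
  then show ?case using 0(1) by linarith
next
  case (Suc c)
  have "finite f" if "f \<in> Y" for f using Suc.prems(2)[OF that] by (intro card_ge_0_finite) simp
  then have finS: "finite (shadow Y)" unfolding shadow_def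
    using Suc.prems(1) by (auto intro!: finite_pairs)
  show ?case
  proof (cases "8 * l * card (shadow Y) < card Y")
    case True
    then obtain T where T: "T \<in> linear_cycles (2 * l)" "T \<subseteq> Y"
      using linear_cycle_exists[of Y l] Suc.prems l by auto
    have "card T = 2 * l" using card_linear_cycle[OF T(1)] l by simp
    then obtain f where f: "f \<in> T" using l by (cases "T = {}") auto
    let ?Y = "Y - {f}"
    have "f \<in> Y" using f T by blast
    then have "c = card ?Y" using Suc.hyps(2) by simp
    then have "real (card ?Y) - 8 * real l * card (shadow ?Y) \<le> card {T \<in> linear_cycles (2 * l). T \<subseteq> ?Y}"
      using Suc.hyps(1)[of ?Y] Suc.prems by auto
    moreover have "card (shadow ?Y) \<le> card (shadow Y)"
      by (intro card_mono finS shadow_mono) auto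
    then have "8 * real l * card (shadow ?Y) \<le> 8 * real l * card (shadow Y)" by (intro mult_left_mono) auto
    moreover have "real (card ?Y) = card Y - 1" using \<open>c = card ?Y\<close> Suc.hyps(2) by simp
    moreover have "{T \<in> linear_cycles (2 * l). T \<subseteq> ?Y} \<subset> {T \<in> linear_cycles (2 * l). T \<subseteq> Y}"
      using T f by blast
    then have "card {T \<in> linear_cycles (2 * l). T \<subseteq> ?Y} < card {T \<in> linear_cycles (2 * l). T \<subseteq> Y}"
      using Suc.prems(1) by (intro psubset_card_mono) auto
    ultimately show ?thesis using Suc.hyps(2) by simp
  next
    case False
    then have "real (card Y) \<le> real (8 * l * card (shadow Y))" by (simp only: of_nat_le_iff not_less)
    then show ?thesis by simp
  qed
qed

text \<open>The analogue for triples, again with random vertex sets. Here the loss \<open>u\<close>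
  depends on the sample, namely on the number of shadow pairs inside it; \<open>dens\<close> keeps
  its average small. Each further triple of \<open>S\<close> gains two factors
  \<open>w / card V\<close>.\<close>

lemma hypergraph_balanced_supersaturation:
  fixes V :: "'v set" and H :: "'v set set" and w :: nat
  assumes V: "finite V" and H: "\<And>f. f \<in> H \<Longrightarrow> f \<subseteq> V \<and> card f = 3" and ne: "H \<noteq> {}"
    and l: "l \<ge> 2" and w: "6 \<le> w" "w \<le> card V"
    and dens: "256 * real l * card (shadow H) \<le> w / card V * card H"
  obtains \<S> where "\<S> \<subseteq> {T \<in> linear_cycles (2 * l). T \<subseteq> H}"
    "card H / (32 * (w / card V) ^ (4 * l - 3)) \<le> card \<S>"
    "\<And>S. S \<noteq> {} \<Longrightarrow> card S < 2 * l \<Longrightarrow> real (card {A \<in> \<S>. S \<subseteq> A})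
       \<le> 2 + 64 * 4 ^ l * (w / card V) ^ (2 * (card S - 1)) * card \<S> / card H"
proof -
  define n N where "n = real (card V)" and "N = real (card H)"
  define q where "q = w / n"
  \<comment> \<open>In units of \<open>q ^ 3 * N\<close>, samples have at least \<open>1 / 8\<close>
    triples on average, while the shadow, the bad sets and the surviving members cost
    \<open>1 / 32\<close> each.\<close>
  define M where "M = N / (32 * q ^ (4 * l - 3))"
  define B where "B = 64 * (4::real) ^ l"
  define \<pi> where "\<pi> = (\<lambda>j. if j < 2 * l then q ^ (2 * j + 1) else q ^ (4 * l))"
  define \<Delta> where "\<Delta> = (\<lambda>j. 2 + B * q ^ (2 * (j - 1)) * M / N)"
  define u where "u = (\<lambda>W. 8 * real l * card {e \<in> shadow H. e \<subseteq> W})"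
  define \<sigma> where "\<sigma> = real (card (samples V w))"
  have finH: "finite H" using V H by (intro finite_subset[of H "Pow V"]) auto
  have finf: "finite f" if "f \<in> H" for f using H[OF that] V finite_subset by auto
  have finS: "finite (shadow H)" unfolding shadow_def using finH finf by (auto intro!: finite_pairs)
  have n: "n > 0" and N: "N > 0" using w ne finH V by (auto simp: n_def N_def card_gt_0_iff)
  have q: "0 < q" "q \<le> 1" using w n by (auto simp: q_def n_def)
  have Mpos: "M > 0" using N q by (simp add: M_def)
  have B: "B > 0" by (simp add: B_def)
  have sw: "finite (samples V w)" by (rule finite_samples[OF V])
  have "card V choose w > 0" using w by simp
  then have \<sigma>: "\<sigma> > 0" using V by (simp add: \<sigma>_def card_samples)
  have swap: "(\<Sum>W\<in>samples V w. real (card {e \<in> F. e \<subseteq> W})) = (\<Sum>e\<in>F. real (card {W \<in> samples V w. e \<subseteq> W}))"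
    if "finite F" for F :: "'v set set"
  proof -
    have "(\<Sum>W\<in>samples V w. real (card {e \<in> F. e \<subseteq> W})) = (\<Sum>W\<in>samples V w. \<Sum>e\<in>F. if e \<subseteq> W then 1 else 0)"
      using that by (simp add: sum.inter_filter[symmetric])
    also have "\<dots> = (\<Sum>e\<in>F. \<Sum>W\<in>samples V w. if e \<subseteq> W then 1 else 0)" by (rule sum.swap)
    also have "\<dots> = (\<Sum>e\<in>F. real (card {W \<in> samples V w. e \<subseteq> W}))"
      using sw by (simp add: sum.inter_filter[symmetric])
    finally show ?thesis .
  qed
  obtain \<S> where \<S>: "\<S> \<subseteq> {T \<in> linear_cycles (2 * l). T \<subseteq> H}" "M \<le> card \<S>"
    "\<And>S. S \<noteq> {} \<Longrightarrow> card S < 2 * l \<Longrightarrow> real (card {A \<in> \<S>. S \<subseteq> A}) \<le> max (\<Delta> (card S)) 0"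
  proof (rule saturation[of H "{T \<in> linear_cycles (2 * l). T \<subseteq> H}" "2 * l" "samples V w" "\<lambda>W. {f \<in> H. f \<subseteq> W}"
        1 u \<pi> \<Delta> "q ^ 3 * N / (B * M)" M])
    show "finite H" by fact
    show "T \<subseteq> H \<and> card T = 2 * l" if "T \<in> {T \<in> linear_cycles (2 * l). T \<subseteq> H}" for T
      using that l card_linear_cycle[of T "2 * l"] by simp
    show "finite (samples V w)" by fact
    show "1 * (card Y - u W) \<le> card {A \<in> {T \<in> linear_cycles (2 * l). T \<subseteq> H}. A \<subseteq> Y}"
      if W: "W \<in> samples V w" and Y: "Y \<subseteq> {f \<in> H. f \<subseteq> W}" for W Y
    proof -
      have YH: "Y \<subseteq> H" using Y by auto
      have finY: "finite Y" by (rule finite_subset[OF YH finH])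
      have "shadow Y \<subseteq> {e \<in> shadow H. e \<subseteq> W}" unfolding shadow_def pairs_def using Y by blast
      then have "card (shadow Y) \<le> card {e \<in> shadow H. e \<subseteq> W}" using finS by (intro card_mono) auto
      then have "8 * real l * card (shadow Y) \<le> u W" unfolding u_def by (intro mult_left_mono) auto
      moreover have "real (card Y) - 8 * real l * card (shadow Y) \<le> card {T \<in> linear_cycles (2 * l). T \<subseteq> Y}"
        using YH H by (intro linear_cycle_count finY l) auto
      moreover have "{T \<in> linear_cycles (2 * l). T \<subseteq> Y} = {A \<in> {T \<in> linear_cycles (2 * l). T \<subseteq> H}. A \<subseteq> Y}"
        using YH by auto
      ultimately show ?thesis by simp
    qed
    show "card {W \<in> samples V w. S \<subseteq> {f \<in> H. f \<subseteq> W}} \<le> \<pi> (card S) * card (samples V w)"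
      if T: "T \<in> {T \<in> linear_cycles (2 * l). T \<subseteq> H}" and S: "S \<subseteq> T" "S \<noteq> {}" for T S
    proof -
      have l3: "3 \<le> 2 * l" using l by simp
      have TL: "T \<in> linear_cycles (2 * l)" using T by simp
      note span = linear_cycles_span[OF TL l3 S]
      have "{W \<in> samples V w. S \<subseteq> {f \<in> H. f \<subseteq> W}} = {W \<in> samples V w. \<Union>S \<subseteq> W}"
        using S T by auto
      moreover have "\<Union>S \<subseteq> V" using S T H by blast
      ultimately have "real (card {W \<in> samples V w. S \<subseteq> {f \<in> H. f \<subseteq> W}}) \<le> q ^ card (\<Union>S) * card (samples V w)"
        using samples_upper[OF V, of "\<Union>S" w] w unfolding q_def n_def by simp
      also have "\<dots> \<le> \<pi> (card S) * card (samples V w)"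
      proof (rule mult_right_mono)
        show "q ^ card (\<Union>S) \<le> \<pi> (card S)"
        proof (cases "S = T")
          case True
          then show ?thesis using span(1,3) by (simp add: \<pi>_def)
        next
          case False
          have "finite T" using span(1) l by (intro card_ge_0_finite) simp
          then have "card S < 2 * l" using False S span(1) by (metis psubsetI psubset_card_mono)
          then show ?thesis using power_decreasing[OF span(2)[OF False], of q] q by (simp add: \<pi>_def)
        qed
      qed simp
      finally show ?thesis .
    qed
    show "(0::real) < 1" "1 \<le> 2 * l" using l by simp_all
    show "2 \<le> \<Delta> j" for j using B q Mpos N by (simp add: \<Delta>_def)
    show "\<pi> j / \<Delta> j \<le> q ^ 3 * N / (B * M)" if "1 \<le> j" "j < 2 * l" for j
    proof -
      have "\<pi> j / \<Delta> j \<le> \<pi> j / (B * q ^ (2 * (j - 1)) * M / N)"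
        using B q Mpos N by (intro divide_left_mono) (auto simp: \<Delta>_def \<pi>_def add_pos_pos)
      also have "\<dots> = q ^ 3 * N / (B * M)"
      proof -
        have "2 * j + 1 = 2 * (j - 1) + 3" using that by simp
        then have "q ^ (2 * j + 1) = q ^ (2 * (j - 1)) * q ^ 3" by (metis power_add)
        then have "\<pi> j = q ^ (2 * (j - 1)) * q ^ 3" using that(2) by (simp add: \<pi>_def)
        then show ?thesis using q B Mpos N by (simp add: power3_eq_cube)
      qed
      finally show ?thesis .
    qed
    show "0 \<le> q ^ 3 * N / (B * M)" using q B Mpos N by simp
    show "0 \<le> \<pi> (2 * l)" using q by (simp add: \<pi>_def)
    show "0 \<le> M" using Mpos by simp
    have 1: "M * (2 ^ (2 * l + 1) * (q ^ 3 * N / (B * M))) = q ^ 3 * N / 32"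
      using Mpos unfolding B_def by (simp add: power_mult)
    have 2: "M * (\<pi> (2 * l) / 1) = q ^ 3 * N / 32"
    proof -
      have "4 * l = (4 * l - 3) + 3" using l by simp
      then have "q ^ (4 * l) = q ^ (4 * l - 3) * q ^ 3" by (metis power_add)
      then show ?thesis using q by (simp add: M_def \<pi>_def)
    qed
    have "(\<Sum>f\<in>H. (q / 2) ^ 3 * \<sigma>) \<le> (\<Sum>f\<in>H. real (card {W \<in> samples V w. f \<subseteq> W}))"
    proof (rule sum_mono)
      fix f assume f: "f \<in> H"
      have "w / (2 * card V) = q / 2" by (simp add: q_def n_def)
      then show "(q / 2) ^ 3 * \<sigma> \<le> real (card {W \<in> samples V w. f \<subseteq> W})"
        using samples_lower[OF V, of f w] H[OF f] w unfolding \<sigma>_def by (simp only:)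
    qed
    then have a: "q ^ 3 * N / 8 * \<sigma> \<le> (\<Sum>W\<in>samples V w. real (card {f \<in> H. f \<subseteq> W}))"
      unfolding swap[OF finH] by (simp add: N_def power_divide mult_ac)
    have "(\<Sum>e\<in>shadow H. real (card {W \<in> samples V w. e \<subseteq> W})) \<le> (\<Sum>e\<in>shadow H. q\<^sup>2 * \<sigma>)"
    proof (rule sum_mono)
      fix e assume e: "e \<in> shadow H"
      then have "e \<subseteq> V" "card e = 2" using H by (auto simp: shadow_def pairs_def)
      then show "real (card {W \<in> samples V w. e \<subseteq> W}) \<le> q\<^sup>2 * \<sigma>"
        using samples_upper[OF V, of e w] w n unfolding \<sigma>_def q_def n_def by simp
    qed
    then have "(\<Sum>W\<in>samples V w. u W) \<le> 8 * real l * (card (shadow H) * (q\<^sup>2 * \<sigma>))"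
      unfolding u_def sum_distrib_left[symmetric] swap[OF finS] by (intro mult_left_mono) (auto simp: mult_ac)
    also have "\<dots> = (256 * real l * card (shadow H)) * (q\<^sup>2 * \<sigma> / 32)" by simp
    also have "\<dots> \<le> (q * N) * (q\<^sup>2 * \<sigma> / 32)"
      using dens q \<sigma> by (intro mult_right_mono) (auto simp: q_def n_def N_def)
    also have "\<dots> = q ^ 3 * N / 32 * \<sigma>" by (simp add: power2_eq_square power3_eq_cube)
    finally have b: "(\<Sum>W\<in>samples V w. u W) \<le> q ^ 3 * N / 32 * \<sigma>" .
    have "\<sigma> * (q ^ 3 * N / 32 + q ^ 3 * N / 32) < q ^ 3 * N / 8 * \<sigma> - q ^ 3 * N / 32 * \<sigma>"
      using \<sigma> q N by simp
    also have "\<dots> \<le> (\<Sum>W\<in>samples V w. card {f \<in> H. f \<subseteq> W} - u W)"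
      unfolding sum_subtractf using a b by (rule diff_mono)
    finally show "card (samples V w) * (M * (2 ^ (2 * l + 1) * (q ^ 3 * N / (B * M)) + \<pi> (2 * l) / 1))
       < (\<Sum>W\<in>samples V w. card {f \<in> H. f \<subseteq> W} - u W)"
      unfolding distrib_left[of M] 1 2 by (simp only: \<sigma>_def)
  qed auto
  show ?thesis
  proof (rule that[OF \<S>(1)])
    show "card H / (32 * (w / card V) ^ (4 * l - 3)) \<le> card \<S>"
      using \<S>(2) by (simp add: M_def N_def q_def n_def)
    fix S :: "'v set set" assume S: "S \<noteq> {}" "card S < 2 * l"
    have "real (card {A \<in> \<S>. S \<subseteq> A}) \<le> \<Delta> (card S)"
      using \<S>(3)[OF S] B q Mpos N by (simp add: \<Delta>_def max_def split: if_splits)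
    also have "\<dots> \<le> 2 + B * q ^ (2 * (card S - 1)) * card \<S> / N"
      unfolding \<Delta>_def using B q N \<S>(2) by (intro add_left_mono divide_right_mono mult_left_mono) auto
    finally show "real (card {A \<in> \<S>. S \<subseteq> A})
       \<le> 2 + 64 * 4 ^ l * (w / card V) ^ (2 * (card S - 1)) * card \<S> / card H"
      by (simp add: B_def q_def n_def N_def)
  qed
qed

section \<open>Containers for hypergraphs without a linear cycle\<close>

definition cycle_free :: "nat \<Rightarrow> 'v set set \<Rightarrow> bool" where
  "cycle_free k I \<longleftrightarrow> (\<forall>T\<in>linear_cycles k. \<not> T \<subseteq> I)"

text \<open>The fraction removed by \<open>containers\<close> when its constant is
  \<open>3 * B\<close>.\<close>

definition shrink :: "nat \<Rightarrow> real \<Rightarrow> real" where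
  "shrink s B = 1 / (12 * B * (1 + 2 ^ s) ^ s)"

text \<open>The condition \<open>many\<close> makes the second summand of the degree bound at least
  1 for all sizes up to \<open>s\<close>, since \<tau> is at most 1. So it absorbs the additive 2
  and also covers sets of size \<open>s\<close>, which lie in at most one member.\<close>

lemma containers_of_supersaturation:
  fixes X :: "'a set" and \<S> :: "'a set set" and B \<tau> :: real
  assumes fin: "finite X" and \<tau>: "0 < \<tau>" "\<tau> \<le> 1" and B: "B \<ge> 1" and s: "s \<ge> 1"
    and \<S>: "\<And>A. A \<in> \<S> \<Longrightarrow> A \<subseteq> X \<and> card A = s"
    and deg: "\<And>S. S \<noteq> {} \<Longrightarrow> S \<subseteq> X \<Longrightarrow> card S < s \<Longrightarrow>
      real (card {A \<in> \<S>. S \<subseteq> A}) \<le> 2 + B * \<tau> ^ (card S - 1) * card \<S> / card X"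
    and many: "1 \<le> B * \<tau> ^ (s - 1) * card \<S> / card X"
  obtains \<C> where "finite \<C>" "card \<C> \<le> (card X + 1) ^ (s * nat \<lceil>4 * \<tau> * card X\<rceil>)"
    "\<And>I. I \<subseteq> X \<Longrightarrow> (\<And>A. A \<in> \<S> \<Longrightarrow> \<not> A \<subseteq> I) \<Longrightarrow>
      \<exists>C\<in>\<C>. I \<subseteq> C \<and> C \<subseteq> X \<and> real (card C) \<le> (1 - shrink s B) * card X"
proof -
  have ne: "\<S> \<noteq> {}" using many by auto
  have fA: "finite A" if "A \<in> \<S>" for A using \<S>[OF that] finite_subset[OF _ fin] by blast
  have one: "1 \<le> B * \<tau> ^ (j - 1) * card \<S> / card X" if "j \<le> s" for j
  proof -
    have "B * \<tau> ^ (s - 1) * card \<S> / card X \<le> B * \<tau> ^ (j - 1) * card \<S> / card X"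
      using \<tau> B that by (intro divide_right_mono mult_right_mono mult_left_mono power_decreasing) auto
    then show ?thesis using many by linarith
  qed
  have d: "real (card {A \<in> \<S>. S \<subseteq> A}) \<le> (3 * B) * \<tau> ^ (card S - 1) * card \<S> / card X"
    if S: "S \<noteq> {}" "S \<subseteq> X" for S
  proof -
    have e: "(3 * B) * \<tau> ^ (card S - 1) * card \<S> / card X = 3 * (B * \<tau> ^ (card S - 1) * card \<S> / card X)" by simp
    consider "card S < s" | "card S = s" | "card S > s" by linarith
    then show ?thesis
    proof cases
      case 1
      then show ?thesis unfolding e using deg[OF S 1] one[of "card S"] by linarith
    next
      case 2
      have "{A \<in> \<S>. S \<subseteq> A} \<subseteq> {S}"
      proof
        fix A assume A: "A \<in> {A \<in> \<S>. S \<subseteq> A}"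
        then have "finite A" "card A = card S" using \<S>[of A] fA 2 by auto
        then show "A \<in> {S}" using A card_subset_eq[of A S] by auto
      qed
      then have "card {A \<in> \<S>. S \<subseteq> A} \<le> card {S}" by (intro card_mono) auto
      then show ?thesis unfolding e using one[of "card S"] 2 by simp
    next
      case 3
      have "\<not> S \<subseteq> A" if "A \<in> \<S>" for A
        using \<S>[OF that] card_mono[OF fA[OF that], of S] 3 by auto
      then have "card {A \<in> \<S>. S \<subseteq> A} = 0" by (metis (no_types, lifting) card.empty Collect_empty_eq)
      then show ?thesis using B \<tau> by simp
    qed
  qed
  have "1 \<le> 3 * B" using B by simp
  from containers[OF fin ne \<tau>(1) this s \<S> d] obtain \<C> where \<C>:
    "finite \<C>" "card \<C> \<le> (card X + 1) ^ (s * nat \<lceil>4 * \<tau> * card X\<rceil>)"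
    "\<And>I. I \<subseteq> X \<Longrightarrow> (\<And>A. A \<in> \<S> \<Longrightarrow> \<not> A \<subseteq> I) \<Longrightarrow>
      \<exists>C\<in>\<C>. I \<subseteq> C \<and> C \<subseteq> X \<and> real (card C) \<le> (1 - 1 / (4 * (3 * B) * (1 + 2 ^ s) ^ s)) * card X"
    by blast
  have "1 / (4 * (3 * B) * (1 + 2 ^ s) ^ s) = shrink s B" by (simp add: shrink_def)
  then show ?thesis using that[OF \<C>(1,2)] \<C>(3) by simp
qed

text \<open>The rate \<tau> may be larger than the degrees demand; the last condition on it ensures
  \<open>many\<close>. It implies \<open>q\<^sup>2 \<le> \<tau>\<close> for
  \<open>q = w / card V\<close>, because \<open>4 * l - 3\<close> is less than
  \<open>2 * (2 * l - 1)\<close>, and this covers the other degrees.\<close>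

lemma heavy_containers:
  fixes V :: "'v set" and H :: "'v set set" and w :: nat and \<tau> :: real
  assumes V: "finite V" and H: "\<And>f. f \<in> H \<Longrightarrow> f \<subseteq> V \<and> card f = 3" and ne: "H \<noteq> {}"
    and l: "l \<ge> 2" and w: "6 \<le> w" "w \<le> card V"
    and dens: "256 * real l * card (shadow H) \<le> w / card V * card H"
    and \<tau>: "0 < \<tau>" "\<tau> \<le> 1" "(w / card V) ^ (4 * l - 3) \<le> \<tau> ^ (2 * l - 1)"
  obtains \<C> where "finite \<C>" "card \<C> \<le> (card H + 1) ^ (2 * l * nat \<lceil>4 * \<tau> * card H\<rceil>)"
    "\<And>I. I \<subseteq> H \<Longrightarrow> cycle_free (2 * l) I \<Longrightarrow>
      \<exists>C\<in>\<C>. I \<subseteq> C \<and> C \<subseteq> H \<and> real (card C) \<le> (1 - shrink (2 * l) (64 * 4 ^ l)) * card H"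
proof -
  define q where "q = w / card V"
  define B where "B = 64 * (4::real) ^ l"
  have finH: "finite H" using V H by (intro finite_subset[of H "Pow V"]) auto
  have N: "real (card H) > 0" using ne finH by (simp add: card_gt_0_iff)
  have q: "0 < q" "q \<le> 1" using w by (auto simp: q_def)
  have B: "32 \<le> B" unfolding B_def using one_le_power[of "4::real" l] by linarith
  obtain \<S> where \<S>: "\<S> \<subseteq> {T \<in> linear_cycles (2 * l). T \<subseteq> H}"
    "card H / (32 * q ^ (4 * l - 3)) \<le> card \<S>"
    "\<And>S. S \<noteq> {} \<Longrightarrow> card S < 2 * l \<Longrightarrow> real (card {A \<in> \<S>. S \<subseteq> A})
       \<le> 2 + B * q ^ (2 * (card S - 1)) * card \<S> / card H"
    using hypergraph_balanced_supersaturation[OF V H ne l w dens] unfolding q_def B_def by blast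
  have q2: "q\<^sup>2 \<le> \<tau>"
  proof (rule power_le_imp_le_base)
    have e: "Suc (2 * l - 2) = 2 * l - 1" using l by simp
    have "(q\<^sup>2) ^ Suc (2 * l - 2) = q ^ (2 * (2 * l - 1))" unfolding e by (rule power_mult[symmetric])
    also have "\<dots> \<le> q ^ (4 * l - 3)" using q by (intro power_decreasing) auto
    also have "\<dots> \<le> \<tau> ^ (2 * l - 1)" using \<tau>(3) by (simp add: q_def)
    also have "2 * l - 1 = Suc (2 * l - 2)" using l by simp
    finally show "(q\<^sup>2) ^ Suc (2 * l - 2) \<le> \<tau> ^ Suc (2 * l - 2)" .
  qed (use \<tau> in simp)
  have many: "1 \<le> B * \<tau> ^ (2 * l - 1) * card \<S> / card H"
  proof -
    have "card H \<le> 32 * q ^ (4 * l - 3) * card \<S>" using \<S>(2) q by (simp add: pos_divide_le_eq mult_ac)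
    also have "\<dots> \<le> B * \<tau> ^ (2 * l - 1) * card \<S>"
      using B \<tau> q by (intro mult_right_mono mult_mono) (auto simp: q_def)
    finally show ?thesis using N by simp
  qed
  have deg: "real (card {A \<in> \<S>. S \<subseteq> A}) \<le> 2 + B * \<tau> ^ (card S - 1) * card \<S> / card H"
    if S: "S \<noteq> {}" "S \<subseteq> H" "card S < 2 * l" for S
  proof -
    have "q ^ (2 * (card S - 1)) \<le> \<tau> ^ (card S - 1)"
      unfolding power_mult using q2 q by (intro power_mono) auto
    then have "2 + B * q ^ (2 * (card S - 1)) * card \<S> / card H \<le> 2 + B * \<tau> ^ (card S - 1) * card \<S> / card H"
      using B by (intro add_left_mono divide_right_mono mult_right_mono mult_left_mono) auto
    then show ?thesis using \<S>(3)[OF S(1,3)] by linarith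
  qed
  have sz: "A \<subseteq> H \<and> card A = 2 * l" if "A \<in> \<S>" for A
    using that \<S>(1) card_linear_cycle[of A "2 * l"] l by auto
  have "1 \<le> B" "1 \<le> 2 * l" using B l by auto
  from containers_of_supersaturation[OF finH \<tau>(1,2) this sz deg many]
  obtain \<C> where \<C>: "finite \<C>" "card \<C> \<le> (card H + 1) ^ (2 * l * nat \<lceil>4 * \<tau> * card H\<rceil>)"
    "\<And>I. I \<subseteq> H \<Longrightarrow> (\<And>A. A \<in> \<S> \<Longrightarrow> \<not> A \<subseteq> I) \<Longrightarrow>
      \<exists>C\<in>\<C>. I \<subseteq> C \<and> C \<subseteq> H \<and> real (card C) \<le> (1 - shrink (2 * l) B) * card H" by blast
  show ?thesis
  proof (rule that[OF \<C>(1,2)])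
    fix I assume I: "I \<subseteq> H" "cycle_free (2 * l) I"
    then have "\<not> A \<subseteq> I" if "A \<in> \<S>" for A using that \<S>(1) by (auto simp: cycle_free_def)
    then show "\<exists>C\<in>\<C>. I \<subseteq> C \<and> C \<subseteq> H \<and> real (card C) \<le> (1 - shrink (2 * l) (64 * 4 ^ l)) * card H"
      using \<C>(3)[OF I(1)] unfolding B_def by blast
  qed
qed

definition light_const :: "nat \<Rightarrow> real" where
  "light_const l = 32 * 4 ^ l + 16 ^ (2 * l) * (2 * (2 * real l) ^ (2 * l))"

text \<open>A balanced family of graph cycles in \<open>G\<close> is expanded by about
  \<open>D\<close> apexes per edge. Fixing one more triple costs a factor of order \<open>D\<close>
  in addition to \<open>w / card V\<close>. As \<open>H\<close> has at most
  \<open>2 * D * card G\<close> triples, \<open>D\<close> cancels in the fingerprint, which depends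
  only on \<open>w / card V * card G\<close>.\<close>

lemma light_containers:
  fixes V :: "'v set" and H G :: "'v set set" and w D :: nat
  assumes V: "finite V" and H: "\<And>f. f \<in> H \<Longrightarrow> f \<subseteq> V \<and> card f = 3"
    and G: "\<And>e. e \<in> G \<Longrightarrow> e \<subseteq> V \<and> card e = 2" and ne: "G \<noteq> {}" and l: "l \<ge> 2"
    and cover: "\<And>f. f \<in> H \<Longrightarrow> \<exists>e\<in>G. e \<subseteq> f"
    and D: "8 * l \<le> D" "\<And>e. e \<in> G \<Longrightarrow> D \<le> card (apexes H e) \<and> card (apexes H e) \<le> 2 * D"
    and w: "4 \<le> w" "w \<le> card V"
    and big: "(128 * (real l)\<^sup>2) ^ l * w \<le> (real (card G) * w / (real (card V))\<^sup>2) ^ l"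
    and many: "real (card V) ^ (2 * l) \<le> (w / card V * card G) ^ (2 * l - 1)"
  obtains \<C> where "finite \<C>" "card \<C> \<le> (card H + 1) ^ (2 * l * nat \<lceil>4 * (w / card V * card G)\<rceil>)"
    "\<And>I. I \<subseteq> H \<Longrightarrow> cycle_free (2 * l) I \<Longrightarrow>
      \<exists>C\<in>\<C>. I \<subseteq> C \<and> C \<subseteq> H \<and> real (card C) \<le> (1 - shrink (2 * l) (3 * 144 ^ (2 * l) * light_const l)) * card H"
proof -
  define n m where "n = real (card V)" and "m = real (card G)"
  define \<theta> where "\<theta> = w / n"
  define \<tau> where "\<tau> = \<theta> / (2 * D)"
  define B where "B = light_const l"
  \<comment> \<open>One factor \<open>12 ^ (2 * l)\<close> bounds the powers of 3 from guessing
    pairs, the other comes from comparing the number of linear cycles with the number of graph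
    cycles (\<open>ST\<close>). The 3 covers the additive 2 in the degrees of the graph
    family.\<close>
  define K where "K = 3 * 144 ^ (2 * l) * B"
  define A where "A = 2 * (2 * real l) ^ (2 * l)"
  have finG: "finite G" using V G by (intro finite_subset[of G "Pow V"]) auto
  have finH: "finite H" using V H by (intro finite_subset[of H "Pow V"]) auto
  have n: "n > 0" and m: "m > 0" using w ne finG V by (auto simp: n_def m_def card_gt_0_iff)
  have \<theta>: "0 < \<theta>" "\<theta> \<le> 1" using w n by (auto simp: \<theta>_def n_def)
  have D0: "D > 0" using D l by simp
  have A: "A > 0" using l by (simp add: A_def)
  have B: "32 * 4 ^ l \<le> B" "16 ^ (2 * l) * A \<le> B" "1 \<le> B"
  proof -
    have a: "0 \<le> 16 ^ (2 * l) * A" and b: "1 \<le> (4::real) ^ l" using A by (auto intro: one_le_power)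
    have B: "B = 32 * 4 ^ l + 16 ^ (2 * l) * A" by (simp add: B_def light_const_def A_def)
    show "32 * 4 ^ l \<le> B" "16 ^ (2 * l) * A \<le> B" "1 \<le> B" unfolding B using a b by linarith+
  qed
  obtain \<S> where \<S>: "\<S> \<subseteq> {C \<in> graph_cycles (2 * l). C \<subseteq> G}"
    "(m / (16 * n)) ^ (2 * l) / A \<le> card \<S>"
    "\<And>S. S \<noteq> {} \<Longrightarrow> card S < 2 * l \<Longrightarrow> real (card {A \<in> \<S>. S \<subseteq> A})
       \<le> 2 + 32 * 4 ^ l * \<theta> ^ (card S - 1) * card \<S> / m"
    using graph_balanced_supersaturation[OF V G ne l w big] unfolding \<theta>_def n_def m_def A_def of_nat_mult of_nat_numeral
    by blast
  have finS: "finite \<S>" using \<S>(1) finG by (auto intro: finite_subset[of _ "Pow G"])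
  have S_cyc: "\<S> \<subseteq> graph_cycles (2 * l)" using \<S>(1) by auto
  have cycsz: "card C = 2 * l \<and> finite C" if C: "C \<in> \<S>" for C
  proof -
    obtain xs where "C = cycle_edges xs" "length xs = 2 * l" "distinct xs"
      using C S_cyc unfolding graph_cycles_def by blast
    then have "card C = 2 * l" using l by (simp add: card_cycle_edges)
    then show ?thesis using l by (auto intro: card_ge_0_finite)
  qed
  \<comment> \<open>This is what the hypothesis \<open>many\<close> amounts to for the size of the
    balanced family.\<close>
  have one: "1 \<le> B * \<theta> ^ (2 * l - 1) * card \<S> / m"
  proof -
    have l2: "t ^ (2 * l) = t ^ (2 * l - 1) * t" for t :: real using l by (cases l) auto
    have "(16 * n) ^ (2 * l) * A = n ^ (2 * l) * (16 ^ (2 * l) * A)" by (simp add: power_mult_distrib)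
    also have "\<dots> \<le> (\<theta> * m) ^ (2 * l - 1) * B"
      using many B A by (intro mult_mono) (auto simp: \<theta>_def n_def m_def)
    finally have 1: "(16 * n) ^ (2 * l) * A \<le> (\<theta> * m) ^ (2 * l - 1) * B" .
    have "m ^ (2 * l) = (m / (16 * n)) ^ (2 * l) / A * ((16 * n) ^ (2 * l) * A)"
      using n A by (simp add: power_divide)
    also have "\<dots> \<le> card \<S> * ((\<theta> * m) ^ (2 * l - 1) * B)"
      using 1 \<S>(2) n A by (intro mult_mono[of "_ / A"]) auto
    finally have "m ^ (2 * l - 1) * m \<le> m ^ (2 * l - 1) * (B * \<theta> ^ (2 * l - 1) * card \<S>)"
      unfolding power_mult_distrib l2 by (simp only: mult_ac)
    then have "m \<le> B * \<theta> ^ (2 * l - 1) * card \<S>" using m by simp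
    then show ?thesis using m by simp
  qed
  have oneS: "1 \<le> B * \<theta> ^ (j - 1) * card \<S> / m" if "j \<le> 2 * l" for j
  proof -
    have "B * \<theta> ^ (2 * l - 1) * card \<S> / m \<le> B * \<theta> ^ (j - 1) * card \<S> / m"
      using \<theta> B that m by (intro divide_right_mono mult_right_mono mult_left_mono power_decreasing) auto
    then show ?thesis using one by linarith
  qed
  have degS: "real (card {C \<in> \<S>. S \<subseteq> C}) \<le> 3 * (B * \<theta> ^ (card S - 1) * card \<S> / m)"
    if S: "S \<noteq> {}" "card S \<le> 2 * l" for S
  proof (cases "card S < 2 * l")
    case True
    have "32 * 4 ^ l * \<theta> ^ (card S - 1) * card \<S> / m \<le> B * \<theta> ^ (card S - 1) * card \<S> / m"
      using \<theta> B m by (intro divide_right_mono mult_right_mono) auto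
    then show ?thesis using \<S>(3)[OF S(1) True] oneS[OF S(2)] by linarith
  next
    case False
    have "{C \<in> \<S>. S \<subseteq> C} \<subseteq> {S}"
    proof
      fix C assume C: "C \<in> {C \<in> \<S>. S \<subseteq> C}"
      then have "finite C" "card C = card S" using cycsz[of C] False S by auto
      then show "C \<in> {S}" using C card_subset_eq[of C S] by auto
    qed
    then have "card {C \<in> \<S>. S \<subseteq> C} \<le> card {S}" by (intro card_mono) auto
    then show ?thesis using oneS[OF S(2)] by simp
  qed
  define P where "P = expansions H \<S>"
  define \<T> where "\<T> = expand ` P"
  have l3: "3 \<le> 2 * l" using l by simp
  have three: "card f = 3" if "f \<in> H" for f using H that by auto
  have GS: "e \<in> G" if "C \<in> \<S>" "e \<in> C" for C e using that \<S>(1) by auto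
  have apS: "card (apexes H e) \<le> 2 * D" if "C \<in> \<S>" "e \<in> C" for C e using D(2)[OF GS[OF that]] by simp
  have degP: "finite {p \<in> P. S \<subseteq> expand p}"
    "real (card {p \<in> P. S \<subseteq> expand p}) \<le> 3 ^ card S * (3 * (B * \<theta> ^ (card S - 1) * card \<S> / m) * (2 * real D) ^ (2 * l - card S))"
    if S: "S \<noteq> {}" "finite S" "card S \<le> 2 * l" for S
  proof -
    define \<beta> where "\<beta> = nat \<lfloor>3 * (B * \<theta> ^ (card S - 1) * card \<S> / m)\<rfloor>"
    have \<beta>0: "0 \<le> 3 * (B * \<theta> ^ (card S - 1) * card \<S> / m)" using \<theta> B m by simp
    have b: "card {C \<in> \<S>. A \<subseteq> C} \<le> \<beta>" if "A \<noteq> {}" "card A = card S" for A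
      using degS[of A] that S unfolding \<beta>_def by (simp add: le_nat_floor)
    note E = expand_degree[where b = "2 * D", OF finH three l3 finS S_cyc apS S b]
    show "finite {p \<in> P. S \<subseteq> expand p}" unfolding P_def by (rule E(1))
    have "real (card {p \<in> P. S \<subseteq> expand p}) \<le> real (3 ^ card S * (\<beta> * (2 * D) ^ (2 * l - card S)))"
      unfolding P_def by (rule of_nat_mono[OF E(2)])
    also have "\<dots> = 3 ^ card S * (real \<beta> * (2 * real D) ^ (2 * l - card S))" by simp
    also have "\<dots> \<le> 3 ^ card S * (3 * (B * \<theta> ^ (card S - 1) * card \<S> / m) * (2 * real D) ^ (2 * l - card S))"
      using \<beta>0 by (intro mult_left_mono mult_right_mono) (auto simp: \<beta>_def)
    finally show "real (card {p \<in> P. S \<subseteq> expand p}) \<le> 3 ^ card S * (3 * (B * \<theta> ^ (card S - 1) * card \<S> / m) * (2 * real D) ^ (2 * l - card S))" .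
  qed
  have T: "T \<in> linear_cycles (2 * l) \<and> T \<subseteq> H" if "T \<in> \<T>" for T
    using that expand_linear_cycle[OF _ S_cyc l3] unfolding \<T>_def P_def by auto
  have finT: "finite \<T>" using T finH by (intro finite_subset[of \<T> "Pow H"]) auto
  have card2l: "card T = 2 * l" if "T \<in> \<T>" for T using card_linear_cycle[of T "2 * l"] T[OF that] l by simp
  \<comment> \<open>The degree bound for a full linear cycle: \<open>2 * l\<close> guessed pairs
    determine the graph cycle, so \<beta> is 1, and no free apex is left.\<close>
  have fib: "card {p \<in> P. expand p = T} \<le> 3 ^ (2 * l) \<and> finite {p \<in> P. expand p = T}" if TT: "T \<in> \<T>" for T
  proof -
    have fT: "finite T" using T[OF TT] finH finite_subset by auto
    have T0: "T \<noteq> {}" using card2l[OF TT] l by auto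
    have b: "card {C \<in> \<S>. A \<subseteq> C} \<le> 1" if A: "A \<noteq> {}" "card A = card T" for A
    proof -
      have "{C \<in> \<S>. A \<subseteq> C} \<subseteq> {A}"
      proof
        fix C assume C: "C \<in> {C \<in> \<S>. A \<subseteq> C}"
        then have "finite C" "card C = card A" using cycsz[of C] A card2l[OF TT] by auto
        then show "C \<in> {A}" using C card_subset_eq[of C A] by auto
      qed
      then have "card {C \<in> \<S>. A \<subseteq> C} \<le> card {A}" by (intro card_mono) auto
      then show ?thesis by simp
    qed
    note E = expand_degree[where b = "2 * D" and \<beta> = 1, OF finH three l3 finS S_cyc apS T0 fT _ b]
    have sub: "{p \<in> P. expand p = T} \<subseteq> {p \<in> P. T \<subseteq> expand p}" by auto
    have fin: "finite {p \<in> P. T \<subseteq> expand p}" unfolding P_def using E(1) card2l[OF TT] by simp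
    have "card {p \<in> P. expand p = T} \<le> card {p \<in> P. T \<subseteq> expand p}" by (rule card_mono[OF fin sub])
    also have "\<dots> \<le> 3 ^ (2 * l)" unfolding P_def using E(2) card2l[OF TT] by simp
    finally show ?thesis using finite_subset[OF sub fin] by simp
  qed
  have cP: "card P \<le> card \<T> * 3 ^ (2 * l)"
  proof -
    have "P = (\<Union>T\<in>\<T>. {p \<in> P. expand p = T})" by (auto simp: \<T>_def)
    then have "card P = card (\<Union>T\<in>\<T>. {p \<in> P. expand p = T})" by (rule arg_cong)
    also have "\<dots> \<le> (\<Sum>T\<in>\<T>. card {p \<in> P. expand p = T})" by (rule card_UN_le[OF finT])
    also have "\<dots> \<le> (\<Sum>T\<in>\<T>. 3 ^ (2 * l))" using fib by (intro sum_mono) auto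
    finally show ?thesis by simp
  qed
  have "finite f" if "f \<in> H" for f using three[OF that] by (intro card_ge_0_finite) simp
  then have finUH: "finite (\<Union>H)" using finH by auto
  have "card \<S> * (D - 4 * l) ^ (2 * l) \<le> card P"
    unfolding P_def
  proof (rule expansions_lower[OF finH finUH l3 finS S_cyc])
    fix C e assume "C \<in> \<S>" "e \<in> C"
    then show "D - 4 * l + 2 * (2 * l) \<le> card (apexes H e)" using D(1) D(2)[OF GS] by fastforce
  qed
  then have "card \<S> * (D - 4 * l) ^ (2 * l) \<le> card \<T> * 3 ^ (2 * l)" using cP by linarith
  then have "real (card \<S> * (D - 4 * l) ^ (2 * l)) \<le> real (card \<T> * 3 ^ (2 * l))" by (rule of_nat_mono)
  then have "real (card \<S>) * real (D - 4 * l) ^ (2 * l) \<le> real (card \<T>) * 3 ^ (2 * l)"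
    by (simp only: of_nat_mult of_nat_power of_nat_numeral)
  \<comment> \<open>The \<open>4 * l\<close> apexes avoided in the expansion are at most half of
    \<open>D\<close>, so the lower and upper numbers of choices differ by a factor 4 per
    edge.\<close>
  moreover have "real (card \<S>) * (2 * real D) ^ (2 * l) \<le> real (card \<S>) * (4 ^ (2 * l) * real (D - 4 * l) ^ (2 * l))"
  proof -
    have "2 * real D \<le> 4 * real (D - 4 * l)" using D(1) by linarith
    then have "(2 * real D) ^ (2 * l) \<le> (4 * real (D - 4 * l)) ^ (2 * l)" by (intro power_mono) auto
    then show ?thesis by (intro mult_left_mono) (auto simp: power_mult_distrib)
  qed
  ultimately have ST: "real (card \<S>) * (2 * real D) ^ (2 * l) \<le> 12 ^ (2 * l) * real (card \<T>)"
  proof -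
    assume a: "real (card \<S>) * real (D - 4 * l) ^ (2 * l) \<le> real (card \<T>) * 3 ^ (2 * l)"
      and b: "real (card \<S>) * (2 * real D) ^ (2 * l) \<le> real (card \<S>) * (4 ^ (2 * l) * real (D - 4 * l) ^ (2 * l))"
    note b
    also have "\<dots> = 4 ^ (2 * l) * (real (card \<S>) * real (D - 4 * l) ^ (2 * l))" by simp
    also have "\<dots> \<le> 4 ^ (2 * l) * (real (card \<T>) * 3 ^ (2 * l))" using a by (intro mult_left_mono) auto
    also have "\<dots> = 12 ^ (2 * l) * real (card \<T>)"
    proof -
      have "(12::real) ^ (2 * l) = 4 ^ (2 * l) * 3 ^ (2 * l)" using power_mult_distrib[of "4::real" 3 "2 * l"] by simp
      then show ?thesis by simp
    qed
    finally show ?thesis .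
  qed
  have cH: "real (card H) \<le> 2 * D * m"
  proof -
    have "H \<subseteq> (\<Union>e\<in>G. (\<lambda>z. insert z e) ` apexes H e)"
    proof
      fix f assume f: "f \<in> H"
      then obtain e where e: "e \<in> G" "e \<subseteq> f" using cover by blast
      then have "f \<noteq> e" using three[OF f] G by auto
      have fe: "finite e" using G[OF e(1)] by (intro card_ge_0_finite) simp
      have "card (f - e) = 1" using three[OF f] G[OF e(1)] fe e(2) by (subst card_Diff_subset) auto
      then obtain z where z: "f - e = {z}" by (auto simp: card_1_singleton_iff)
      then have "f = insert z e" "z \<notin> e" using e by auto
      then show "f \<in> (\<Union>e\<in>G. (\<lambda>z. insert z e) ` apexes H e)" using e f by (auto simp: apexes_def)
    qed
    moreover have fa: "finite (apexes H e)" for e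
      by (rule finite_subset[OF _ finUH]) (auto simp: apexes_def)
    ultimately have "card H \<le> card (\<Union>e\<in>G. (\<lambda>z. insert z e) ` apexes H e)"
      using finG by (intro card_mono) auto
    also have "\<dots> \<le> (\<Sum>e\<in>G. card ((\<lambda>z. insert z e) ` apexes H e))" by (rule card_UN_le[OF finG])
    also have "\<dots> \<le> (\<Sum>e\<in>G. 2 * D)"
    proof (rule sum_mono)
      fix e assume "e \<in> G"
      then show "card ((\<lambda>z. insert z e) ` apexes H e) \<le> 2 * D"
        using D(2)[of e] card_image_le[OF fa[of e], of "\<lambda>z. insert z e"] by linarith
    qed
    finally have "card H \<le> card G * (2 * D)" by simp
    then have "real (card H) \<le> real (card G * (2 * D))" by (rule of_nat_mono)
    then show ?thesis unfolding m_def by (simp add: mult_ac)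
  qed
  obtain e where e: "e \<in> G" using ne by auto
  have "apexes H e \<noteq> {}" using D(2)[OF e] D0 by auto
  then have "H \<noteq> {}" by (auto simp: apexes_def)
  then have cH0: "real (card H) > 0" using finH by (simp add: card_gt_0_iff)
  have \<tau>: "0 < \<tau>" "\<tau> \<le> 1" using \<theta> D0 by (auto simp: \<tau>_def divide_le_eq)
  have K: "1 \<le> K" "B \<le> K"
  proof -
    have "1 \<le> 3 * (144::real) ^ (2 * l)" using one_le_power[of "144::real" "2 * l"] by linarith
    then have "1 * B \<le> 3 * 144 ^ (2 * l) * B" using B by (intro mult_right_mono) auto
    then show "1 \<le> K" "B \<le> K" using B unfolding K_def by linarith+
  qed
  have scale: "\<theta> ^ (j - 1) * card \<S> / m * (2 * real D) ^ (2 * l - j) \<le> 12 ^ (2 * l) * (\<tau> ^ (j - 1) * card \<T> / card H)"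
    if j: "1 \<le> j" "j \<le> 2 * l" for j
  proof -
    have "2 * l = (j - 1) + 1 + (2 * l - j)" using j by simp
    then have "(2 * real D) ^ (2 * l) = (2 * real D) ^ (j - 1) * (2 * real D) * (2 * real D) ^ (2 * l - j)"
      by (metis power_add power_one_right)
    then have "\<theta> ^ (j - 1) * card \<S> / m * (2 * real D) ^ (2 * l - j)
       = \<tau> ^ (j - 1) * (real (card \<S>) * (2 * real D) ^ (2 * l)) / (2 * D * m)"
      using D0 m by (simp add: \<tau>_def power_divide)
    also have "\<dots> \<le> \<tau> ^ (j - 1) * (12 ^ (2 * l) * real (card \<T>)) / (2 * D * m)"
      using ST \<tau> D0 m by (intro divide_right_mono mult_left_mono) auto
    also have "\<dots> \<le> \<tau> ^ (j - 1) * (12 ^ (2 * l) * real (card \<T>)) / card H"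
      using cH cH0 \<tau> D0 m by (intro divide_left_mono) auto
    also have "\<dots> = 12 ^ (2 * l) * (\<tau> ^ (j - 1) * card \<T> / card H)" by simp
    finally show ?thesis .
  qed
  have pw: "(144::real) ^ (2 * l) = 12 ^ (2 * l) * 12 ^ (2 * l)"
    using power_mult_distrib[of "12::real" 12 "2 * l"] by simp
  have degT: "real (card {T \<in> \<T>. S \<subseteq> T}) \<le> 2 + K * \<tau> ^ (card S - 1) * card \<T> / card H"
    if S: "S \<noteq> {}" "S \<subseteq> H" "card S < 2 * l" for S
  proof -
    have fS: "finite S" using S finH finite_subset by auto
    then have j: "1 \<le> card S" using S by (simp add: Suc_le_eq card_gt_0_iff)
    have "{T \<in> \<T>. S \<subseteq> T} \<subseteq> expand ` {p \<in> P. S \<subseteq> expand p}" by (auto simp: \<T>_def)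
    then have "card {T \<in> \<T>. S \<subseteq> T} \<le> card (expand ` {p \<in> P. S \<subseteq> expand p})"
      using degP(1)[OF S(1) fS] S by (intro card_mono) auto
    also have "\<dots> \<le> card {p \<in> P. S \<subseteq> expand p}"
      using degP(1)[OF S(1) fS] S by (intro card_image_le) auto
    finally have "real (card {T \<in> \<T>. S \<subseteq> T}) \<le> card {p \<in> P. S \<subseteq> expand p}" by simp
    also have "\<dots> \<le> 3 ^ card S * (3 * (B * \<theta> ^ (card S - 1) * card \<S> / m) * (2 * real D) ^ (2 * l - card S))"
      using degP(2)[OF S(1) fS] S by simp
    also have "\<dots> = 3 ^ card S * (3 * B) * (\<theta> ^ (card S - 1) * card \<S> / m * (2 * real D) ^ (2 * l - card S))" by simp
    also have "\<dots> \<le> 12 ^ (2 * l) * (3 * B) * (12 ^ (2 * l) * (\<tau> ^ (card S - 1) * card \<T> / card H))"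
    proof (rule mult_mono)
      have "(3::real) ^ card S \<le> 3 ^ (2 * l)" using S by (intro power_increasing) auto
      also have "\<dots> \<le> 12 ^ (2 * l)" by (intro power_mono) auto
      finally show "3 ^ card S * (3 * B) \<le> 12 ^ (2 * l) * (3 * B)" using B by (intro mult_right_mono) auto
      show "\<theta> ^ (card S - 1) * card \<S> / m * (2 * real D) ^ (2 * l - card S)
        \<le> 12 ^ (2 * l) * (\<tau> ^ (card S - 1) * card \<T> / card H)" using j S by (intro scale) auto
    qed (use \<theta> B m in auto)
    also have "\<dots> = K * \<tau> ^ (card S - 1) * card \<T> / card H" unfolding K_def pw by simp
    finally show ?thesis by linarith
  qed
  have manyT: "1 \<le> K * \<tau> ^ (2 * l - 1) * card \<T> / card H"
  proof -
    have "1 \<le> B * (\<theta> ^ (2 * l - 1) * card \<S> / m * (2 * real D) ^ (2 * l - 2 * l))" using one by simp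
    also have "\<dots> \<le> B * (12 ^ (2 * l) * (\<tau> ^ (2 * l - 1) * card \<T> / card H))"
      using B l by (intro mult_left_mono scale) auto
    also have "\<dots> \<le> K * (\<tau> ^ (2 * l - 1) * card \<T> / card H)"
    proof -
      have "(12::real) ^ (2 * l) \<le> 3 * 144 ^ (2 * l)" using power_mono[of "12::real" 144 "2 * l"]
          zero_le_power[of "144::real" "2 * l"] by linarith
      then have "B * 12 ^ (2 * l) \<le> K" unfolding K_def using B by (simp add: mult.commute)
      then have "B * 12 ^ (2 * l) * (\<tau> ^ (2 * l - 1) * card \<T> / card H) \<le> K * (\<tau> ^ (2 * l - 1) * card \<T> / card H)"
        using \<tau> by (intro mult_right_mono) auto
      then show ?thesis by (simp add: mult.assoc)
    qed
    finally show ?thesis by simp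
  qed
  have sz: "T \<subseteq> H \<and> card T = 2 * l" if "T \<in> \<T>" for T using T[OF that] card2l[OF that] by simp
  have "1 \<le> 2 * l" using l by simp
  from containers_of_supersaturation[OF finH \<tau> K(1) this sz degT manyT]
  obtain \<C> where \<C>: "finite \<C>" "card \<C> \<le> (card H + 1) ^ (2 * l * nat \<lceil>4 * \<tau> * card H\<rceil>)"
    "\<And>I. I \<subseteq> H \<Longrightarrow> (\<And>A. A \<in> \<T> \<Longrightarrow> \<not> A \<subseteq> I) \<Longrightarrow>
      \<exists>C\<in>\<C>. I \<subseteq> C \<and> C \<subseteq> H \<and> real (card C) \<le> (1 - shrink (2 * l) K) * card H" by blast
  have "\<tau> * card H \<le> \<tau> * (2 * D * m)" using cH \<tau> by (intro mult_left_mono) auto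
  also have "\<dots> = w / card V * card G" using D0 by (simp add: \<tau>_def \<theta>_def n_def m_def)
  finally have "4 * \<tau> * card H \<le> 4 * (w / card V * card G)" by simp
  then have "nat \<lceil>4 * \<tau> * card H\<rceil> \<le> nat \<lceil>4 * (w / card V * card G)\<rceil>" by (intro nat_mono ceiling_mono)
  then have "(card H + 1) ^ (2 * l * nat \<lceil>4 * \<tau> * card H\<rceil>) \<le> (card H + 1) ^ (2 * l * nat \<lceil>4 * (w / card V * card G)\<rceil>)"
    by (intro power_increasing mult_le_mono2) auto
  then have cC: "card \<C> \<le> (card H + 1) ^ (2 * l * nat \<lceil>4 * (w / card V * card G)\<rceil>)" using \<C>(2) by linarith
  show ?thesis
  proof (rule that[OF \<C>(1) cC])
    fix I assume I: "I \<subseteq> H" "cycle_free (2 * l) I"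
    then have "\<not> A \<subseteq> I" if "A \<in> \<T>" for A using T[OF that] by (auto simp: cycle_free_def)
    then show "\<exists>C\<in>\<C>. I \<subseteq> C \<and> C \<subseteq> H \<and> real (card C) \<le> (1 - shrink (2 * l) (3 * 144 ^ (2 * l) * light_const l)) * card H"
      using \<C>(3)[OF I(1)] unfolding K_def B_def by blast
  qed
qed

section \<open>One refinement step in the sparse regime\<close>

definition triples :: "'v set \<Rightarrow> 'v set set" where
  "triples V = {f. f \<subseteq> V \<and> card f = 3}"

definition light_factor :: "nat \<Rightarrow> real" where
  "light_factor l = 24 * (128 * (real l)\<^sup>2) ^ l"

lemma light_factor_ge:
  assumes "2 \<le> l" shows "24 \<le> light_factor l"
proof -
  have "1 \<le> (128 * (real l)\<^sup>2) ^ l" using assms by (intro one_le_power) (simp add: power2_eq_square mult_ge1_I)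
  then show ?thesis by (simp add: light_factor_def)
qed

definition step_rate :: "nat \<Rightarrow> real" where
  "step_rate l = min (shrink (2 * l) (64 * 4 ^ l)) (shrink (2 * l) (3 * 144 ^ (2 * l) * light_const l))"

text \<open>Here \<open>X\<close> bounds the number of vertices of a fingerprint in one container step and \<open>N\<^sub>0\<close> is the size
  at which containers are not refined any more. The assumption \<open>heavy\<close> balances the two kinds of steps.\<close>

locale sparse_regime =
  fixes V :: "'v set" and l :: nat and n X N\<^sub>0 L :: real
  assumes finV: "finite V" and n_def: "n = card V" and L_def: "L = ln n" and L1: "1 \<le> L"
    and l2: "2 \<le> l" and X_large: "4 * n \<le> X"
    and X_lower: "n ^ (2 * l) \<le> X ^ (2 * l - 1)" and X_upper: "X ^ l \<le> n ^ (l + 1)"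
    and N0_lower: "128 * real l * n\<^sup>2 \<le> N\<^sub>0" and XL: "X * L \<le> N\<^sub>0"
    and heavy: "(3072 * real l * light_factor l) ^ (4 * l - 3) * n ^ ((l + 1) * (4 * l - 3)) * L ^ (2 * l - 2)
      \<le> X ^ ((l - 1) * (4 * l - 3) + (2 * l - 1)) * N\<^sub>0 ^ (2 * l - 2)"
    and gap: "1536 * real l * light_factor l * L * n ^ (l - 1) \<le> X ^ (l - 1)"
begin

lemma n_pos: "n > 0"
proof (rule ccontr)
  assume "\<not> n > 0"
  then have "n = 0" by (simp add: n_def)
  then show False using L1 by (simp add: L_def)
qed

lemma n_exp: "n = exp L" using n_pos by (simp add: L_def)

lemma n_ge: "2 \<le> n"
proof -
  have "2 \<le> exp (1::real)" using exp_ge_add_one_self[of "1::real"] by simp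
  also have "\<dots> \<le> exp L" using L1 by simp
  finally show ?thesis by (simp add: n_exp)
qed

lemma X_pos: "X > 0" using X_large n_pos by linarith

lemma X_ge: "8 \<le> X" using X_large n_ge by linarith

lemma N0_pos: "N\<^sub>0 > 0"
proof -
  have "0 < 128 * real l * n\<^sup>2" using n_pos l2 by simp
  then show ?thesis using N0_lower by linarith
qed

lemma card_family:
  assumes "C \<subseteq> triples V" shows "finite C" "real (card C) + 1 \<le> n ^ 3"
proof -
  have fin: "finite (triples V)" unfolding triples_def using finV by (auto intro: finite_subset[of _ "Pow V"])
  then show "finite C" using assms finite_subset by auto
  have "card C \<le> card (triples V)" by (rule card_mono[OF fin assms])
  also have "\<dots> = card V choose 3" unfolding triples_def by (rule n_subsets[OF finV])
  finally have "card C \<le> card V choose 3" .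
  moreover have "(card V choose 3) + 1 \<le> card V ^ 3"
  proof (cases "3 \<le> card V")
    case True
    have "fact 3 * (card V choose 3) \<le> card V ^ 3" by (rule binomial_fact_pow[THEN order_trans[rotated]]) (simp add: mult.commute)
    then have "6 * (card V choose 3) \<le> card V ^ 3" by (simp add: fact_numeral)
    moreover have "(card V choose 3) > 0" using True by simp
    ultimately show ?thesis by linarith
  next
    case False
    have "card V > 0" using n_pos by (simp add: n_def)
    then show ?thesis using False by (simp add: binomial_eq_0)
  qed
  ultimately have "card C + 1 \<le> card V ^ 3" by linarith
  then have "real (card C + 1) \<le> real (card V ^ 3)" by (rule of_nat_mono)
  then show "real (card C) + 1 \<le> n ^ 3" by (simp add: n_def)
qed

lemma family_power_le:
  assumes "H \<subseteq> triples V" "real k \<le> b"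
  shows "real ((card H + 1) ^ k) \<le> exp (3 * L * b)"
proof -
  have "real ((card H + 1) ^ k) = (real (card H) + 1) ^ k" by (simp add: add.commute)
  also have "\<dots> \<le> (n ^ 3) ^ k" using card_family(2)[OF assms(1)] by (intro power_mono) auto
  also have "\<dots> = exp (3 * L * k)" by (simp add: n_exp exp_of_nat_mult[symmetric] mult_ac)
  also have "\<dots> \<le> exp (3 * L * b)" using assms(2) L1 by simp
  finally show ?thesis .
qed

lemma sum_codegree:
  assumes C: "C \<subseteq> triples V" and P: "finite P" "\<And>e. e \<in> P \<Longrightarrow> card e = 2"
  shows "(\<Sum>e\<in>P. card (apexes C e)) = (\<Sum>f\<in>C. card {e \<in> P. e \<in> pairs f})"
proof -
  have finC: "finite C" by (rule card_family(1)[OF C])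
  have "(\<Sum>e\<in>P. card (apexes C e)) = (\<Sum>e\<in>P. card {f \<in> C. e \<in> pairs f})"
    using C P(2) by (intro sum.cong refl card_apexes) (auto simp: triples_def)
  also have "\<dots> = (\<Sum>e\<in>P. \<Sum>f\<in>C. if e \<in> pairs f then 1 else 0)"
    using finC by (simp add: sum.inter_filter[symmetric])
  also have "\<dots> = (\<Sum>f\<in>C. \<Sum>e\<in>P. if e \<in> pairs f then 1 else 0)" by (rule sum.swap)
  also have "\<dots> = (\<Sum>f\<in>C. card {e \<in> P. e \<in> pairs f})"
    using P by (simp add: sum.inter_filter[symmetric])
  finally show ?thesis .
qed

lemma sum_codegree_le:
  assumes C: "C \<subseteq> triples V" and P: "finite P" "\<And>e. e \<in> P \<Longrightarrow> card e = 2"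
  shows "(\<Sum>e\<in>P. card (apexes C e)) \<le> 3 * card C"
proof -
  have "(\<Sum>f\<in>C. card {e \<in> P. e \<in> pairs f}) \<le> (\<Sum>f\<in>C. 3)"
  proof (rule sum_mono)
    fix f assume "f \<in> C"
    then have "card f = 3" using C by (auto simp: triples_def)
    then have "card (pairs f) = 3" "finite (pairs f)" using card_pairs[of f] card_ge_0_finite[of "pairs f"] by auto
    then show "card {e \<in> P. e \<in> pairs f} \<le> 3" using card_mono[of "pairs f" "{e \<in> P. e \<in> pairs f}"] by auto
  qed
  then show ?thesis using sum_codegree[OF assms] by simp
qed

lemma sum_codegree_ge:
  assumes C: "C \<subseteq> triples V" and P: "finite P" "\<And>e. e \<in> P \<Longrightarrow> card e = 2"
  shows "card {f \<in> C. \<exists>e\<in>P. e \<in> pairs f} \<le> (\<Sum>e\<in>P. card (apexes C e))"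
proof -
  have finC: "finite C" by (rule card_family(1)[OF C])
  have "card {f \<in> C. \<exists>e\<in>P. e \<in> pairs f} = (\<Sum>f\<in>C. if \<exists>e\<in>P. e \<in> pairs f then 1 else 0)"
    using finC by (simp add: sum.inter_filter[symmetric])
  also have "\<dots> \<le> (\<Sum>f\<in>C. card {e \<in> P. e \<in> pairs f})"
    using P(1) by (intro sum_mono) (auto simp: Suc_le_eq card_gt_0_iff)
  finally show ?thesis using sum_codegree[OF assms] by simp
qed

text \<open>Only the part \<open>H\<close> is refined; adding all of \<open>C - H\<close> to a
  container of \<open>I \<inter> H\<close> gives a container of \<open>I\<close>. The gain \<delta>
  in \<open>H\<close> becomes a gain \<rho> in \<open>C\<close>.\<close>

lemma extend_containers:
  fixes H C :: "'v set set" and \<rho> \<delta> b :: real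
  assumes C: "C \<subseteq> triples V" and H: "H \<subseteq> C" "\<rho> * card C \<le> \<delta> * card H"
    and D: "finite \<D>" "real (card \<D>) \<le> b"
      "\<And>I. I \<subseteq> H \<Longrightarrow> cycle_free (2 * l) I \<Longrightarrow> \<exists>D\<in>\<D>. I \<subseteq> D \<and> D \<subseteq> H \<and> real (card D) \<le> (1 - \<delta>) * card H"
  shows "\<exists>\<C>. finite \<C> \<and> real (card \<C>) \<le> b \<and> (\<forall>I. I \<subseteq> C \<longrightarrow> cycle_free (2 * l) I \<longrightarrow>
     (\<exists>D\<in>\<C>. I \<subseteq> D \<and> D \<subseteq> C \<and> real (card D) \<le> (1 - \<rho>) * card C))"
proof (intro exI conjI allI impI)
  let ?\<C> = "(\<lambda>D. (C - H) \<union> D) ` \<D>"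
  show "finite ?\<C>" using D by simp
  show "real (card ?\<C>) \<le> b" using card_image_le[OF D(1), of "\<lambda>D. (C - H) \<union> D"] D(2) by linarith
  fix I assume I: "I \<subseteq> C" "cycle_free (2 * l) I"
  have finC: "finite C" by (rule card_family(1)[OF C])
  have "cycle_free (2 * l) (I \<inter> H)" using I(2) by (auto simp: cycle_free_def)
  then obtain D where D': "D \<in> \<D>" "I \<inter> H \<subseteq> D" "D \<subseteq> H" "real (card D) \<le> (1 - \<delta>) * card H"
    using D(3)[of "I \<inter> H"] by auto
  have "card ((C - H) \<union> D) \<le> card (C - H) + card D" by (rule card_Un_le)
  moreover have "real (card (C - H)) = real (card C) - card H"
    using H(1) finC finite_subset[OF H(1) finC] card_mono[OF finC H(1)] by (simp add: card_Diff_subset of_nat_diff)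
  ultimately have "real (card ((C - H) \<union> D)) \<le> real (card C) - card H + (1 - \<delta>) * card H" using D'(4) by linarith
  also have "\<dots> \<le> (1 - \<rho>) * card C" using H(2) by (simp add: algebra_simps)
  finally show "\<exists>D\<in>?\<C>. I \<subseteq> D \<and> D \<subseteq> C \<and> real (card D) \<le> (1 - \<rho>) * card C"
    using D' I(1) H(1) by (intro bexI[of _ "(C - H) \<union> D"] conjI) auto
qed

lemma card_pairs_V: "finite {e. e \<subseteq> V \<and> card e = 2}" "real (card {e. e \<subseteq> V \<and> card e = 2}) \<le> n\<^sup>2"
proof -
  show "finite {e. e \<subseteq> V \<and> card e = 2}" using finV by (auto intro: finite_subset[of _ "Pow V"])
  have "card {e. e \<subseteq> V \<and> card e = 2} = card V choose 2" by (rule n_subsets[OF finV])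
  also have "\<dots> \<le> (card V)\<^sup>2" by (simp add: choose_two power2_eq_square div_le_dividend order_trans[OF div_le_dividend])
  finally have "real (card {e. e \<subseteq> V \<and> card e = 2}) \<le> real ((card V)\<^sup>2)" by (rule of_nat_mono)
  then show "real (card {e. e \<subseteq> V \<and> card e = 2}) \<le> n\<^sup>2" by (simp add: n_def)
qed

lemma codegree_le: "C \<subseteq> triples V \<Longrightarrow> real (card (apexes C e)) \<le> n"
proof -
  assume "C \<subseteq> triples V"
  then have "apexes C e \<subseteq> V" by (auto simp: apexes_def triples_def)
  then have "card (apexes C e) \<le> card V" using finV by (intro card_mono)
  then show ?thesis by (simp add: n_def)
qed

text \<open>The largest codegree that the light case tolerates: a dyadic class of pairs of codegree
  about \<open>D\<close> has at least of order \<open>card C / (L * D)\<close> members, and cycles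
  in it with fingerprint \<open>X\<close> need \<open>(X / n) ^ (l - 1)\<close> times this number to
  be a large multiple of \<open>n\<^sup>2\<close>.\<close>

definition threshold :: "'v set set \<Rightarrow> real" where
  "threshold C = (X / n) ^ (l - 1) * card C / (n\<^sup>2 * light_factor l * L)"

lemma threshold_ge: "N\<^sub>0 \<le> card C \<Longrightarrow> 1536 * real l \<le> threshold C"
proof -
  assume C: "N\<^sub>0 \<le> card C"
  have lf: "light_factor l > 0" using light_factor_ge[OF l2] by linarith
  have "1 \<le> 128 * real l" using l2 by simp
  then have "1 * n\<^sup>2 \<le> 128 * real l * n\<^sup>2" by (intro mult_right_mono) auto
  then have "n\<^sup>2 \<le> card C" using N0_lower C by linarith
  moreover have "1536 * real l * light_factor l * L \<le> (X / n) ^ (l - 1)"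
    using gap n_pos by (simp add: power_divide pos_le_divide_eq)
  ultimately have "(1536 * real l * light_factor l * L) * n\<^sup>2 \<le> (X / n) ^ (l - 1) * card C"
    using X_pos n_pos by (intro mult_mono) auto
  moreover have "0 < n\<^sup>2 * light_factor l * L" using n_pos lf L1 by simp
  ultimately show ?thesis unfolding threshold_def by (simp add: pos_le_divide_eq mult_ac)
qed

text \<open>Every pair in the shadow of \<open>H\<close> has codegree above the threshold in
  \<open>C\<close>, and the codegrees in \<open>C\<close> sum to at most \<open>3 * card C\<close>;
  so the shadow is small compared with \<open>H\<close>.\<close>

lemma heavy_step:
  assumes C: "C \<subseteq> triples V" and N: "N\<^sub>0 \<le> card C"
    and H_def: "H = {f \<in> C. \<forall>e\<in>pairs f. threshold C < card (apexes C e)}" and half: "card C \<le> 2 * card H"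
    and \<delta>: "0 < \<delta>" "\<delta> \<le> shrink (2 * l) (64 * 4 ^ l)"
  shows "\<exists>\<C>. finite \<C> \<and> real (card \<C>) \<le> exp (30 * real l * X * L\<^sup>2) \<and> (\<forall>I. I \<subseteq> C \<longrightarrow> cycle_free (2 * l) I \<longrightarrow>
     (\<exists>D\<in>\<C>. I \<subseteq> D \<and> D \<subseteq> C \<and> real (card D) \<le> (1 - \<delta> / 2) * card C))"
proof -
  define D\<^sub>1 where "D\<^sub>1 = threshold C"
  define N where "N = real (card C)"
  \<comment> \<open>The largest rate that the cost allows: the exponent may exceed that of a light
    step by a factor \<open>L\<close>, because a constant fraction is removed.\<close>
  define \<tau> where "\<tau> = X * L / N"
  \<comment> \<open>About the smallest sample for which the shadow bound \<open>sh\<close> yields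
    \<open>dens\<close>; note \<open>1536 = 6 * 256\<close>.\<close>
  define w where "w = nat \<lceil>1536 * real l * n / D\<^sub>1\<rceil>"
  have D1: "1536 * real l \<le> D\<^sub>1" unfolding D\<^sub>1_def by (rule threshold_ge[OF N])
  then have D1p: "D\<^sub>1 > 0" using l2 by linarith
  have N0: "N > 0" "N\<^sub>0 \<le> N" using assms(2) N0_pos by (auto simp: N_def)
  have HC: "H \<subseteq> C" by (auto simp: H_def)
  have HV: "f \<subseteq> V \<and> card f = 3" if "f \<in> H" for f using HC C that by (auto simp: triples_def)
  have Hne: "H \<noteq> {}" using half N0 by (auto simp: N_def)
  have sh2: "card e = 2" if "e \<in> shadow H" for e using that by (auto simp: shadow_def pairs_def)
  have finS: "finite (shadow H)"
    using HV by (intro finite_subset[OF _ card_pairs_V(1)]) (auto simp: shadow_def pairs_def)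
  have "card (shadow H) * D\<^sub>1 \<le> (\<Sum>e\<in>shadow H. real (card (apexes C e)))"
  proof -
    have "D\<^sub>1 \<le> real (card (apexes C e))" if "e \<in> shadow H" for e
      using that unfolding shadow_def H_def D\<^sub>1_def by auto
    then show ?thesis using sum_bounded_below[of "shadow H" D\<^sub>1 "\<lambda>e. real (card (apexes C e))"] by simp
  qed
  also have "\<dots> \<le> 3 * N" unfolding N_def using sum_codegree_le[OF C finS sh2] by (simp flip: of_nat_sum)
  also have "\<dots> \<le> 6 * card H" using half by (simp add: N_def)
  finally have sh: "card (shadow H) * D\<^sub>1 \<le> 6 * card H" .
  obtain f where f: "f \<in> H" using Hne by auto
  then have "card (pairs f) = 3" using HV by (intro card_pairs) auto
  then obtain e where "e \<in> pairs f" by (metis card.empty ex_in_conv zero_neq_numeral)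
  then have "D\<^sub>1 < n" using f codegree_le[OF C, of e] unfolding H_def D\<^sub>1_def by force
  then have r: "1536 * real l \<le> 1536 * real l * n / D\<^sub>1" using D1p l2 by (simp add: pos_le_divide_eq)
  have w1: "1536 * real l * n / D\<^sub>1 \<le> w" unfolding w_def by linarith
  have w2: "w \<le> 3072 * real l * n / D\<^sub>1"
  proof -
    define z where "z = 1536 * real l * n / D\<^sub>1"
    have z: "1536 * real l \<le> z" using r by (simp add: z_def)
    have "real w \<le> z + 1" unfolding w_def z_def[symmetric] using z by linarith
    moreover have "1 \<le> z" using z l2 by linarith
    ultimately have "real w \<le> 2 * z" by linarith
    then show ?thesis by (simp add: z_def)
  qed
  have w6: "6 \<le> w" using r w1 l2 by linarith
  have "1536 * real l * n / D\<^sub>1 \<le> n" using D1 D1p n_pos by (simp add: pos_divide_le_eq mult.commute)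
  then have wn: "w \<le> card V" unfolding w_def n_def by (simp add: nat_le_iff ceiling_le_iff)
  have dens: "256 * real l * card (shadow H) \<le> w / card V * card H"
  proof -
    have "1536 * real l / D\<^sub>1 \<le> w / n" using w1 n_pos by (simp add: field_simps)
    then have "1536 * real l / D\<^sub>1 * card H \<le> w / n * card H" by (intro mult_right_mono) auto
    moreover have "256 * real l * card (shadow H) \<le> 1536 * real l / D\<^sub>1 * card H"
      using mult_left_mono[OF sh, of "256 * real l"] D1p by (simp add: pos_le_divide_eq mult_ac)
    ultimately show ?thesis by (simp add: n_def)
  qed
  have \<tau>: "0 < \<tau>" "\<tau> \<le> 1" using X_pos L1 N0 XL by (auto simp: \<tau>_def)
  have pw: "(w / card V) ^ (4 * l - 3) \<le> \<tau> ^ (2 * l - 1)"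
  proof -
    define k where "k = 4 * l - 3"
    define \<Lambda> where "\<Lambda> = (X / n) ^ (l - 1)"
    define c where "c = 3072 * real l * light_factor l"
    have \<Lambda>: "\<Lambda> > 0" using X_pos n_pos by (simp add: \<Lambda>_def)
    have lf: "light_factor l > 0" using light_factor_ge[OF l2] by linarith
    have "w / card V \<le> 3072 * real l / D\<^sub>1" using w2 n_pos by (simp add: n_def field_simps)
    also have "\<dots> = c * n\<^sup>2 * L / (\<Lambda> * N)"
      unfolding D\<^sub>1_def threshold_def \<Lambda>_def[symmetric] N_def[symmetric] c_def by simp
    finally have "(w / card V) ^ k \<le> (c * n\<^sup>2 * L / (\<Lambda> * N)) ^ k" by (intro power_mono) auto
    also have "\<dots> \<le> \<tau> ^ (2 * l - 1)"
    proof -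
      have e1: "k = (2 * l - 1) + (2 * l - 2)" using l2 by (simp add: k_def)
      have e2: "2 * k + (l - 1) * k = (l + 1) * k" using l2 by (cases l) (auto simp: algebra_simps)
      \<comment> \<open>With \<open>w\<close> and \<tau> inserted, the required inequality is
        \<open>heavy\<close> with \<open>N\<close> for \<open>N\<^sub>0\<close>. Larger containers
        only help: of the \<open>4 * l - 3\<close> powers of \<open>N\<close>, only
        \<open>2 * l - 1\<close> are spent on \<tau>.\<close>
      have "c ^ k * n ^ ((l + 1) * k) * L ^ (2 * l - 2) \<le> X ^ ((l - 1) * k + (2 * l - 1)) * N\<^sub>0 ^ (2 * l - 2)"
        using heavy by (simp add: c_def k_def)
      also have "\<dots> \<le> X ^ ((l - 1) * k + (2 * l - 1)) * N ^ (2 * l - 2)"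
        using N0 N0_pos X_pos by (intro mult_left_mono power_mono) auto
      finally have h: "c ^ k * n ^ ((l + 1) * k) * L ^ (2 * l - 2) \<le> X ^ ((l - 1) * k + (2 * l - 1)) * N ^ (2 * l - 2)" .
      have "(c * n\<^sup>2 * L) ^ k * N ^ (2 * l - 1) * n ^ ((l - 1) * k)
         = (c ^ k * n ^ ((l + 1) * k) * L ^ (2 * l - 2)) * (L ^ (2 * l - 1) * N ^ (2 * l - 1))"
      proof -
        have "(c * n\<^sup>2 * L) ^ k = c ^ k * n ^ (2 * k) * L ^ k" by (simp add: power_mult_distrib power_mult)
        moreover have "L ^ k = L ^ (2 * l - 1) * L ^ (2 * l - 2)" unfolding e1 by (rule power_add)
        moreover have "n ^ ((l + 1) * k) = n ^ (2 * k) * n ^ ((l - 1) * k)" unfolding e2[symmetric] by (rule power_add)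
        ultimately show ?thesis by simp
      qed
      also have "\<dots> \<le> (X ^ ((l - 1) * k + (2 * l - 1)) * N ^ (2 * l - 2)) * (L ^ (2 * l - 1) * N ^ (2 * l - 1))"
        using h L1 N0 by (intro mult_right_mono) auto
      also have "\<dots> = (X * L) ^ (2 * l - 1) * (\<Lambda> * N) ^ k * n ^ ((l - 1) * k)"
      proof -
        have "N ^ k = N ^ (2 * l - 1) * N ^ (2 * l - 2)" unfolding e1 by (rule power_add)
        moreover have "\<Lambda> ^ k * n ^ ((l - 1) * k) = X ^ ((l - 1) * k)"
          using n_pos by (simp add: \<Lambda>_def power_mult power_divide)
        ultimately show ?thesis by (simp add: power_add power_mult_distrib mult_ac)
      qed
      finally have "(c * n\<^sup>2 * L) ^ k * N ^ (2 * l - 1) \<le> (X * L) ^ (2 * l - 1) * (\<Lambda> * N) ^ k"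
        using n_pos by simp
      then show ?thesis using \<Lambda> N0 by (simp add: \<tau>_def power_divide field_simps)
    qed
    finally show ?thesis by (simp add: k_def)
  qed
  obtain \<D> where \<D>: "finite \<D>" "card \<D> \<le> (card H + 1) ^ (2 * l * nat \<lceil>4 * \<tau> * card H\<rceil>)"
    "\<And>I. I \<subseteq> H \<Longrightarrow> cycle_free (2 * l) I \<Longrightarrow>
      \<exists>D\<in>\<D>. I \<subseteq> D \<and> D \<subseteq> H \<and> real (card D) \<le> (1 - shrink (2 * l) (64 * 4 ^ l)) * card H"
    using heavy_containers[OF finV HV Hne l2 w6 wn dens \<tau> pw] by blast
  have "real (2 * l * nat \<lceil>4 * \<tau> * card H\<rceil>) \<le> 10 * real l * X * L"
  proof -
    have "\<tau> * card H \<le> \<tau> * N" using \<tau> HC card_family(1)[OF C] by (intro mult_left_mono) (auto simp: N_def intro: card_mono)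
    also have "\<dots> = X * L" using N0 by (simp add: \<tau>_def)
    finally have "4 * \<tau> * card H \<le> 4 * (X * L)" by simp
    moreover have "1 * 1 \<le> X * L" using X_ge L1 by (intro mult_mono) auto
    moreover have "0 \<le> 4 * \<tau> * card H" using \<tau> by simp
    ultimately have "real (nat \<lceil>4 * \<tau> * card H\<rceil>) \<le> 5 * (X * L)" by linarith
    then have "2 * real l * real (nat \<lceil>4 * \<tau> * card H\<rceil>) \<le> 2 * real l * (5 * (X * L))" by (intro mult_left_mono) auto
    then show ?thesis by simp
  qed
  then have "real (card \<D>) \<le> exp (3 * L * (10 * real l * X * L))"
    using \<D>(2) family_power_le[of H _ "10 * real l * X * L"] HC C by (meson of_nat_mono order_trans)
  also have "3 * L * (10 * real l * X * L) = 30 * real l * X * L\<^sup>2" by (simp add: power2_eq_square)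
  finally have cD: "real (card \<D>) \<le> exp (30 * real l * X * L\<^sup>2)" .
  have "\<delta> / 2 * card C \<le> \<delta> * card H" using half \<delta> by simp
  moreover have "\<exists>D\<in>\<D>. I \<subseteq> D \<and> D \<subseteq> H \<and> real (card D) \<le> (1 - \<delta>) * card H" if "I \<subseteq> H" "cycle_free (2 * l) I" for I
  proof -
    have "(1 - shrink (2 * l) (64 * 4 ^ l)) * card H \<le> (1 - \<delta>) * card H" using \<delta> by (intro mult_right_mono) auto
    then show ?thesis using \<D>(3)[OF that] by (meson order_trans)
  qed
  ultimately show ?thesis by (intro extend_containers[OF C HC _ \<D>(1) cD]) auto
qed

end

context sparse_regime
begin

text \<open>Pigeonhole: codegrees lie between 1 and \<open>n\<close>, so at most
  \<open>3 * L\<close> dyadic classes occur, \<open>ln 2\<close> being at least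
  \<open>1 / 2\<close>.\<close>

lemma dyadic_class:
  assumes C: "C \<subseteq> triples V" and P: "finite P" "\<And>e. e \<in> P \<Longrightarrow> 1 \<le> card (apexes C e)"
    and S: "S \<le> (\<Sum>e\<in>P. real (card (apexes C e)))"
  obtains i where "S / (3 * L) \<le> (\<Sum>e | e \<in> P \<and> 2 ^ i \<le> card (apexes C e) \<and> card (apexes C e) < 2 ^ (i + 1). real (card (apexes C e)))"
proof -
  define c where "c = (\<lambda>e. card (apexes C e))"
  define Q where "Q = (\<lambda>i::nat. {e \<in> P. 2 ^ i \<le> c e \<and> c e < 2 ^ (i + 1)})"
  define J where "J = nat \<lfloor>2 * L\<rfloor>"
  have J: "real J \<le> 2 * L" using L1 by (simp add: J_def)
  have sub: "P \<subseteq> (\<Union>i\<in>{..J}. Q i)"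
  proof
    fix e assume e: "e \<in> P"
    then obtain i where i: "2 ^ i \<le> c e" "c e < 2 ^ (i + 1)"
      using ex_power_ivl1[of 2 "c e"] P(2) by (auto simp: c_def)
    have "real (2 ^ i) \<le> real (c e)" using i(1) by (rule of_nat_mono)
    also have "\<dots> \<le> n" unfolding c_def by (rule codegree_le[OF C])
    finally have "ln (2 ^ i) \<le> L" using n_pos unfolding L_def by (subst ln_le_cancel_iff) auto
    then have "real i * ln 2 \<le> L" by (simp add: ln_realpow)
    moreover have "real i * (1 / 2) \<le> real i * ln 2" using ln2_ge_two_thirds by (intro mult_left_mono) auto
    ultimately have "real i \<le> 2 * L" by linarith
    then have "i \<le> J" unfolding J_def by (simp add: le_nat_floor)
    then show "e \<in> (\<Union>i\<in>{..J}. Q i)" using i e by (auto simp: Q_def)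
  qed
  have finQ: "finite (Q i)" for i using P by (simp add: Q_def)
  have "S \<le> (\<Sum>e\<in>P. real (c e))" using S by (simp add: c_def)
  also have "\<dots> \<le> (\<Sum>e\<in>(\<Union>i\<in>{..J}. Q i). real (c e))"
    using sub finQ by (intro sum_mono2) auto
  also have "\<dots> \<le> (\<Sum>(i, e)\<in>Sigma {..J} Q. real (c e))"
    using finQ by (intro sum_le_included[where i = snd]) (auto intro!: finite_SigmaI)
  also have "\<dots> = (\<Sum>i\<le>J. \<Sum>e\<in>Q i. real (c e))" using finQ by (subst sum.Sigma) auto
  finally have tot: "S \<le> (\<Sum>i\<le>J. \<Sum>e\<in>Q i. real (c e))" .
  have "\<exists>i\<le>J. S / (3 * L) \<le> (\<Sum>e\<in>Q i. real (c e))"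
  proof (rule ccontr)
    assume "\<not> ?thesis"
    then have lt: "(\<Sum>e\<in>Q i. real (c e)) < S / (3 * L)" if "i \<le> J" for i using that not_le by blast
    have "(\<Sum>i\<le>J. \<Sum>e\<in>Q i. real (c e)) < (\<Sum>i\<le>J. S / (3 * L))"
      using lt by (intro sum_strict_mono) auto
    also have "\<dots> = (real J + 1) * (S / (3 * L))" by (simp add: add.commute)
    also have "\<dots> \<le> 3 * L * (S / (3 * L))"
    proof (rule mult_right_mono)
      show "real J + 1 \<le> 3 * L" using J L1 by linarith
      have "0 \<le> (\<Sum>e\<in>Q 0. real (c e))" by (intro sum_nonneg) auto
      then show "0 \<le> S / (3 * L)" using lt[of 0] by simp
    qed
    also have "\<dots> = S" using L1 by simp
    finally show False using tot by simp
  qed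
  then obtain i where "S / (3 * L) \<le> (\<Sum>e\<in>Q i. real (c e))" by auto
  then show ?thesis using that[of i] by (simp add: Q_def c_def)
qed

text \<open>At least half of the triples contain a pair of codegree at most the threshold. Pairs far
  below average codegree are discarded, and one dyadic class of the rest still covers a fraction of
  order \<open>1 / L\<close> of \<open>C\<close>.\<close>

lemma light_step:
  assumes C: "C \<subseteq> triples V" and N: "N\<^sub>0 \<le> card C"
    and half: "card C \<le> 2 * card {f \<in> C. \<exists>e\<in>pairs f. real (card (apexes C e)) \<le> threshold C}"
    and \<delta>: "0 < \<delta>" "\<delta> \<le> shrink (2 * l) (3 * 144 ^ (2 * l) * light_const l)"
  shows "\<exists>\<C>. finite \<C> \<and> real (card \<C>) \<le> exp (54 * real l * X * L) \<and> (\<forall>I. I \<subseteq> C \<longrightarrow> cycle_free (2 * l) I \<longrightarrow>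
     (\<exists>D\<in>\<C>. I \<subseteq> D \<and> D \<subseteq> C \<and> real (card D) \<le> (1 - \<delta> / (72 * L)) * card C))"
proof -
  define D\<^sub>1 where "D\<^sub>1 = threshold C"
  define N where "N = real (card C)"
  define t where "t = N / n\<^sup>2"
  define cod where "cod = (\<lambda>e. real (card (apexes C e)))"
  define A where "A = {e. e \<subseteq> V \<and> card e = 2}"
  \<comment> \<open>\<open>t\<close> is the average codegree up to a constant, so these pairs cover
    at most \<open>N / 8\<close> triples. Discarding them ensures that \<open>D\<close> is at least
    \<open>8 * l\<close>, which the expansion needs.\<close>
  define Low where "Low = {e \<in> A. cod e < t / 8}"
  define Mid where "Mid = {e \<in> A. t / 8 \<le> cod e \<and> cod e \<le> D\<^sub>1}"
  have N0: "N > 0" "N\<^sub>0 \<le> N" using assms(2) N0_pos by (auto simp: N_def)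
  have t: "t > 0" using N0 n_pos by (simp add: t_def)
  have tl: "128 * real l \<le> t" using N0_lower N0(2) n_pos by (simp add: t_def pos_le_divide_eq)
  have finA: "finite A" "real (card A) \<le> n\<^sup>2" using card_pairs_V by (simp_all add: A_def)
  have finC: "finite C" by (rule card_family(1)[OF C])
  have finLM: "finite Low" "finite Mid" using finA by (auto simp: Low_def Mid_def)
  have two: "card e = 2" if "e \<in> Low \<or> e \<in> Mid" for e using that by (auto simp: Low_def Mid_def A_def)
  have "{f \<in> C. \<exists>e\<in>pairs f. cod e \<le> D\<^sub>1} \<subseteq> {f \<in> C. \<exists>e\<in>Low. e \<in> pairs f} \<union> {f \<in> C. \<exists>e\<in>Mid. e \<in> pairs f}"
  proof
    fix f assume "f \<in> {f \<in> C. \<exists>e\<in>pairs f. cod e \<le> D\<^sub>1}"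
    then obtain e where f: "f \<in> C" "e \<in> pairs f" "cod e \<le> D\<^sub>1" by blast
    then have "e \<in> A" using C unfolding A_def pairs_def triples_def by blast
    then have "e \<in> Low \<or> e \<in> Mid" using f(3) by (auto simp: Low_def Mid_def)
    then show "f \<in> {f \<in> C. \<exists>e\<in>Low. e \<in> pairs f} \<union> {f \<in> C. \<exists>e\<in>Mid. e \<in> pairs f}" using f by blast
  qed
  then have "card {f \<in> C. \<exists>e\<in>pairs f. cod e \<le> D\<^sub>1} \<le> card ({f \<in> C. \<exists>e\<in>Low. e \<in> pairs f} \<union> {f \<in> C. \<exists>e\<in>Mid. e \<in> pairs f})"
    using finC by (intro card_mono) auto
  also have "\<dots> \<le> card {f \<in> C. \<exists>e\<in>Low. e \<in> pairs f} + card {f \<in> C. \<exists>e\<in>Mid. e \<in> pairs f}" by (rule card_Un_le)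
  finally have c1: "card {f \<in> C. \<exists>e\<in>pairs f. cod e \<le> D\<^sub>1}
     \<le> card {f \<in> C. \<exists>e\<in>Low. e \<in> pairs f} + card {f \<in> C. \<exists>e\<in>Mid. e \<in> pairs f}" .
  have cL: "real (card {f \<in> C. \<exists>e\<in>Low. e \<in> pairs f}) \<le> (\<Sum>e\<in>Low. cod e)"
    using of_nat_mono[OF sum_codegree_ge[OF C finLM(1)], where 'a = real] two by (simp add: cod_def)
  have cM: "real (card {f \<in> C. \<exists>e\<in>Mid. e \<in> pairs f}) \<le> (\<Sum>e\<in>Mid. cod e)"
    using of_nat_mono[OF sum_codegree_ge[OF C finLM(2)], where 'a = real] two by (simp add: cod_def)
  have "(\<Sum>e\<in>Low. cod e) \<le> (\<Sum>e\<in>Low. t / 8)" by (intro sum_mono) (auto simp: Low_def)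
  also have "\<dots> = card Low * (t / 8)" by simp
  also have "\<dots> \<le> n\<^sup>2 * (t / 8)"
  proof (rule mult_right_mono)
    have "card Low \<le> card A" using finA by (intro card_mono) (auto simp: Low_def)
    then show "real (card Low) \<le> n\<^sup>2" using finA by linarith
  qed (use t in simp)
  also have "\<dots> = N / 8" using n_pos by (simp add: t_def)
  finally have sL: "(\<Sum>e\<in>Low. cod e) \<le> N / 8" .
  have "N \<le> 2 * real (card {f \<in> C. \<exists>e\<in>pairs f. cod e \<le> D\<^sub>1})" using half by (simp add: N_def cod_def D\<^sub>1_def)
  then have sM: "N / 4 \<le> (\<Sum>e\<in>Mid. cod e)" using c1 cL cM sL N0 by linarith
  have "1 \<le> card (apexes C e)" if "e \<in> Mid" for e
  proof -
    have "0 < cod e" using that t by (auto simp: Mid_def)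
    then show ?thesis by (simp add: cod_def Suc_le_eq)
  qed
  then obtain i where i: "N / 4 / (3 * L) \<le> (\<Sum>e | e \<in> Mid \<and> 2 ^ i \<le> card (apexes C e) \<and> card (apexes C e) < 2 ^ (i + 1). real (card (apexes C e)))"
    using dyadic_class[OF C finLM(2), of "N / 4"] sM unfolding cod_def by metis
  define D :: nat where "D = 2 ^ i"
  define G where "G = {e \<in> Mid. 2 ^ i \<le> card (apexes C e) \<and> card (apexes C e) < 2 ^ (i + 1)}"
  define m where "m = real (card G)"
  define H where "H = {f \<in> C. \<exists>e\<in>G. e \<subseteq> f}"
  have finG: "finite G" using finLM by (simp add: G_def)
  have GA: "e \<subseteq> V \<and> card e = 2" if "e \<in> G" for e using that by (auto simp: G_def Mid_def A_def)
  have sG: "N / (12 * L) \<le> (\<Sum>e\<in>G. cod e)" using i by (simp add: G_def cod_def)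
  have cG: "real D \<le> cod e \<and> cod e \<le> 2 * real D" if "e \<in> G" for e
  proof -
    have "D \<le> card (apexes C e)" "card (apexes C e) \<le> 2 * D" using that by (auto simp: G_def D_def)
    then show ?thesis unfolding cod_def by (simp only: of_nat_le_iff[symmetric, where 'a = real] of_nat_mult of_nat_numeral)
  qed
  have "0 < N / (12 * L)" using N0 L1 by simp
  then have "0 < (\<Sum>e\<in>G. cod e)" using sG by linarith
  then have Gne: "G \<noteq> {}" by auto
  have m: "m > 0" using Gne finG by (simp add: m_def card_gt_0_iff)
  have "(\<Sum>e\<in>G. cod e) \<le> (\<Sum>e\<in>G. 2 * real D)" using cG by (intro sum_mono) auto
  also have "\<dots> = m * (2 * real D)" by (simp add: m_def)
  finally have mD: "N / (12 * L) \<le> m * (2 * real D)" using sG by linarith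
  obtain e\<^sub>0 where e0: "e\<^sub>0 \<in> G" using Gne by auto
  have tD: "t / 8 \<le> 2 * real D" using cG[OF e0] e0 by (auto simp: G_def Mid_def)
  then have "16 * real l \<le> 2 * real D" using tl by linarith
  then have Dl: "8 * l \<le> D" by linarith
  have DD1: "real D \<le> D\<^sub>1" using cG[OF e0] e0 by (auto simp: G_def Mid_def)
  have lf: "light_factor l > 0" using light_factor_ge[OF l2] by linarith
  define \<Lambda> where "\<Lambda> = (X / n) ^ (l - 1)"
  have \<Lambda>: "\<Lambda> > 0" using X_pos n_pos by (simp add: \<Lambda>_def)
  \<comment> \<open>The threshold was made for this: codegrees of at most \<open>D\<^sub>1\<close>
    force the class to have many pairs. The 24 is 12 from \<open>sG\<close> times 2 from the dyadic
    width.\<close>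
  have key: "light_factor l / 24 \<le> \<Lambda> * m / n\<^sup>2"
  proof -
    have "N / (12 * L) \<le> m * (2 * D\<^sub>1)" using mD DD1 m by (meson mult_left_mono mult_left_mono order_trans less_imp_le zero_le_numeral)
    also have "\<dots> = (N / (12 * L)) * (24 * (\<Lambda> * m / n\<^sup>2) / light_factor l)"
      unfolding D\<^sub>1_def threshold_def \<Lambda>_def[symmetric] N_def[symmetric] using L1 n_pos lf by (simp add: mult_ac)
    finally have "N / (12 * L) * 1 \<le> N / (12 * L) * (24 * (\<Lambda> * m / n\<^sup>2) / light_factor l)"
      by (simp only: mult_1_right)
    then have "1 \<le> 24 * (\<Lambda> * m / n\<^sup>2) / light_factor l"
      using \<open>0 < N / (12 * L)\<close> by (rule mult_left_le_imp_le)
    moreover have "b / 24 \<le> z" if "1 \<le> 24 * z / b" "b > 0" for z b :: real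
      using that by (simp add: field_simps)
    ultimately show ?thesis using lf by blast
  qed
  have key1: "1 \<le> \<Lambda> * m / n\<^sup>2" using key light_factor_ge[OF l2] by linarith
  have mn: "m \<le> n\<^sup>2"
  proof -
    have "card G \<le> card A" using finA by (intro card_mono) (auto simp: G_def Mid_def)
    then show ?thesis using finA by (simp add: m_def)
  qed
  \<comment> \<open>Otherwise the sample size would exceed \<open>n\<close>.\<close>
  have Xm: "X \<le> m"
  proof -
    have "n\<^sup>2 \<le> \<Lambda> * m" using key1 n_pos by (simp add: pos_le_divide_eq)
    then have "n\<^sup>2 * n ^ (l - 1) \<le> \<Lambda> * m * n ^ (l - 1)" using n_pos by (intro mult_right_mono) auto
    also have "\<dots> = X ^ (l - 1) * m" using n_pos by (simp add: \<Lambda>_def power_divide)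
    also have "n\<^sup>2 * n ^ (l - 1) = n ^ (l + 1)" using l2 by (simp add: power_add[symmetric])
    finally have "X ^ l \<le> X ^ (l - 1) * m" using X_upper by linarith
    moreover have "X ^ l = X ^ (l - 1) * X" using l2 by (cases l) auto
    ultimately show ?thesis using X_pos by simp
  qed
  \<comment> \<open>Makes \<open>w / n * m\<close>, which governs the fingerprint, equal to
    \<open>X\<close> up to a factor 2.\<close>
  define w where "w = nat \<lceil>n * X / m\<rceil>"
  have r1: "4 \<le> n * X / m"
  proof -
    have "4 * m \<le> 4 * n * n" using mn by (simp add: power2_eq_square)
    also have "\<dots> \<le> X * n" using X_large n_pos by (intro mult_right_mono) auto
    finally show ?thesis using m by (simp add: pos_le_divide_eq mult.commute)
  qed
  have w1: "n * X / m \<le> w" unfolding w_def by linarith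
  have w2: "w \<le> 2 * (n * X / m)" 
  proof -
    define z where "z = n * X / m"
    have "4 \<le> z" using r1 by (simp add: z_def)
    then show ?thesis unfolding w_def z_def[symmetric] by linarith
  qed
  have w4: "4 \<le> w" using r1 w1 by linarith
  have "n * X / m \<le> n" using Xm m n_pos by (simp add: pos_divide_le_eq)
  then have wn: "w \<le> card V" unfolding w_def n_def by (simp add: nat_le_iff ceiling_le_iff)
  have wX1: "X \<le> w / card V * card G"
    using w1 m n_pos by (simp add: n_def[symmetric] m_def[symmetric] field_simps)
  have wX2: "w / card V * card G \<le> 2 * X"
    using w2 m n_pos by (simp add: n_def[symmetric] m_def[symmetric] field_simps)
  have HC: "H \<subseteq> C" by (auto simp: H_def)
  have HV: "f \<subseteq> V \<and> card f = 3" if "f \<in> H" for f using HC C that by (auto simp: triples_def)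
  have apH: "apexes H e = apexes C e" if "e \<in> G" for e using that by (auto simp: apexes_def H_def)
  have Dap: "D \<le> card (apexes H e) \<and> card (apexes H e) \<le> 2 * D" if "e \<in> G" for e
    using apH[OF that] that by (auto simp: G_def D_def)
  have big: "(128 * (real l)\<^sup>2) ^ l * w \<le> (real (card G) * w / (real (card V))\<^sup>2) ^ l"
  proof -
    have "(128 * (real l)\<^sup>2) ^ l \<le> \<Lambda> * m / n\<^sup>2" using key by (simp add: light_factor_def)
    also have "\<dots> = (n * X / m) ^ (l - 1) * (m / n\<^sup>2) ^ l"
    proof -
      obtain k where k: "l = Suc k" using l2 by (cases l) auto
      have "(n * X / m) ^ k * (m / n\<^sup>2) ^ Suc k = (n * X / m * (m / n\<^sup>2)) ^ k * (m / n\<^sup>2)"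
        by (simp add: power_mult_distrib power_divide mult_ac)
      also have "n * X / m * (m / n\<^sup>2) = X / n" using m n_pos by (simp add: power2_eq_square)
      finally show ?thesis by (simp only: k \<Lambda>_def diff_Suc_1 times_divide_eq_right)
    qed
    also have "\<dots> \<le> real w ^ (l - 1) * (m / n\<^sup>2) ^ l"
      using w1 n_pos X_pos m by (intro mult_right_mono power_mono) auto
    finally have "(128 * (real l)\<^sup>2) ^ l * w \<le> real w ^ (l - 1) * (m / n\<^sup>2) ^ l * w" by (intro mult_right_mono) auto
    also have "\<dots> = (m * w / n\<^sup>2) ^ l"
    proof -
      obtain k where k: "l = Suc k" using l2 by (cases l) auto
      show ?thesis unfolding k by (simp add: power_mult_distrib power_divide mult_ac)
    qed
    finally show ?thesis by (simp add: m_def n_def)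
  qed
  have many: "real (card V) ^ (2 * l) \<le> (w / card V * card G) ^ (2 * l - 1)"
  proof -
    have "X ^ (2 * l - 1) \<le> (w / card V * card G) ^ (2 * l - 1)" using wX1 X_pos by (intro power_mono) auto
    then show ?thesis using X_lower by (simp add: n_def)
  qed
  have cov: "\<exists>e\<in>G. e \<subseteq> f" if "f \<in> H" for f using that by (auto simp: H_def)
  obtain \<D> where \<D>: "finite \<D>" "card \<D> \<le> (card H + 1) ^ (2 * l * nat \<lceil>4 * (w / card V * card G)\<rceil>)"
    "\<And>I. I \<subseteq> H \<Longrightarrow> cycle_free (2 * l) I \<Longrightarrow>
      \<exists>D\<in>\<D>. I \<subseteq> D \<and> D \<subseteq> H \<and> real (card D) \<le> (1 - shrink (2 * l) (3 * 144 ^ (2 * l) * light_const l)) * card H"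
    using light_containers[OF finV HV GA Gne l2 cov Dl Dap w4 wn big many] by blast
  have "real (2 * l * nat \<lceil>4 * (w / card V * card G)\<rceil>) \<le> 18 * real l * X"
  proof -
    have "real (nat \<lceil>4 * (w / card V * card G)\<rceil>) \<le> 9 * X" using wX1 wX2 X_ge by linarith
    then have "2 * real l * real (nat \<lceil>4 * (w / card V * card G)\<rceil>) \<le> 2 * real l * (9 * X)" by (intro mult_left_mono) auto
    then show ?thesis by simp
  qed
  then have "real (card \<D>) \<le> exp (3 * L * (18 * real l * X))"
    using \<D>(2) family_power_le[of H _ "18 * real l * X"] HC C by (meson of_nat_mono order_trans)
  also have "3 * L * (18 * real l * X) = 54 * real l * X * L" by simp
  finally have cD: "real (card \<D>) \<le> exp (54 * real l * X * L)" .
  have "\<delta> / (72 * L) * card C \<le> \<delta> * card H"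
  proof -
    have "real (\<Sum>e\<in>G. card (apexes H e)) \<le> real (3 * card H)"
      using HC C GA finG by (intro of_nat_mono sum_codegree_le) auto
    then have "(\<Sum>e\<in>G. cod e) \<le> 3 * card H" using apH by (simp add: cod_def)
    then have "N / (12 * L) \<le> 3 * card H" using sG by linarith
    then have "N / (36 * L) \<le> card H" using L1 by (simp add: pos_divide_le_eq)
    moreover have "N / (72 * L) \<le> N / (36 * L)" using N0 L1 by (intro divide_left_mono) auto
    ultimately have "\<delta> * (N / (72 * L)) \<le> \<delta> * card H" using \<delta> by (intro mult_left_mono) auto
    then show ?thesis by (simp add: N_def)
  qed
  moreover have "\<exists>D\<in>\<D>. I \<subseteq> D \<and> D \<subseteq> H \<and> real (card D) \<le> (1 - \<delta>) * card H" if "I \<subseteq> H" "cycle_free (2 * l) I" for I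
  proof -
    have "(1 - shrink (2 * l) (3 * 144 ^ (2 * l) * light_const l)) * card H \<le> (1 - \<delta>) * card H" using \<delta> by (intro mult_right_mono) auto
    then show ?thesis using \<D>(3)[OF that] by (meson order_trans)
  qed
  ultimately show ?thesis by (intro extend_containers[OF C HC _ \<D>(1) cD]) auto
qed

end

lemma shrink_bounds: "1 \<le> B \<Longrightarrow> 0 < shrink s B \<and> shrink s B \<le> 1"
proof -
  assume B: "1 \<le> B"
  have "1 \<le> (1 + 2 ^ s :: real) ^ s" by (intro one_le_power) simp
  then have "1 * 1 \<le> (12 * B) * (1 + 2 ^ s) ^ s" using B by (intro mult_mono) auto
  then show ?thesis by (simp add: shrink_def)
qed

lemma step_rate_bounds: "0 < step_rate l" "step_rate l \<le> 1"
proof -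
  have 4: "1 \<le> (4::real) ^ l" by (intro one_le_power) simp
  then have "1 \<le> 64 * (4::real) ^ l" by linarith
  moreover have "1 \<le> 3 * 144 ^ (2 * l) * light_const l"
  proof -
    have "0 \<le> 16 ^ (2 * l) * (2 * (2 * real l) ^ (2 * l))" by simp
    then have "1 \<le> light_const l" unfolding light_const_def using 4 by linarith
    moreover have "1 \<le> 3 * (144::real) ^ (2 * l)" using one_le_power[of "144::real" "2 * l"] by linarith
    ultimately have "1 * 1 \<le> (3 * 144 ^ (2 * l)) * light_const l" by (intro mult_mono) auto
    then show ?thesis by simp
  qed
  ultimately show "0 < step_rate l" "step_rate l \<le> 1"
    unfolding step_rate_def using shrink_bounds by (auto simp: min_le_iff_disj)
qed

text \<open>Logarithm of the number of containers, in units of \<open>X * L\<^sup>2\<close>, per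
  fraction removed; the numbers are those of the light step.\<close>

definition step_cost :: "nat \<Rightarrow> real" where
  "step_cost l = 54 * 72 * real l / step_rate l"

text \<open>Both cases have the same exchange rate: a heavy step pays \<open>X * L\<^sup>2\<close>
  for a constant fraction, a light step \<open>X * L\<close> for a fraction of order
  \<open>1 / L\<close>.\<close>

lemma (in sparse_regime) container_step:
  assumes C: "C \<subseteq> triples V" and N: "N\<^sub>0 \<le> card C"
  shows "\<exists>(\<rho>::real) \<C>. 0 < \<rho> \<and> \<rho> \<le> 1 \<and> finite \<C> \<and> real (card \<C>) \<le> exp (step_cost l * X * L\<^sup>2 * \<rho>) \<and>
     (\<forall>I. I \<subseteq> C \<longrightarrow> cycle_free (2 * l) I \<longrightarrow>
       (\<exists>D\<in>\<C>. I \<subseteq> D \<and> D \<subseteq> C \<and> real (card D) \<le> (1 - \<rho>) * card C))"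
proof -
  define \<delta> where "\<delta> = step_rate l"
  define H where "H = {f \<in> C. \<forall>e\<in>pairs f. threshold C < card (apexes C e)}"
  define F where "F = {f \<in> C. \<exists>e\<in>pairs f. real (card (apexes C e)) \<le> threshold C}"
  have \<delta>: "0 < \<delta>" "\<delta> \<le> 1" using step_rate_bounds by (auto simp: \<delta>_def)
  have \<delta>h: "\<delta> \<le> shrink (2 * l) (64 * 4 ^ l)" and \<delta>l: "\<delta> \<le> shrink (2 * l) (3 * 144 ^ (2 * l) * light_const l)"
    by (auto simp: \<delta>_def step_rate_def)
  have finC: "finite C" by (rule card_family(1)[OF C])
  have "card C = card (H \<union> F)" by (rule arg_cong[of _ _ card]) (auto simp: H_def F_def not_less)
  also have "\<dots> = card H + card F" using finC by (intro card_Un_disjoint) (auto simp: H_def F_def)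
  finally have HF: "card C = card H + card F" .
  consider "card C \<le> 2 * card H" | "card C \<le> 2 * card F" using HF by linarith
  then show ?thesis
  proof cases
    case 1
    obtain \<C> where \<C>: "finite \<C>" "real (card \<C>) \<le> exp (30 * real l * X * L\<^sup>2)"
      "\<forall>I. I \<subseteq> C \<longrightarrow> cycle_free (2 * l) I \<longrightarrow>
        (\<exists>D\<in>\<C>. I \<subseteq> D \<and> D \<subseteq> C \<and> real (card D) \<le> (1 - \<delta> / 2) * card C)"
      using heavy_step[OF C N H_def 1 \<delta>(1) \<delta>h] by auto
    have "30 * real l * X * L\<^sup>2 \<le> 27 * 72 * real l * X * L\<^sup>2"
      using X_pos by (intro mult_right_mono) auto
    also have "\<dots> = step_cost l * X * L\<^sup>2 * (\<delta> / 2)" using \<delta> by (simp add: step_cost_def \<delta>_def)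
    finally have "real (card \<C>) \<le> exp (step_cost l * X * L\<^sup>2 * (\<delta> / 2))" using \<C>(2) by (meson exp_le_cancel_iff order_trans)
    then show ?thesis using \<C>(1,3) \<delta> by (intro exI[of _ "\<delta> / 2"] exI[of _ \<C>]) auto
  next
    case 2
    obtain \<C> where \<C>: "finite \<C>" "real (card \<C>) \<le> exp (54 * real l * X * L)"
      "\<forall>I. I \<subseteq> C \<longrightarrow> cycle_free (2 * l) I \<longrightarrow>
        (\<exists>D\<in>\<C>. I \<subseteq> D \<and> D \<subseteq> C \<and> real (card D) \<le> (1 - \<delta> / (72 * L)) * card C)"
      using light_step[OF C N 2[unfolded F_def] \<delta>(1) \<delta>l] by auto
    have "54 * real l * X * L = step_cost l * X * L\<^sup>2 * (\<delta> / (72 * L))"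
      using \<delta> L1 by (simp add: step_cost_def \<delta>_def power2_eq_square)
    then have "real (card \<C>) \<le> exp (step_cost l * X * L\<^sup>2 * (\<delta> / (72 * L)))" using \<C>(2) by simp
    moreover have "\<delta> / (72 * L) \<le> 1" "0 < \<delta> / (72 * L)" using \<delta> L1 by (auto simp: divide_le_eq)
    ultimately show ?thesis using \<C>(1,3) by (intro exI[of _ "\<delta> / (72 * L)"] exI[of _ \<C>]) auto
  qed
qed

section \<open>Iteration of the refinement\<close>

text \<open>Fractions removed one after the other satisfy
  \<open>ln (1 - \<rho>) \<le> - \<rho>\<close>, so all but the last of them sum to at most
  \<open>ln (card C / N\<^sub>0)\<close>. The summand 1 pays for the last step, which may fall far
  below \<open>N\<^sub>0\<close>.\<close>

lemma iterate_containers: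
  fixes X :: "'a set" and N\<^sub>0 E :: real
  assumes fin: "finite X" and N0: "N\<^sub>0 > 0" and E: "E \<ge> 0"
    and step: "\<And>C. C \<subseteq> X \<Longrightarrow> N\<^sub>0 \<le> card C \<Longrightarrow> \<exists>(\<rho>::real) \<C>. 0 < \<rho> \<and> \<rho> \<le> 1 \<and> finite \<C> \<and> real (card \<C>) \<le> exp (E * \<rho>) \<and>
     (\<forall>I. I \<subseteq> C \<longrightarrow> P I \<longrightarrow> (\<exists>D\<in>\<C>. I \<subseteq> D \<and> D \<subseteq> C \<and> real (card D) \<le> (1 - \<rho>) * card C))"
    and C: "C \<subseteq> X"
  shows "\<exists>\<C>. finite \<C> \<and>
     real (card \<C>) \<le> (if card C \<le> N\<^sub>0 then 1 else exp (E * (1 + ln (card C / N\<^sub>0)))) \<and>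
     (\<forall>I. I \<subseteq> C \<longrightarrow> P I \<longrightarrow> (\<exists>D\<in>\<C>. I \<subseteq> D \<and> D \<subseteq> C \<and> card D \<le> N\<^sub>0))"
  using C
proof (induction "card C" arbitrary: C rule: less_induct)
  case less
  show ?case
  proof (cases "card C \<le> N\<^sub>0")
    case True
    then show ?thesis by (intro exI[of _ "{C}"]) auto
  next
    case False
    then have "N\<^sub>0 \<le> card C" by simp
    from step[OF less.prems this]
    obtain \<rho> \<C> where \<C>: "0 < \<rho>" "\<rho> \<le> 1" "finite \<C>" "real (card \<C>) \<le> exp (E * \<rho>)"
      "\<forall>I. I \<subseteq> C \<longrightarrow> P I \<longrightarrow> (\<exists>D\<in>\<C>. I \<subseteq> D \<and> D \<subseteq> C \<and> real (card D) \<le> (1 - \<rho>) * card C)"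
      by blast
    define \<D> where "\<D> = {D \<in> \<C>. D \<subseteq> C \<and> real (card D) \<le> (1 - \<rho>) * card C}"
    define b where "b = exp (E * (1 + ln (card C / N\<^sub>0) - \<rho>))"
    have c0: "real (card C) > 0" using False N0 by linarith
    have lnpos: "ln (card C / N\<^sub>0) \<ge> 0" using False N0 by (simp add: le_divide_eq_1_pos)
    have IH: "\<exists>\<F>. finite \<F> \<and> real (card \<F>) \<le> b \<and> (\<forall>I. I \<subseteq> D \<longrightarrow> P I \<longrightarrow> (\<exists>F\<in>\<F>. I \<subseteq> F \<and> F \<subseteq> D \<and> card F \<le> N\<^sub>0))"
      if D: "D \<in> \<D>" for D
    proof -
      have Dle: "real (card D) \<le> (1 - \<rho>) * card C" and DC: "D \<subseteq> C" using D by (auto simp: \<D>_def)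
      have "(1 - \<rho>) * card C < card C" using c0 \<C>(1) by simp
      then have "card D < card C" using Dle by linarith
      then obtain \<F> where \<F>: "finite \<F>"
        "real (card \<F>) \<le> (if card D \<le> N\<^sub>0 then 1 else exp (E * (1 + ln (card D / N\<^sub>0))))"
        "\<forall>I. I \<subseteq> D \<longrightarrow> P I \<longrightarrow> (\<exists>F\<in>\<F>. I \<subseteq> F \<and> F \<subseteq> D \<and> card F \<le> N\<^sub>0)"
        using less.hyps[of D] DC less.prems by blast
      have "(if card D \<le> N\<^sub>0 then 1 else exp (E * (1 + ln (card D / N\<^sub>0)))) \<le> b"
      proof (cases "card D \<le> N\<^sub>0")
        case True
        have "0 \<le> E * (1 + ln (card C / N\<^sub>0) - \<rho>)" using E lnpos \<C>(2) by simp
        then show ?thesis using True by (simp add: b_def)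
      next
        case False
        then have d0: "real (card D) > 0" using N0 by linarith
        have "0 < (1 - \<rho>) * card C" using d0 Dle by linarith
        then have r: "1 - \<rho> > 0" using c0 by (simp add: zero_less_mult_iff)
        have "ln (card D / N\<^sub>0) \<le> ln ((1 - \<rho>) * (card C / N\<^sub>0))"
          using d0 N0 Dle r c0 by (subst ln_le_cancel_iff) (auto simp: divide_right_mono)
        also have "\<dots> = ln (1 - \<rho>) + ln (card C / N\<^sub>0)" using r c0 N0 by (intro ln_mult_pos) auto
        also have "ln (1 - \<rho>) \<le> - \<rho>" using ln_le_minus_one[OF r] by simp
        finally have "E * (1 + ln (card D / N\<^sub>0)) \<le> E * (1 + ln (card C / N\<^sub>0) - \<rho>)"
          using E by (intro mult_left_mono) auto
        then show ?thesis using False by (simp add: b_def)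
      qed
      then show ?thesis using \<F> by (intro exI[of _ \<F>]) auto
    qed
    define \<F> where "\<F> = (\<lambda>D. SOME \<F>. finite \<F> \<and> real (card \<F>) \<le> b \<and> (\<forall>I. I \<subseteq> D \<longrightarrow> P I \<longrightarrow> (\<exists>F\<in>\<F>. I \<subseteq> F \<and> F \<subseteq> D \<and> card F \<le> N\<^sub>0)))"
    have \<F>: "finite (\<F> D) \<and> real (card (\<F> D)) \<le> b \<and> (\<forall>I. I \<subseteq> D \<longrightarrow> P I \<longrightarrow> (\<exists>F\<in>\<F> D. I \<subseteq> F \<and> F \<subseteq> D \<and> card F \<le> N\<^sub>0))"
      if "D \<in> \<D>" for D unfolding \<F>_def by (rule someI_ex) (rule IH[OF that])
    have finD: "finite \<D>" using \<C>(3) by (simp add: \<D>_def)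
    define \<U> where "\<U> = (\<Union>D\<in>\<D>. \<F> D)"
    have "card \<U> \<le> (\<Sum>D\<in>\<D>. card (\<F> D))" unfolding \<U>_def by (rule card_UN_le[OF finD])
    then have "real (card \<U>) \<le> real (\<Sum>D\<in>\<D>. card (\<F> D))" by (rule of_nat_mono)
    then have "real (card \<U>) \<le> (\<Sum>D\<in>\<D>. real (card (\<F> D)))" by simp
    also have "\<dots> \<le> (\<Sum>D\<in>\<D>. b)" using \<F> by (intro sum_mono) auto
    also have "\<dots> = card \<D> * b" by simp
    also have "\<dots> \<le> exp (E * \<rho>) * b"
    proof (rule mult_right_mono)
      have "card \<D> \<le> card \<C>" using \<C>(3) by (intro card_mono) (auto simp: \<D>_def)
      then show "real (card \<D>) \<le> exp (E * \<rho>)" using \<C>(4) by linarith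
    qed (simp add: b_def)
    also have "\<dots> = exp (E * (1 + ln (card C / N\<^sub>0)))" by (simp add: b_def exp_add[symmetric] algebra_simps)
    finally have cU: "real (card \<U>) \<le> exp (E * (1 + ln (card C / N\<^sub>0)))" .
    have "\<exists>F\<in>\<U>. I \<subseteq> F \<and> F \<subseteq> C \<and> card F \<le> N\<^sub>0" if I: "I \<subseteq> C" "P I" for I
    proof -
      obtain D where D: "D \<in> \<C>" "I \<subseteq> D" "D \<subseteq> C" "real (card D) \<le> (1 - \<rho>) * card C" using \<C>(5) I by blast
      then have "D \<in> \<D>" by (simp add: \<D>_def)
      then obtain F where "F \<in> \<F> D" "I \<subseteq> F" "F \<subseteq> D" "card F \<le> N\<^sub>0" using \<F> I D by blast
      then show ?thesis using \<open>D \<in> \<D>\<close> D unfolding \<U>_def by blast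
    qed
    moreover have "finite \<U>" using finD \<F> by (auto simp: \<U>_def)
    ultimately show ?thesis using cU False by (intro exI[of _ \<U>]) auto
  qed
qed

theorem (in sparse_regime) cycle_free_containers:
  obtains \<C> where "finite \<C>" "real (card \<C>) \<le> exp (4 * step_cost l * X * L ^ 3)"
    "\<And>D. D \<in> \<C> \<Longrightarrow> D \<subseteq> triples V \<and> card D \<le> N\<^sub>0"
    "\<And>I. I \<subseteq> triples V \<Longrightarrow> cycle_free (2 * l) I \<Longrightarrow> \<exists>D\<in>\<C>. I \<subseteq> D"
proof -
  define T where "T = triples V"
  define E where "E = step_cost l * X * L\<^sup>2"
  have sc: "0 \<le> step_cost l" using step_rate_bounds[of l] by (simp add: step_cost_def)
  have E: "E \<ge> 0" using sc X_pos by (simp add: E_def)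
  have finT: "finite T" unfolding T_def by (rule card_family(1)) simp
  obtain \<C> where \<C>: "finite \<C>"
    "real (card \<C>) \<le> (if card T \<le> N\<^sub>0 then 1 else exp (E * (1 + ln (card T / N\<^sub>0))))"
    "\<forall>I. I \<subseteq> T \<longrightarrow> cycle_free (2 * l) I \<longrightarrow> (\<exists>D\<in>\<C>. I \<subseteq> D \<and> D \<subseteq> T \<and> card D \<le> N\<^sub>0)"
    using iterate_containers[OF finT N0_pos E _ order_refl, of "cycle_free (2 * l)"] container_step
    unfolding T_def E_def by blast
  have "(if card T \<le> N\<^sub>0 then 1 else exp (E * (1 + ln (card T / N\<^sub>0)))) \<le> exp (4 * step_cost l * X * L ^ 3)"
  proof (cases "card T \<le> N\<^sub>0")
    case True
    have "0 \<le> 4 * step_cost l * X * L ^ 3" using sc X_pos L1 by simp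
    then show ?thesis using True by simp
  next
    case False
    then have T0: "real (card T) > 0" using N0_pos by linarith
    have "1 \<le> N\<^sub>0" using XL X_ge L1 mult_mono[of 1 X 1 L] by simp
    then have "card T / N\<^sub>0 \<le> card T" using T0 by (simp add: divide_le_eq mult_le_cancel_left1)
    also have "\<dots> \<le> n ^ 3" using card_family(2)[of T] by (simp add: T_def)
    finally have "ln (card T / N\<^sub>0) \<le> ln (n ^ 3)" using T0 N0_pos n_pos by (subst ln_le_cancel_iff) auto
    also have "\<dots> = 3 * L" using n_pos by (simp add: ln_realpow L_def)
    finally have "1 + ln (card T / N\<^sub>0) \<le> 4 * L" using L1 by linarith
    then have "E * (1 + ln (card T / N\<^sub>0)) \<le> E * (4 * L)" using E by (intro mult_left_mono) auto
    also have "\<dots> = 4 * step_cost l * X * L ^ 3" by (simp add: E_def power2_eq_square power3_eq_cube)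
    finally show ?thesis using False by simp
  qed
  then have c: "real (card \<C>) \<le> exp (4 * step_cost l * X * L ^ 3)" using \<C>(2) by linarith
  define \<D> where "\<D> = {D \<in> \<C>. D \<subseteq> T \<and> card D \<le> N\<^sub>0}"
  have "card \<D> \<le> card \<C>" using \<C>(1) by (intro card_mono) (auto simp: \<D>_def)
  then show ?thesis using \<C> c by (intro that[of \<D>]) (auto simp: \<D>_def T_def)
qed

section \<open>Random hypergraphs\<close>

text \<open>In the numbering of \<open>linear_cycle\<close>, even residues are the shared vertices
  and odd residues the private ones.\<close>

lemma copy_of_linear_cycle:
  assumes T: "T \<in> linear_cycles k" "T \<subseteq> G" and k: "2 \<le> k"
  shows "contains_copy G (linear_cycle 3 k)"
proof -
  obtain xs zs where xz: "T = linear_edges xs zs" "length xs = k" "length zs = k" "distinct (xs @ zs)"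
    using T by (auto simp: linear_cycles_def)
  define f where "f = (\<lambda>v. if even v then xs ! (v div 2) else zs ! (v div 2))"
  have edge: "(\<lambda>j. j mod (k * (3 - 1))) ` {(i - 1) * (3 - 1)..i * (3 - 1)} = {2 * (i - 1), 2 * (i - 1) + 1, 2 * (i mod k)}"
    if i: "i \<in> {1..k}" for i
  proof -
    obtain a where a: "i = Suc a" "a < k" using i by (cases i) auto
    have "{(i - 1) * (3 - 1)..i * (3 - 1)} = {2 * a, 2 * a + 1, 2 * a + 2}" using a by auto
    moreover have "2 * a mod (k * 2) = 2 * a" "(2 * a + 1) mod (k * 2) = 2 * a + 1" using a by auto
    moreover have "(2 * a + 2) mod (k * 2) = 2 * (i mod k)" using a by (simp add: mult_mod_right mult.commute)
    ultimately show ?thesis using a by simp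
  qed
  have lt: "v < 2 * k" if "v \<in> \<Union>(linear_cycle 3 k)" for v
  proof -
    obtain i where "i \<in> {1..k}" "v \<in> (\<lambda>j. j mod (k * (3 - 1))) ` {(i - 1) * (3 - 1)..i * (3 - 1)}"
      using \<open>v \<in> \<Union>(linear_cycle 3 k)\<close> unfolding linear_cycle_def by blast
    then obtain x where "v = x mod (k * 2)" by auto
    then show ?thesis using k mod_less_divisor[of "k * 2" x] by (simp add: mult.commute)
  qed
  have "inj_on f {..<2 * k}"
  proof (rule inj_onI)
    fix v w assume vw: "v \<in> {..<2 * k}" "w \<in> {..<2 * k}" "f v = f w"
    have d: "v div 2 < k" "w div 2 < k" using vw by auto
    have dx: "distinct xs" "distinct zs" "set xs \<inter> set zs = {}" using xz by auto
    have x: "xs ! a \<noteq> zs ! b" if "a < k" "b < k" for a b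
      using dx(3) that xz(2,3) by (metis disjoint_iff nth_mem)
    have "even v = even w \<and> v div 2 = w div 2"
      using vw(3) x[OF d] x[OF d(2,1)] dx d xz(2,3)
      by (auto simp: f_def nth_eq_iff_index_eq split: if_splits)
    then show "v = w" by (metis even_two_times_div_two odd_two_times_div_two_succ)
  qed
  then have "inj_on f (\<Union>(linear_cycle 3 k))" by (rule inj_on_subset) (use lt in auto)
  moreover have "f ` e \<in> G" if e: "e \<in> linear_cycle 3 k" for e
  proof -
    obtain i where i: "i \<in> {1..k}" "e = {2 * (i - 1), 2 * (i - 1) + 1, 2 * (i mod k)}"
      using e edge unfolding linear_cycle_def by blast
    then obtain a where a: "i = Suc a" "a < k" by (cases i) auto
    have "f ` e = {xs ! a, xs ! (Suc a mod k), zs ! a}" using i a by (simp add: f_def insert_commute)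
    then have "f ` e \<in> T" using a xz by (auto simp: linear_edges_def)
    then show ?thesis using T by auto
  qed
  ultimately show ?thesis unfolding contains_copy_def by blast
qed

lemma ex_in_le:
  assumes H: "finite H" and k: "2 \<le> k"
    and b: "\<And>G. G \<subseteq> H \<Longrightarrow> cycle_free k G \<Longrightarrow> real (card G) \<le> b"
  shows "real (ex_in H (linear_cycle 3 k)) \<le> b"
proof -
  define S where "S = {card G | G. G \<subseteq> H \<and> \<not> contains_copy G (linear_cycle 3 k)}"
  have "finite S" unfolding S_def using H by simp
  moreover have "linear_cycle 3 k \<noteq> {}" using k by (auto simp: linear_cycle_def)
  then have "\<not> contains_copy {} (linear_cycle 3 k)" by (auto simp: contains_copy_def)
  then have "S \<noteq> {}" unfolding S_def by blast
  ultimately have "Max S \<in> S" by (rule Max_in)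
  then obtain G where G: "Max S = card G" "G \<subseteq> H" "\<not> contains_copy G (linear_cycle 3 k)"
    by (auto simp: S_def)
  then have "cycle_free k G" using copy_of_linear_cycle[OF _ _ k] unfolding cycle_free_def by blast
  then show ?thesis using b[OF G(2)] G(1) unfolding ex_in_def S_def by simp
qed

lemma complete_hypergraph_triples: "complete_hypergraph 3 n = triples {1..n}"
  by (simp add: complete_hypergraph_def triples_def)

lemma finite_complete_hypergraph: "finite (complete_hypergraph r n)"
  unfolding complete_hypergraph_def by (rule finite_subset[of _ "Pow {1..n}"]) auto

text \<open>Markov's inequality for the exponential moment with parameter 1; the factor 2 comes from
  \<open>exp 1 - 1 \<le> 2\<close>.\<close>

lemma random_subset_tail:
  assumes fin: "finite A" and D: "D \<subseteq> A" and p: "0 \<le> p" "p \<le> 1"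
  shows "measure_pmf.prob (Pi_pmf A False (\<lambda>_. bernoulli_pmf p)) {b. x < real (card {e \<in> D. b e})}
     \<le> exp (2 * p * card D - x)"
proof -
  define Q where "Q = Pi_pmf A False (\<lambda>_. bernoulli_pmf p)"
  define f where "f = (\<lambda>e v. if e \<in> D \<and> v then exp (1::real) else 1)"
  have finQ: "finite (set_pmf Q)" unfolding Q_def
    by (rule finite_subset[OF set_Pi_pmf_subset'[OF fin]]) (auto intro!: finite_PiE_dflt fin)
  have prodf: "(\<Prod>e\<in>A. f e (b e)) = exp (card {e \<in> D. b e})" for b
  proof -
    have "(\<Prod>e\<in>A. f e (b e)) = (\<Prod>e\<in>{e \<in> D. b e}. exp 1)"
      unfolding f_def using fin D by (intro prod.mono_neutral_cong_right) auto
    also have "\<dots> = exp (card {e \<in> D. b e})" by (simp add: exp_of_nat_mult[symmetric])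
    finally show ?thesis .
  qed
  have e3: "exp (1::real) \<le> 3" by (rule exp_le)
  have ev: "measure_pmf.expectation (bernoulli_pmf p) (f e) = (if e \<in> D then 1 + p * (exp 1 - 1) else 1)" for e
    using p by (simp add: f_def algebra_simps)
  have "measure_pmf.expectation Q (\<lambda>b. \<Prod>e\<in>A. f e (b e)) = (\<Prod>e\<in>A. measure_pmf.expectation (bernoulli_pmf p) (f e))"
    unfolding Q_def
    by (rule expectation_prod_Pi_pmf[OF fin]) (auto simp: f_def intro!: integrable_measure_pmf_finite)
  also have "\<dots> = (\<Prod>e\<in>D. 1 + p * (exp 1 - 1))"
    unfolding ev using fin D by (intro prod.mono_neutral_cong_right) auto
  also have "\<dots> \<le> (\<Prod>e\<in>D. exp (2 * p))"
  proof (rule prod_mono)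
    fix e
    have "p * (exp 1 - 1) \<le> p * 2" using p e3 by (intro mult_left_mono) auto
    then have "1 + p * (exp 1 - 1) \<le> 1 + 2 * p" by simp
    also have "\<dots> \<le> exp (2 * p)" by (rule exp_ge_add_one_self)
    finally show "0 \<le> 1 + p * (exp 1 - 1) \<and> 1 + p * (exp 1 - 1) \<le> exp (2 * p)" using p by simp
  qed
  also have "\<dots> = exp (2 * p * card D)" by (simp add: exp_of_nat_mult[symmetric] mult_ac)
  finally have E: "measure_pmf.expectation Q (\<lambda>b. exp (card {e \<in> D. b e})) \<le> exp (2 * p * card D)"
    unfolding prodf .
  have "measure_pmf.prob Q {b. x < real (card {e \<in> D. b e})}
     = measure_pmf.expectation Q (indicator {b. x < real (card {e \<in> D. b e})})" by simp
  also have "\<dots> \<le> measure_pmf.expectation Q (\<lambda>b. exp (- x) * exp (card {e \<in> D. b e}))"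
  proof (rule integral_mono)
    show "indicator {b. x < real (card {e \<in> D. b e})} b \<le> exp (- x) * exp (card {e \<in> D. b e})" for b
      by (auto simp: indicator_def exp_add[symmetric])
  qed (auto intro!: integrable_measure_pmf_finite finQ)
  also have "\<dots> = exp (- x) * measure_pmf.expectation Q (\<lambda>b. exp (card {e \<in> D. b e}))" by simp
  also have "\<dots> \<le> exp (- x) * exp (2 * p * card D)" using E by (intro mult_left_mono) auto
  also have "\<dots> = exp (2 * p * card D - x)" by (simp add: exp_add[symmetric])
  finally show ?thesis by (simp add: Q_def)
qed

text \<open>A cycle-free subgraph of the random hypergraph lies in the intersection of the latter
  with some container, so a union bound over containers suffices. The \<open>+ 1\<close> leaves a
  margin \<open>X * L ^ 3\<close>, which is at least \<open>n\<close>, for the failure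
  probability.\<close>

lemma random_turan_bound:
  fixes m l :: nat and n X N\<^sub>0 L p b :: real
  assumes regime: "sparse_regime {1..m} l n X N\<^sub>0 L" and p: "0 \<le> p" "p \<le> 1"
    and b: "2 * p * N\<^sub>0 + (4 * step_cost l + 1) * (X * L ^ 3) \<le> b"
  shows "1 - exp (- n) \<le> measure_pmf.prob (random_hypergraph 3 m p) {H. real (ex_in H (linear_cycle 3 (2 * l))) \<le> b}"
proof -
  interpret sparse_regime "{1..m}" l n X N\<^sub>0 L by (rule regime)
  define V where "V = {1..m}"
  define A where "A = complete_hypergraph 3 m"
  define Q where "Q = Pi_pmf A False (\<lambda>_. bernoulli_pmf p)"
  have finA: "finite A" unfolding A_def by (rule finite_complete_hypergraph)
  have AV: "A = triples V" by (simp add: A_def V_def complete_hypergraph_triples)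
  obtain \<C> where \<C>: "finite \<C>" "real (card \<C>) \<le> exp (4 * step_cost l * X * L ^ 3)"
    "\<And>D. D \<in> \<C> \<Longrightarrow> D \<subseteq> triples V \<and> card D \<le> N\<^sub>0"
    "\<And>I. I \<subseteq> triples V \<Longrightarrow> cycle_free (2 * l) I \<Longrightarrow> \<exists>D\<in>\<C>. I \<subseteq> D"
    using cycle_free_containers unfolding V_def by blast
  define bad where "bad = (\<lambda>D :: nat set set. {\<omega>. b < real (card {e \<in> D. \<omega> e})})"
  define good where "good = {\<omega>. real (ex_in {e \<in> A. \<omega> e} (linear_cycle 3 (2 * l))) \<le> b}"
  have sub: "- good \<subseteq> (\<Union>D\<in>\<C>. bad D)"
  proof (rule subsetI, rule ccontr)
    fix \<omega> assume \<omega>: "\<omega> \<in> - good" "\<omega> \<notin> (\<Union>D\<in>\<C>. bad D)"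
    have "real (ex_in {e \<in> A. \<omega> e} (linear_cycle 3 (2 * l))) \<le> b"
    proof (rule ex_in_le)
      show "finite {e \<in> A. \<omega> e}" using finA by simp
      show "2 \<le> 2 * l" using l2 by simp
      fix G assume G: "G \<subseteq> {e \<in> A. \<omega> e}" "cycle_free (2 * l) G"
      then have "G \<subseteq> triples V" using AV by blast
      then obtain D where D: "D \<in> \<C>" "G \<subseteq> D" using \<C>(4) G(2) by blast
      have "finite D" using \<C>(3)[OF D(1)] finA AV finite_subset by auto
      then have "card G \<le> card {e \<in> D. \<omega> e}" using D G by (intro card_mono) auto
      moreover have "real (card {e \<in> D. \<omega> e}) \<le> b" using \<omega>(2) D(1) by (auto simp: bad_def)
      ultimately show "real (card G) \<le> b" by linarith
    qed
    then show False using \<omega>(1) by (simp add: good_def)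
  qed
  have "measure_pmf.prob Q (- good) \<le> measure_pmf.prob Q (\<Union>D\<in>\<C>. bad D)"
    by (intro measure_pmf.finite_measure_mono sub) auto
  also have "\<dots> \<le> (\<Sum>D\<in>\<C>. measure_pmf.prob Q (bad D))"
    by (intro measure_pmf.finite_measure_subadditive_finite \<C>(1)) auto
  also have "\<dots> \<le> (\<Sum>D\<in>\<C>. exp (2 * p * N\<^sub>0 - b))"
  proof (rule sum_mono)
    fix D assume D: "D \<in> \<C>"
    have "measure_pmf.prob Q (bad D) \<le> exp (2 * p * card D - b)"
      unfolding Q_def bad_def using \<C>(3)[OF D] AV by (intro random_subset_tail finA p) auto
    also have "\<dots> \<le> exp (2 * p * N\<^sub>0 - b)" using \<C>(3)[OF D] p by (simp add: mult_left_mono)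
    finally show "measure_pmf.prob Q (bad D) \<le> exp (2 * p * N\<^sub>0 - b)" .
  qed
  also have "\<dots> = card \<C> * exp (2 * p * N\<^sub>0 - b)" by simp
  also have "\<dots> \<le> exp (4 * step_cost l * X * L ^ 3) * exp (2 * p * N\<^sub>0 - b)"
    using \<C>(2) by (intro mult_right_mono) auto
  also have "\<dots> = exp (4 * step_cost l * X * L ^ 3 + (2 * p * N\<^sub>0 - b))" by (simp add: exp_add)
  also have "\<dots> \<le> exp (- n)"
  proof -
    have "1 \<le> L ^ 3" using L1 by (rule one_le_power)
    then have "X * 1 \<le> X * L ^ 3" using X_pos by (intro mult_left_mono) auto
    then have "n \<le> X * L ^ 3" using X_large n_pos by linarith
    then show ?thesis using b by (simp add: algebra_simps)
  qed
  finally have "measure_pmf.prob Q (- good) \<le> exp (- n)" .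
  moreover have "measure_pmf.prob Q (- good) = 1 - measure_pmf.prob Q good"
    using measure_pmf.prob_compl[of good Q] by (simp add: Compl_eq_Diff_UNIV)
  moreover have "measure_pmf.prob (random_hypergraph 3 m p) {H. real (ex_in H (linear_cycle 3 (2 * l))) \<le> b} = measure_pmf.prob Q good"
    unfolding random_hypergraph_def A_def[symmetric] Q_def[symmetric] measure_map_pmf good_def by (simp add: vimage_def)
  ultimately show ?thesis by simp
qed

section \<open>Verification of the regime for the given densities\<close>

lemma eventually_log_log:
  fixes \<alpha> \<beta> \<gamma> :: real
  assumes "\<alpha> > 0"
  shows "\<forall>\<^sub>F n::nat in sequentially. \<beta> * ln (ln (real n)) + \<gamma> \<le> \<alpha> * ln (real n)"
proof -
  have "((\<lambda>x::real. \<beta> * (ln x / x) + \<gamma> * (1 / x)) \<longlongrightarrow> \<beta> * 0 + \<gamma> * 0) at_top"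
    by (intro tendsto_intros ln_x_over_x_tendsto_0 tendsto_divide_0[OF tendsto_const] filterlim_at_top_imp_at_infinity filterlim_ident)
  then have "\<forall>\<^sub>F x::real in at_top. \<beta> * (ln x / x) + \<gamma> * (1 / x) < \<alpha>"
    using assms by (intro order_tendstoD(2)) auto
  then have "\<forall>\<^sub>F x::real in at_top. \<beta> * ln x + \<gamma> \<le> \<alpha> * x"
    using eventually_gt_at_top[of 0]
  proof eventually_elim
    case (elim x)
    have "\<beta> * ln x + \<gamma> = (\<beta> * (ln x / x) + \<gamma> * (1 / x)) * x" using elim by (simp add: field_simps)
    also have "\<dots> \<le> \<alpha> * x" using elim by (intro mult_right_mono) auto
    finally show ?case .
  qed
  moreover have "filterlim (\<lambda>n::nat. ln (real n)) at_top sequentially"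
    by (rule filterlim_compose[OF ln_at_top filterlim_real_sequentially])
  ultimately show ?thesis by (rule eventually_compose_filterlim)
qed

text \<open>The first summand serves \<open>N0_lower\<close>, the second the constant in
  \<open>heavy\<close>.\<close>

definition density_const :: "nat \<Rightarrow> real" where
  "density_const l = 128 * real l + (3072 * real l * light_factor l) ^ (4 * l - 3)"

text \<open>The formula for \<open>X\<close> solves \<open>heavy\<close> with equality when
  constants are dropped and \<open>N\<^sub>0\<close> is \<open>L ^ 3 * X / P\<close>. The bound
  \<open>p0 \<le> P\<close> gives the lower bounds on \<open>X\<close>, and
  \<open>P \<le> p1\<close> gives the lower bound on \<open>N\<^sub>0\<close>.\<close>

lemma sparse_regime_of_density:
  fixes m l :: nat and P c :: real
  assumes l: "2 \<le> l" and c: "1 \<le> c" and P: "0 < P" "P \<le> 1" "p0 c l m \<le> P" "P \<le> p1 l m"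
    and L1: "1 \<le> ln (real m)" and big1: "ln 4 \<le> ln (real m) / (2 * real l - 1)"
    and big2: "ln (1536 * real l * light_factor l) + ln (ln (real m)) \<le> ln (real m) / (2 * real l - 1)"
  defines "a \<equiv> 2 * (real l - 1) / (real l * (4 * real l - 3))"
  defines "X \<equiv> P powr a * real m powr (1 + 1 / real l) * ln (real m) powr (- 2 * a)"
  shows "sparse_regime {1..m} l (real m) X (density_const l * (ln (real m) ^ 3 * X / P)) (ln (real m))"
    and "P = p1 l m \<Longrightarrow> ln (real m) ^ 3 * X / P = (real m)\<^sup>2" and "X > 0"
proof -
  define r where "r = real l"
  define L where "L = ln (real m)"
  \<comment> \<open>In the logarithms \<open>x\<close>, \<open>y\<close>, \<open>z\<close> of \<open>P\<close>, \<open>L\<close>, \<open>X\<close> all conditions become linear.\<close>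
  define x where "x = ln P"
  define y where "y = ln L"
  define z where "z = a * x + (1 + 1 / r) * L - 2 * a * y"
  define q where "q = 4 * r\<^sup>2 - 5 * r + 2"
  define \<mu> where "\<mu> = 1 / (2 * r - 1)"
  define T where "T = L ^ 3 * X / P"
  define K where "K = density_const l"
  have r: "2 \<le> r" using l by (simp add: r_def)
  have L: "1 \<le> L" using L1 by (simp add: L_def)
  then have m: "real m > 0" unfolding L_def by (cases "m = 0") auto
  have y0: "0 \<le> y" using L by (simp add: y_def)
  have x0: "x \<le> 0" using P by (simp add: x_def)
  have "0 < r * (4 * r - 5) + 2" using r by (intro add_pos_pos mult_pos_pos) auto
  then have q: "q > 0" by (simp add: q_def power2_eq_square algebra_simps)
  have a: "a = 2 * (r - 1) / (r * (4 * r - 3))" by (simp add: a_def r_def)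
  have den: "r \<noteq> 0" "4 * r - 3 \<noteq> 0" "2 * r - 1 \<noteq> 0" "4 * r - 2 \<noteq> 0" "2 * r - 2 \<noteq> 0" "q \<noteq> 0" using r q by auto
  have a0: "0 \<le> a" unfolding a using r by simp
  have a1: "1 - a = q / (r * (4 * r - 3))" unfolding a q_def using den by (simp add: field_simps power2_eq_square)
  have aa: "a * (r * (4 * r - 3)) = 2 * (r - 1)" unfolding a using den by simp
  have expP: "P = exp x" using P by (simp add: x_def)
  have expm: "real m = exp L" using m by (simp add: L_def)
  have expL: "L = exp y" using L by (simp add: y_def)
  have X: "X = exp z"
    unfolding X_def powr_def z_def using P m L
    by (simp add: x_def y_def L_def[symmetric] r_def[symmetric] exp_add[symmetric] exp_diff algebra_simps)
  have T: "T = exp (3 * y + z - x)"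
  proof -
    have "L ^ 3 = exp (3 * y)" using expL by (simp add: exp_of_nat_mult[symmetric])
    then show ?thesis unfolding T_def X expP by (simp add: exp_add exp_diff)
  qed
  have x_lower: "x \<ge> - ((4 * r - 3) / (4 * r - 2)) * L + (4 * r\<^sup>2 + r - 4) / (2 * r - 2) * y"
  proof -
    have "p0 1 l m \<le> p0 c l m" unfolding p0_def using c by (intro mult_right_mono) auto
    then have "p0 1 l m \<le> P" using P by linarith
    moreover have "p0 1 l m = exp (- ((4 * r - 3) / (4 * r - 2)) * L + (4 * r\<^sup>2 + r - 4) / (2 * r - 2) * y)"
      unfolding p0_def powr_def exp_add using m L by (simp add: r_def[symmetric] L_def[symmetric] y_def[symmetric])
    ultimately show ?thesis unfolding expP by simp
  qed
  have p1: "p1 l m = exp (- ((r - 1) * (4 * r - 3) / q) * L + (3 + (2 * r - 2) / q) * y)"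
    unfolding p1_def powr_def exp_add using m L
    by (simp add: r_def[symmetric] L_def[symmetric] y_def[symmetric] q_def[symmetric])
  have x_upper: "x \<le> - ((r - 1) * (4 * r - 3) / q) * L + (3 + (2 * r - 2) / q) * y"
    using P(4) unfolding p1 expP by simp
  \<comment> \<open>At \<open>P = p0 1 l m\<close> this is an equality. The first term yields
    \<open>X_lower\<close>; the additional \<open>y\<close> supplies the factor \<open>L\<close> in
    \<open>gap\<close>.\<close>
  have z_lower: "(1 + \<mu>) * L + y \<le> z"
  proof -
    have le: "a * (- ((4 * r - 3) / (4 * r - 2)) * L + (4 * r\<^sup>2 + r - 4) / (2 * r - 2) * y) \<le> a * x"
      by (rule mult_left_mono[OF x_lower a0])
    have f1: "a * ((4 * r - 3) / (4 * r - 2)) = 1 / r - \<mu>"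
    proof -
      have "2 * (r - 1) / (r * u) * (u / (2 * v)) = 1 / r - 1 / v" if "u \<noteq> 0" "v \<noteq> 0" "r - 1 = v - r" for u v :: real
      proof -
        have "2 * g / (r * u) * (u / (2 * v)) = g / (r * v)" for g using that(1) by simp
        from this[of "r - 1"] show ?thesis unfolding that(3) using that(1,2) den(1) by (simp add: diff_divide_distrib)
      qed
      note eq = this[OF den(2,3)]
      have "2 * (2 * r - 1) = 4 * r - 2" by simp
      then show ?thesis using eq unfolding a \<mu>_def by simp
    qed
    have f2: "a * ((4 * r\<^sup>2 + r - 4) / (2 * r - 2)) = 1 + 2 * a"
    proof -
      have e1: "2 * (r - 1) / w * (h / (2 * (r - 1))) = h / w" for w h :: real using r by simp
      have e2: "1 + 2 * (2 * (r - 1) / w) = (w + 4 * (r - 1)) / w" if "w \<noteq> 0" for w :: real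
        using that by (simp add: field_simps)
      have e3: "4 * r\<^sup>2 + r - 4 = r * (4 * r - 3) + 4 * (r - 1)" by (simp add: power2_eq_square algebra_simps)
      have e4: "2 * r - 2 = 2 * (r - 1)" by simp
      show ?thesis unfolding a e3 e4 e1 by (rule e2[symmetric]) (use den in simp)
    qed
    have "a * (- d * L + h * y) = - (a * d) * L + (a * h) * y" for d h :: real by (simp add: algebra_simps)
    then have "a * (- ((4 * r - 3) / (4 * r - 2)) * L + (4 * r\<^sup>2 + r - 4) / (2 * r - 2) * y) = - (1 / r - \<mu>) * L + (1 + 2 * a) * y"
      unfolding f1[symmetric] f2[symmetric] by blast
    with le have "- (1 / r - \<mu>) * L + (1 + 2 * a) * y \<le> a * x" by simp
    then show ?thesis unfolding z_def by (simp add: algebra_simps)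
  qed
  have z_upper: "z \<le> (1 + 1 / r) * L"
    unfolding z_def using mult_nonneg_nonpos[OF a0 x0] mult_nonneg_nonneg[OF a0 y0] by linarith
  \<comment> \<open>\<open>A1\<close> and \<open>B1\<close> say that the two exponents of
    \<open>p1\<close> are those for which \<open>T\<close> equals the square of
    \<open>m\<close>.\<close>
  have A1: "(1 - a) * ((r - 1) * (4 * r - 3) / q) = 1 - 1 / r"
  proof -
    have "q / (r * u) * ((r - 1) * u / q) = 1 - 1 / r" if "u \<noteq> 0" for u
      using that den by (simp add: diff_divide_distrib)
    then show ?thesis unfolding a1 using den(2) by blast
  qed
  have B1: "(1 - a) * (3 + (2 * r - 2) / q) = 3 - 2 * a"
  proof -
    have "(1 - a) * (3 + (2 * r - 2) / q) = 3 * (1 - a) + (1 - a) * ((2 * r - 2) / q)" by (simp add: algebra_simps)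
    also have "(1 - a) * ((2 * r - 2) / q) = (2 * r - 2) / (r * (4 * r - 3))" unfolding a1 using den by simp
    also have "\<dots> = a" unfolding a by (rule arg_cong[of _ _ "\<lambda>t. t / _"]) simp
    finally show ?thesis by simp
  qed
  have logT: "3 * y + z - x = (1 - a) * (- x) + (1 + 1 / r) * L + (3 - 2 * a) * y"
    unfolding z_def by (simp add: algebra_simps)
  have eqT: "(1 - a) * (- (- ((r - 1) * (4 * r - 3) / q) * L + (3 + (2 * r - 2) / q) * y)) = (1 - 1 / r) * L - (3 - 2 * a) * y"
    unfolding A1[symmetric] B1[symmetric] by (simp add: algebra_simps)
  have a_lt: "0 \<le> 1 - a" unfolding a1 using q r by simp
  have T_lower: "2 * L \<le> 3 * y + z - x"
  proof -
    have "(1 - a) * (- (- ((r - 1) * (4 * r - 3) / q) * L + (3 + (2 * r - 2) / q) * y)) \<le> (1 - a) * (- x)"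
      using x_upper a_lt by (intro mult_left_mono) auto
    then show ?thesis unfolding logT eqT by (simp add: algebra_simps)
  qed
  have m2: "(real m)\<^sup>2 = exp (2 * L)" unfolding expm by (simp add: exp_of_nat_mult[symmetric])
  show "P = p1 l m \<Longrightarrow> ln (real m) ^ 3 * X / P = (real m)\<^sup>2"
  proof -
    assume "P = p1 l m"
    then have "x = - ((r - 1) * (4 * r - 3) / q) * L + (3 + (2 * r - 2) / q) * y" unfolding p1 expP by simp
    then have "(1 - a) * (- x) = (1 - 1 / r) * L - (3 - 2 * a) * y" using eqT by (simp only:)
    then have "3 * y + z - x = 2 * L" unfolding logT by (simp add: distrib_right left_diff_distrib)
    then show ?thesis using T m2 by (simp add: T_def L_def)
  qed
  show X0: "X > 0" by (simp add: X)
  note lf = light_factor_ge[OF l]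
  define G where "G = 1536 * real l * light_factor l"
  define k where "k = (3072 * real l * light_factor l) ^ (4 * l - 3)"
  have G: "G > 0" using l lf by (simp add: G_def)
  have k0: "0 \<le> k" using lf by (simp add: k_def)
  have K: "128 * real l \<le> K" "k \<le> K" "1 \<le> K" using l k0 by (auto simp: K_def density_const_def k_def)
  have Tm: "(real m)\<^sup>2 \<le> T" unfolding m2 T using T_lower by simp
  have nat1: "real (2 * l - 1) = 2 * r - 1" "real (l - 1) = r - 1" "real (2 * l - 2) = 2 * r - 2" "real (4 * l - 3) = 4 * r - 3"
    using l by (auto simp: r_def of_nat_diff)
  have "sparse_regime {1..m} l (real m) X (K * T) L"
  proof
    show "finite {1..m}" "real m = real (card {1..m})" "L = ln (real m)" "1 \<le> L" "2 \<le> l"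
      using L l by (auto simp: L_def)
    show "4 * real m \<le> X"
    proof -
      have "4 * real m = exp (ln 4 + L)" unfolding expm by (simp add: exp_add)
      also have "\<dots> \<le> X" unfolding X using z_lower big1 y0 by (simp add: \<mu>_def L_def r_def algebra_simps)
      finally show ?thesis .
    qed
    show "real m ^ (2 * l) \<le> X ^ (2 * l - 1)"
    proof -
      have "2 * r * L = (2 * r - 1) * ((1 + \<mu>) * L)" unfolding \<mu>_def using den by (simp add: field_simps)
      also have "\<dots> \<le> (2 * r - 1) * z" using z_lower y0 r by (intro mult_left_mono) auto
      finally have "exp (2 * r * L) \<le> exp ((2 * r - 1) * z)" by simp
      then show ?thesis unfolding expm X exp_of_nat_mult[symmetric] nat1 by (simp add: r_def)
    qed
    show "X ^ l \<le> real m ^ (l + 1)"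
    proof -
      have "r * z \<le> r * ((1 + 1 / r) * L)" using z_upper r by (intro mult_left_mono) auto
      also have "\<dots> = (r + 1) * L" using r by (simp add: field_simps)
      finally show ?thesis unfolding expm X exp_of_nat_mult[symmetric] by (simp add: r_def algebra_simps)
    qed
    show "128 * real l * (real m)\<^sup>2 \<le> K * T"
      using K Tm by (intro mult_mono) auto
    show "X * L \<le> K * T"
    proof -
      have "X * L \<le> X * L ^ 3" using X0 self_le_power[OF L, of 3] by (intro mult_left_mono) auto
      also have "\<dots> \<le> T" unfolding T_def using P X0 L by (simp add: pos_le_divide_eq mult.commute mult_le_cancel_right1)
      also have "\<dots> \<le> K * T" using K(3) T by simp
      finally show ?thesis .
    qed
    show "(3072 * real l * light_factor l) ^ (4 * l - 3) * real m ^ ((l + 1) * (4 * l - 3)) * L ^ (2 * l - 2)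
      \<le> X ^ ((l - 1) * (4 * l - 3) + (2 * l - 1)) * (K * T) ^ (2 * l - 2)"
    proof -
      define w where "w = (r - 1) * (4 * r - 3) + (2 * r - 1)"
      have w: "w + (2 * r - 2) = r * (4 * r - 3)" by (simp add: w_def algebra_simps)
      have "w * z + (2 * r - 2) * (3 * y + z - x) = (w + (2 * r - 2)) * z + (2 * r - 2) * (3 * y - x)" by (simp add: algebra_simps)
      also have "(w + (2 * r - 2)) * z = (a * (r * (4 * r - 3))) * (x - 2 * y) + (r * (1 + 1 / r)) * ((4 * r - 3) * L)"
        unfolding w z_def by (simp add: algebra_simps)
      also have "r * (1 + 1 / r) = r + 1" using r by (simp add: field_simps)
      \<comment> \<open>\<open>x\<close> cancels because of \<open>aa\<close>: this is the equation
        that determines the exponent \<open>a\<close>.\<close>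
      finally have e: "w * z + (2 * r - 2) * (3 * y + z - x) = (r + 1) * (4 * r - 3) * L + (2 * r - 2) * y"
        unfolding aa by (simp add: algebra_simps)
      have "real m ^ ((l + 1) * (4 * l - 3)) * L ^ (2 * l - 2) = exp ((r + 1) * (4 * r - 3) * L + (2 * r - 2) * y)"
      proof -
        have "real ((l + 1) * (4 * l - 3)) = (r + 1) * (4 * r - 3)" unfolding of_nat_mult nat1 by (simp add: r_def)
        then have "real m ^ ((l + 1) * (4 * l - 3)) = exp ((r + 1) * (4 * r - 3) * L)"
          unfolding expm exp_of_nat_mult[symmetric] by simp
        moreover have "L ^ (2 * l - 2) = exp ((2 * r - 2) * y)"
          by (subst expL) (simp only: exp_of_nat_mult[symmetric] nat1)
        ultimately show ?thesis by (simp add: exp_add)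
      qed
      also have "\<dots> = X ^ ((l - 1) * (4 * l - 3) + (2 * l - 1)) * T ^ (2 * l - 2)"
        unfolding X T exp_of_nat_mult[symmetric] of_nat_add of_nat_mult nat1 w_def[symmetric] exp_add[symmetric] e ..
      finally have main: "real m ^ ((l + 1) * (4 * l - 3)) * L ^ (2 * l - 2) = X ^ ((l - 1) * (4 * l - 3) + (2 * l - 1)) * T ^ (2 * l - 2)" .
      have "K ^ 1 \<le> K ^ (2 * l - 2)" using K(3) l by (intro power_increasing) auto
      then have "k \<le> K ^ (2 * l - 2)" using K(2) by simp
      then have "k * (real m ^ ((l + 1) * (4 * l - 3)) * L ^ (2 * l - 2))
        \<le> K ^ (2 * l - 2) * (X ^ ((l - 1) * (4 * l - 3) + (2 * l - 1)) * T ^ (2 * l - 2))"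
        unfolding main using X0 T by (intro mult_right_mono) auto
      then show ?thesis unfolding k_def[symmetric] power_mult_distrib[of K] by (simp only: mult_ac)
    qed
    show "1536 * real l * light_factor l * L * real m ^ (l - 1) \<le> X ^ (l - 1)"
    proof -
      have "(r - 1) * ((1 + \<mu>) * L + y) \<le> (r - 1) * z" using z_lower r by (intro mult_left_mono) auto
      moreover have "\<mu> * L \<le> (r - 1) * (\<mu> * L)"
        using r L by (intro mult_right_mono[of 1 "r - 1", simplified]) (auto simp: \<mu>_def)
      moreover have "0 \<le> (r - 1) * y" using r y0 by simp
      moreover have "ln G + y \<le> \<mu> * L" using big2 by (simp add: G_def y_def L_def \<mu>_def r_def)
      ultimately have "ln G + y + (r - 1) * L \<le> (r - 1) * z" by (simp add: algebra_simps)
      then have "exp (ln G + y + (r - 1) * L) \<le> exp ((r - 1) * z)" by simp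
      moreover have "exp (ln G + y + (r - 1) * L) = G * L * real m ^ (l - 1)"
        unfolding exp_add expm exp_of_nat_mult[symmetric] nat1 using G expL by simp
      ultimately have "G * L * real m ^ (l - 1) \<le> exp ((r - 1) * z)" by linarith
      moreover have "X ^ (l - 1) = exp ((r - 1) * z)" unfolding X exp_of_nat_mult[symmetric] nat1 ..
      ultimately show ?thesis by (simp only: G_def)
    qed
  qed
  then show "sparse_regime {1..m} l (real m) X (density_const l * (ln (real m) ^ 3 * X / P)) (ln (real m))"
    by (simp add: K_def T_def L_def)
qed

text \<open>The powers of \<open>n\<close> decide: \<open>(r - 1) * (4 * r - 2) < q\<close> makes
  the one in \<open>p0\<close> strictly smaller, whatever the logarithms and
  \<open>c\<close>.\<close>

lemma p0_le_p1_eventually: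
  assumes l: "2 \<le> l" and c: "0 < c"
  shows "\<forall>\<^sub>F m in sequentially. p0 c l m \<le> p1 l m \<and> p1 l m \<le> 1"
proof -
  define r where "r = real l"
  define q where "q = 4 * r\<^sup>2 - 5 * r + 2"
  define \<alpha> where "\<alpha> = (4 * r - 3) / (4 * r - 2) - (r - 1) * (4 * r - 3) / q"
  define \<beta> where "\<beta> = (4 * r\<^sup>2 + r - 4) / (2 * r - 2) - (3 + (2 * r - 2) / q)"
  have r: "2 \<le> r" using l by (simp add: r_def)
  have "0 < r * (4 * r - 5) + 2" using r by (intro add_pos_pos mult_pos_pos) auto
  then have q: "q > 0" by (simp add: q_def power2_eq_square algebra_simps)
  have \<alpha>: "\<alpha> > 0"
  proof -
    have "(r - 1) * (4 * r - 2) < q" using r by (simp add: q_def power2_eq_square algebra_simps)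
    then have "(r - 1) / q < 1 / (4 * r - 2)" using q r by (simp add: field_simps)
    then have "(4 * r - 3) * ((r - 1) / q) < (4 * r - 3) * (1 / (4 * r - 2))" using r by (intro mult_strict_left_mono) auto
    then show ?thesis by (simp add: \<alpha>_def mult.commute)
  qed
  have \<alpha>': "(r - 1) * (4 * r - 3) / q > 0" using r q by simp
  show ?thesis
    using eventually_log_log[OF \<alpha>, of \<beta> "ln c"] eventually_log_log[OF \<alpha>', of "3 + (2 * r - 2) / q" 0]
      eventually_gt_at_top[of 1]
  proof eventually_elim
    case (elim m)
    define L where "L = ln (real m)"
    have m: "real m > 0" and L: "L > 0" using elim(3) by (auto simp: L_def)
    have "p0 c l m = exp (ln c + (- ((4 * r - 3) / (4 * r - 2)) * L + (4 * r\<^sup>2 + r - 4) / (2 * r - 2) * ln L))"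
      unfolding p0_def powr_def exp_add using m L c by (simp add: r_def[symmetric] L_def[symmetric])
    moreover have p1: "p1 l m = exp (- ((r - 1) * (4 * r - 3) / q) * L + (3 + (2 * r - 2) / q) * ln L)"
      unfolding p1_def powr_def exp_add using m L
      by (simp add: r_def[symmetric] L_def[symmetric] q_def[symmetric])
    moreover have "ln c + (- ((4 * r - 3) / (4 * r - 2)) * L + (4 * r\<^sup>2 + r - 4) / (2 * r - 2) * ln L)
      \<le> - ((r - 1) * (4 * r - 3) / q) * L + (3 + (2 * r - 2) / q) * ln L"
      using elim(1) by (simp only: \<alpha>_def \<beta>_def L_def left_diff_distrib)
    moreover have "- ((r - 1) * (4 * r - 3) / q) * L + (3 + (2 * r - 2) / q) * ln L \<le> 0"
      using elim(2) by (simp add: L_def)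
    ultimately show ?case by simp
  qed
qed

theorem theorem1p7:
  fixes l :: nat
  assumes "l \<ge> 2"
  shows "\<exists>c::real. c > 0 \<and>
    (\<forall>p :: nat \<Rightarrow> real. (\<forall>n. 0 \<le> p n \<and> p n \<le> 1) \<longrightarrow>
      (\<lambda>n. measure_pmf.prob (random_hypergraph 3 n (p n))
        {H. (p0 c l n \<le> p n \<and> p n < p1 l n \<longrightarrow>
              real (ex_in H (linear_cycle 3 (2 * l)))
                \<le> c * p n powr (2 * (real l - 1) / (real l * (4 * real l - 3)))
                    * real n powr (1 + 1 / real l)
                    * ln (real n) powr (3 - (4 * real l - 4) / (real l * (4 * real l - 3)))) \<and>
            (p1 l n \<le> p n \<longrightarrow>
              real (ex_in H (linear_cycle 3 (2 * l))) \<le> c * p n * (real n)\<^sup>2)})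
      \<longlonglongrightarrow> 1)"
proof -
  define K where "K = density_const l"
  define s where "s = 4 * step_cost l"
  \<comment> \<open>\<open>2 * K\<close> bounds the expected part of a container in the random
    hypergraph, \<open>s + 1\<close> the union bound; \<open>c \<ge> 1\<close> lets
    \<open>p0 c\<close> stand in for \<open>p0 1\<close>.\<close>
  define c where "c = 2 * K + s + 1"
  define a where "a = 2 * (real l - 1) / (real l * (4 * real l - 3))"
  have s: "0 \<le> s" using step_rate_bounds[of l] by (simp add: s_def step_cost_def)
  have lf: "0 \<le> light_factor l" by (simp add: light_factor_def)
  have K: "0 \<le> K" using lf by (simp add: K_def density_const_def)
  have c: "1 \<le> c" using K s by (simp add: c_def)
  then have c0: "0 < c" by simp
  have \<mu>: "1 / (2 * real l - 1) > 0" using assms by simp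
  have lim: "(\<lambda>n. measure_pmf.prob (random_hypergraph 3 n (p n))
        {H. (p0 c l n \<le> p n \<and> p n < p1 l n \<longrightarrow>
              real (ex_in H (linear_cycle 3 (2 * l)))
                \<le> c * p n powr (2 * (real l - 1) / (real l * (4 * real l - 3)))
                    * real n powr (1 + 1 / real l)
                    * ln (real n) powr (3 - (4 * real l - 4) / (real l * (4 * real l - 3)))) \<and>
            (p1 l n \<le> p n \<longrightarrow>
              real (ex_in H (linear_cycle 3 (2 * l))) \<le> c * p n * (real n)\<^sup>2)}) \<longlonglongrightarrow> 1"
    (is "(\<lambda>n. measure_pmf.prob _ (?E n)) \<longlonglongrightarrow> 1")
    if p: "\<forall>n. 0 \<le> p n \<and> p n \<le> 1" for p :: "nat \<Rightarrow> real"
  proof (rule tendsto_sandwich[where f = "\<lambda>n. 1 - exp (- real n)" and h = "\<lambda>n. 1"])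
    show "\<forall>\<^sub>F n in sequentially. measure_pmf.prob (random_hypergraph 3 n (p n)) (?E n) \<le> 1"
      by (simp add: measure_pmf.prob_le_1)
    show "(\<lambda>n. 1 :: real) \<longlonglongrightarrow> 1" by simp
    have "((\<lambda>n. exp (- real n)) \<longlongrightarrow> 0) sequentially"
      by (rule filterlim_compose[OF exp_at_bot], rule filterlim_compose[OF filterlim_uminus_at_bot_at_top], rule filterlim_real_sequentially)
    from tendsto_diff[OF tendsto_const[of 1] this] show "(\<lambda>n. 1 - exp (- real n)) \<longlonglongrightarrow> 1" by simp
    show "\<forall>\<^sub>F n in sequentially. 1 - exp (- real n) \<le> measure_pmf.prob (random_hypergraph 3 n (p n)) (?E n)"
      using p0_le_p1_eventually[OF assms c0]
        eventually_log_log[OF \<mu>, of 0 "ln 4"] eventually_log_log[OF \<mu>, of 1 "ln (1536 * real l * light_factor l)"]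
        eventually_log_log[OF zero_less_one, of 0 1] eventually_gt_at_top[of 0]
    proof eventually_elim
      case (elim n)
      define L where "L = ln (real n)"
      \<comment> \<open>Above \<open>p1\<close> the containers are built for density
        \<open>p1\<close>, whereas the random hypergraph keeps its density
        \<open>p n\<close>.\<close>
      define P where "P = min (p n) (p1 l n)"
      define X where "X = P powr a * real n powr (1 + 1 / real l) * L powr (- 2 * a)"
      define N\<^sub>0 where "N\<^sub>0 = K * (L ^ 3 * X / P)"
      define b where "b = 2 * p n * N\<^sub>0 + (s + 1) * (X * L ^ 3)"
      have L1: "1 \<le> L" using elim(4) by (simp add: L_def)
      show ?case
      proof (cases "p0 c l n \<le> p n \<or> p1 l n \<le> p n")
        case False
        then have "?E n = UNIV" by auto
        then show ?thesis by simp
      next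
        case True
        have P1: "P \<le> p1 l n" "P \<le> p n" "P \<le> 1" "p0 c l n \<le> P" using True elim(1) p by (auto simp: P_def)
        have "0 < p0 c l n" unfolding p0_def
          by (intro mult_pos_pos) (use c elim(5) L1 in \<open>auto simp: L_def\<close>)
        then have P0: "0 < P" using P1 by linarith
        note reg = sparse_regime_of_density[OF assms c P0 P1(3,4,1)]
        have r1: "1 \<le> ln (real n)" using L1 by (simp add: L_def)
        have r2: "ln 4 \<le> ln (real n) / (2 * real l - 1)" using elim(2) by simp
        have r3: "ln (1536 * real l * light_factor l) + ln (ln (real n)) \<le> ln (real n) / (2 * real l - 1)"
          using elim(3) by (simp add: add.commute)
        have regime: "sparse_regime {1..n} l (real n) X N\<^sub>0 L"
          using reg(1)[OF r1 r2 r3] by (simp add: X_def a_def L_def N\<^sub>0_def K_def)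
        have "1 - exp (- real n) \<le> measure_pmf.prob (random_hypergraph 3 n (p n)) {H. real (ex_in H (linear_cycle 3 (2 * l))) \<le> b}"
          using p by (intro random_turan_bound[OF regime]) (auto simp: b_def s_def)
        also have "\<dots> \<le> measure_pmf.prob (random_hypergraph 3 n (p n)) (?E n)"
        proof (rule measure_pmf.finite_measure_mono)
          show "{H. real (ex_in H (linear_cycle 3 (2 * l))) \<le> b} \<subseteq> ?E n"
          proof (cases "p n < p1 l n")
            case True
            then have Pp: "P = p n" by (simp add: P_def)
            have "b = c * (X * L ^ 3)" using P0 unfolding b_def N\<^sub>0_def c_def Pp by (simp add: field_simps)
            also have "X * L ^ 3 = P powr a * real n powr (1 + 1 / real l) * (L powr (- 2 * a) * L powr 3)"
              using L1 by (simp add: X_def powr_numeral)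
            also have "L powr (- 2 * a) * L powr 3 = L powr (3 - (4 * real l - 4) / (real l * (4 * real l - 3)))"
            proof -
              have "2 * a = (4 * real l - 4) / (real l * (4 * real l - 3))"
                unfolding a_def times_divide_eq_right by (rule arg_cong[of _ _ "\<lambda>t. t / _"]) simp
              then have "- 2 * a + 3 = 3 - (4 * real l - 4) / (real l * (4 * real l - 3))" by simp
              then show ?thesis by (simp only: powr_add[symmetric])
            qed
            finally have "b = c * p n powr a * real n powr (1 + 1 / real l) * L powr (3 - (4 * real l - 4) / (real l * (4 * real l - 3)))"
              by (simp add: Pp)
            then show ?thesis using True unfolding a_def L_def by auto
          next
            case False
            then have Pp: "P = p1 l n" by (simp add: P_def)
            \<comment> \<open>At \<open>p1\<close> the containers have at most
              \<open>K * n^2\<close> triples and \<open>X * L ^ 3\<close> is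
              \<open>p1 * n^2\<close>, so both terms of \<open>b\<close> are linear in
              \<open>p n\<close>.\<close>
            have T: "L ^ 3 * X / P = (real n)\<^sup>2" using reg(2)[OF r1 r2 r3 Pp] by (simp add: X_def a_def L_def)
            then have "X * L ^ 3 = P * (real n)\<^sup>2" using P0 by (simp add: field_simps)
            also have "\<dots> \<le> p n * (real n)\<^sup>2" using P1(2) by (intro mult_right_mono) auto
            finally have "(s + 1) * (X * L ^ 3) \<le> (s + 1) * (p n * (real n)\<^sup>2)" using s by (intro mult_left_mono) auto
            then have "b \<le> c * p n * (real n)\<^sup>2" unfolding b_def N\<^sub>0_def T c_def by (simp add: algebra_simps)
            then show ?thesis using False by auto
          qed
        qed simp
        finally show ?thesis .
      qed
    qed
  qed
  show ?thesis using c lim by (intro exI[of _ c]) auto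
qed

end
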